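(* Given $k\in\mathbb{Z}$, there exists a domain $\Omega_k\subset\mathbb{P}^2$ such that $$\dim A^2(\mathbb{P}^2;\mathcal{O}(k))<\dim A^2(\Omega_k;\mathcal{O}(k))<\infty.$$ In particular, $\dim A^2(\Omega_k;\mathcal{O}(k))=1$ for $k<-2$, and $\dim A^2(\Omega_k;\mathcal{O}(k))=(k+3)(k+4)/2$ for $k\geq-2$.
   Context: $\mathbb{P}^2$ is the complex projective plane, and $\mathcal{O}(k)$ is the holomorphic line bundle on $\mathbb{P}^2$ associated to the divisor $k\{\ell\}$ for a hyperplane (projective line) $\ell\subset\mathbb{P}^2$. For an open set $D\subseteq\mathbb{P}^2$ and a holomorphic line bundle $L$ on $\mathbb{P}^2$, $\Gamma(D;L)$ is the space of holomorphic sections of $L|_D$. Given a smooth Hermitian metric $h$ on $L$ (over all of $\mathbb{P}^2$) and a smooth (positive) volume form $\omega$ on $\mathbb{P}^2$, the Bergman space is $$A^2(D;L)=\left\{s\in\Gamma(D;L):\int_D h(s,s)\,\omega<\infty\right\};$$ since $\mathbb{P}^2$ is compact, as a vector space it does not depend on the choice of $h$ and $\omega$. Dimension is complex vector space dimension. A domain is a nonempty connected open set. The domain $\Omega_k$ asserted to exist is one for which both the displayed inequalities and the stated dimension formula hold. *)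

theory Defs
  imports
    "HOL-Analysis.Analysis"
    "HOL-Library.Function_Algebras"
    "HOL-Library.Extended_Nat"
begin

section \<open>The complex projective plane\<close>

definition proj_rel :: "complex^3 \<Rightarrow> complex^3 \<Rightarrow> bool" where
  "proj_rel z w \<longleftrightarrow> z \<noteq> 0 \<and> w \<noteq> 0 \<and> (\<exists>c. c \<noteq> 0 \<and> w = c *s z)"

lemma part_equivp_proj_rel: "part_equivp proj_rel"
proof (rule part_equivpI)
  show "\<exists>z. proj_rel z z"
    by (rule exI[of _ "axis 1 1"]) (auto simp: proj_rel_def axis_eq_0_iff intro!: exI[of _ 1])
  show "symp proj_rel"
  proof (rule sympI)
    fix z w assume "proj_rel z w"
    then obtain c where c: "z \<noteq> 0" "w \<noteq> 0" "c \<noteq> 0" "w = c *s z"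
      by (auto simp: proj_rel_def)
    then have "z = inverse c *s w"
      by (simp add: vector_smult_assoc)
    then have "\<exists>d. d \<noteq> 0 \<and> z = d *s w"
      using c(3) by (intro exI[of _ "inverse c"]) simp
    with c show "proj_rel w z"
      unfolding proj_rel_def by blast
  qed
  show "transp proj_rel"
  proof (rule transpI)
    fix x y z assume "proj_rel x y" "proj_rel y z"
    then obtain c d where c: "x \<noteq> 0" "z \<noteq> 0" "c \<noteq> 0" "d \<noteq> 0" "z = d *s (c *s x)"
      unfolding proj_rel_def by blast
    then have "d * c \<noteq> 0 \<and> z = (d * c) *s x"
      by (simp add: vector_smult_assoc)
    with c(1,2) show "proj_rel x z"
      unfolding proj_rel_def by blast
  qed
qed

quotient_type P2 = "complex^3" / partial: proj_rel
  by (rule part_equivp_proj_rel)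

text \<open>The topology of \<^typ>\<open>P2\<close> is the quotient topology.  The value \<^term>\<open>abs_P2 0\<close> is
  unspecified, hence the restriction to nonzero vectors.\<close>

instantiation P2 :: topological_space
begin

definition open_P2 :: "P2 set \<Rightarrow> bool" where
  "open_P2 U \<longleftrightarrow> open {z :: complex^3. z \<noteq> 0 \<and> abs_P2 z \<in> U}"

instance
proof
  have "{z :: complex^3. z \<noteq> 0 \<and> abs_P2 z \<in> UNIV} = - {0}" by auto
  then show "open (UNIV :: P2 set)"
    unfolding open_P2_def by (simp add: open_Compl)
next
  fix S T :: "P2 set"
  assume "open S" "open T"
  moreover have "{z :: complex^3. z \<noteq> 0 \<and> abs_P2 z \<in> S \<inter> T} =
      {z. z \<noteq> 0 \<and> abs_P2 z \<in> S} \<inter> {z. z \<noteq> 0 \<and> abs_P2 z \<in> T}" by auto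
  ultimately show "open (S \<inter> T)"
    unfolding open_P2_def by (simp add: open_Int)
next
  fix K :: "P2 set set"
  assume K: "\<forall>S\<in>K. open S"
  have "{z :: complex^3. z \<noteq> 0 \<and> abs_P2 z \<in> \<Union>K} =
      (\<Union>S\<in>K. {z. z \<noteq> 0 \<and> abs_P2 z \<in> S})" by auto
  with K show "open (\<Union>K)"
    unfolding open_P2_def by (simp add: open_UN)
qed

end

text \<open>The ratio \<open>z\<^sub>j / z\<^sub>i\<close> of homogeneous coordinates, meaningful where \<open>z\<^sub>i \<noteq> 0\<close>.\<close>

lift_definition ratio :: "3 \<Rightarrow> 3 \<Rightarrow> P2 \<Rightarrow> complex" is "\<lambda>i j z. z $ j / z $ i"
  by (auto simp: proj_rel_def)

definition chart_dom :: "3 \<Rightarrow> P2 set" where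
  "chart_dom i = {abs_P2 z | z. z $ i \<noteq> 0}"

text \<open>The three affine charts, with the remaining coordinates in increasing order; recall that
  the elements of the type \<^typ>\<open>3\<close> are \<open>1\<close>, \<open>2\<close> and \<open>3 = 0\<close>.  The chart
  \<open>chart i\<close> maps \<open>chart_dom i\<close> bijectively onto \<open>\<complex>\<^sup>2\<close>, with inverse \<open>param i\<close>.\<close>

definition chart :: "3 \<Rightarrow> P2 \<Rightarrow> complex \<times> complex" where
  "chart i p =
    (if i = 1 then (ratio 1 2 p, ratio 1 3 p)
     else if i = 2 then (ratio 2 1 p, ratio 2 3 p)
     else (ratio 3 1 p, ratio 3 2 p))"

definition param :: "3 \<Rightarrow> complex \<times> complex \<Rightarrow> P2" where
  "param i x = abs_P2
    (if i = 1 then vector [1, fst x, snd x]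
     else if i = 2 then vector [fst x, 1, snd x]
     else vector [fst x, snd x, 1])"


section \<open>Smooth and holomorphic functions on \<open>\<complex>\<^sup>2\<close>\<close>

primrec Ck :: "nat \<Rightarrow> ('a::euclidean_space \<Rightarrow> 'b::real_normed_vector) \<Rightarrow> bool" where
  "Ck 0 f \<longleftrightarrow> continuous_on UNIV f"
| "Ck (Suc n) f \<longleftrightarrow>
     (\<forall>x. f differentiable at x) \<and> (\<forall>v. Ck n (\<lambda>x. frechet_derivative f (at x) v))"

definition smooth :: "('a::euclidean_space \<Rightarrow> 'b::real_normed_vector) \<Rightarrow> bool" where
  "smooth f \<longleftrightarrow> (\<forall>n. Ck n f)"

text \<open>Complex differentiability on open sets: the (real) derivative is complex linear.\<close>

definition holomorphic2_on :: "(complex \<times> complex \<Rightarrow> complex) \<Rightarrow> (complex \<times> complex) set \<Rightarrow> bool" where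
  "holomorphic2_on f S \<longleftrightarrow>
    (\<forall>x\<in>S. \<exists>a b. (f has_derivative (\<lambda>v. a * fst v + b * snd v)) (at x))"

text \<open>The determinant of the complex Jacobian matrix of a holomorphic map.  The square of its modulus
  is the real Jacobian determinant.\<close>

definition complex_jacobian :: "(complex \<times> complex \<Rightarrow> complex \<times> complex) \<Rightarrow> complex \<times> complex \<Rightarrow> complex" where
  "complex_jacobian f x =
    (let D = frechet_derivative f (at x)
     in fst (D (1, 0)) * snd (D (0, 1)) - fst (D (0, 1)) * snd (D (1, 0)))"


section \<open>Line bundles, Hermitian metrics and volume forms\<close>

text \<open>A holomorphic line bundle on \<^typ>\<open>P2\<close> is given by its transition functions \<open>L i j\<close> on
  \<open>chart_dom i \<inter> chart_dom j\<close>.  In the trivialisations over the affine charts a section is a family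
  \<open>s i\<close> of functions with \<open>s i = L i j \<cdot> s j\<close>.  (Holomorphic line bundles on \<open>\<complex>\<^sup>2\<close>
  are trivial, so these charts suffice.)\<close>

type_synonym cocycle = "3 \<Rightarrow> 3 \<Rightarrow> P2 \<Rightarrow> complex"
type_synonym sect = "3 \<Rightarrow> P2 \<Rightarrow> complex"

text \<open>If the line \<open>\<ell>\<close> is the zero set of a linear form \<open>a\<close>, then the divisor
  \<open>k{\<ell>}\<close> has the local equations \<open>(a(z) / z\<^sub>i)\<^sup>k\<close>, and the line bundle
  associated to it has as transition functions the quotients of the \<open>i\<close>-th by the \<open>j\<close>-th local
  equation, which extend to \<open>(z\<^sub>j / z\<^sub>i)\<^sup>k\<close> for every choice of \<open>a\<close>.\<close>

definition local_equation :: "complex^3 \<Rightarrow> 3 \<Rightarrow> P2 \<Rightarrow> complex" where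
  "local_equation a i p = (\<Sum>l\<in>UNIV. a $ l * ratio i l p)"

definition \<O> :: "int \<Rightarrow> cocycle" where
  "\<O> k i j p = ratio i j p powi k"

lemma nonzero_if_coord: "z $ i \<noteq> 0 \<Longrightarrow> z \<noteq> (0 :: complex^3)"
  by auto

lemma proj_rel_refl: "z \<noteq> 0 \<Longrightarrow> proj_rel z z"
  unfolding proj_rel_def by (auto intro!: exI[of _ 1])

lemma ratio_abs: "z \<noteq> 0 \<Longrightarrow> ratio i j (abs_P2 z) = z $ j / z $ i"
  by (rule ratio.abs_eq) (simp add: eq_onp_def proj_rel_refl)

lemma P2_cases: obtains z where "z \<noteq> 0" "p = abs_P2 z"
proof -
  have "proj_rel (rep_P2 p) (rep_P2 p)" "abs_P2 (rep_P2 p) = p"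
    using Quotient_P2 by (auto intro: Quotient_rep_reflp Quotient_abs_rep)
  then show ?thesis using that[of "rep_P2 p"] by (auto simp: proj_rel_def)
qed

lemma \<O>_transition:
  assumes "p \<in> chart_dom i" "p \<in> chart_dom j" "local_equation a j p \<noteq> 0"
  shows "\<O> k i j p = local_equation a i p powi k / local_equation a j p powi k"
proof -
  obtain z where z: "z $ i \<noteq> 0" "p = abs_P2 z"
    using assms(1) by (auto simp: chart_dom_def)
  obtain w where w: "w $ j \<noteq> 0" "p = abs_P2 w"
    using assms(2) by (auto simp: chart_dom_def)
  have "z \<noteq> 0" "w \<noteq> 0"
    using z(1) w(1) by (auto dest: nonzero_if_coord)
  have ij: "ratio i j p = w $ j / w $ i" and "ratio i i p = w $ i / w $ i"
    "ratio i i p = z $ i / z $ i"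
    using z w \<open>z \<noteq> 0\<close> \<open>w \<noteq> 0\<close> ratio_abs by metis+
  then have wi: "w $ i \<noteq> 0"
    using z(1) by auto
  have e: "local_equation a l p = (\<Sum>m\<in>UNIV. a $ m * w $ m) / w $ l" for l
    using \<open>w \<noteq> 0\<close> by (simp add: local_equation_def w(2) ratio_abs sum_divide_distrib)
  have "ratio i j p = local_equation a i p / local_equation a j p"
    using assms(3) wi w(1) unfolding ij e by (simp add: field_simps)
  then show ?thesis
    by (simp add: \<O>_def power_int_divide_distrib)
qed

text \<open>Holomorphic sections over an open set \<open>D\<close>; the components are set to \<open>0\<close> outside their
  domains \<open>D \<inter> chart_dom i\<close>, so that equal sections are equal functions.\<close>

definition sections :: "P2 set \<Rightarrow> cocycle \<Rightarrow> sect set" where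
  "sections D L = {s.
    (\<forall>i. holomorphic2_on (\<lambda>x. s i (param i x)) {x. param i x \<in> D}) \<and>
    (\<forall>i j. \<forall>p \<in> D \<inter> chart_dom i \<inter> chart_dom j. s i p = L i j p * s j p) \<and>
    (\<forall>i. \<forall>p. p \<notin> D \<inter> chart_dom i \<longrightarrow> s i p = 0)}"

text \<open>A smooth Hermitian metric: \<open>h(s, t) = h\<^sub>i s\<^sub>i (cnj t\<^sub>i)\<close> on \<open>chart_dom i\<close>, with
  \<open>h\<^sub>i\<close> the squared length of the \<open>i\<close>-th local frame.\<close>

definition hermitian_metric :: "cocycle \<Rightarrow> (3 \<Rightarrow> P2 \<Rightarrow> real) \<Rightarrow> bool" where
  "hermitian_metric L h \<longleftrightarrow>
    (\<forall>i. smooth (\<lambda>x. h i (param i x))) \<and>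
    (\<forall>i. \<forall>p \<in> chart_dom i. h i p > 0) \<and>
    (\<forall>i j. \<forall>p \<in> chart_dom i \<inter> chart_dom j. h j p = h i p * (cmod (L i j p))\<^sup>2)"

text \<open>A smooth positive volume form, given by its densities \<open>\<omega>\<^sub>i\<close> with respect to Lebesgue
  measure in the charts.\<close>

definition volume_form :: "(3 \<Rightarrow> P2 \<Rightarrow> real) \<Rightarrow> bool" where
  "volume_form \<omega> \<longleftrightarrow>
    (\<forall>i. smooth (\<lambda>x. \<omega> i (param i x))) \<and>
    (\<forall>i. \<forall>p \<in> chart_dom i. \<omega> i p > 0) \<and>
    (\<forall>i j. \<forall>p \<in> chart_dom i \<inter> chart_dom j.
      \<omega> i p = \<omega> j p * (cmod (complex_jacobian (chart j \<circ> param i) (chart i p)))\<^sup>2)"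

text \<open>The index of one chart around \<open>p\<close>.  By the transformation rules the two definitions after it
  do not depend on how this chart is selected.\<close>

definition chart_at :: "P2 \<Rightarrow> 3" where
  "chart_at p = (if p \<in> chart_dom 1 then 1 else if p \<in> chart_dom 2 then 2 else 3)"

definition hermitian_form :: "(3 \<Rightarrow> P2 \<Rightarrow> real) \<Rightarrow> sect \<Rightarrow> sect \<Rightarrow> P2 \<Rightarrow> complex" where
  "hermitian_form h s t p =
    (let i = chart_at p in complex_of_real (h i p) * s i p * cnj (t i p))"

text \<open>The integral over \<open>D\<close> of a nonnegative function against a volume form, computed in the charts
  along the Borel partition of \<^typ>\<open>P2\<close> into the fibres of \<^const>\<open>chart_at\<close>.\<close>

definition volume_integral ::
    "(3 \<Rightarrow> P2 \<Rightarrow> real) \<Rightarrow> P2 set \<Rightarrow> (P2 \<Rightarrow> real) \<Rightarrow> ennreal" where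
  "volume_integral \<omega> D f =
    (\<Sum>i\<in>UNIV. \<integral>\<^sup>+ x. ennreal (f (param i x) * \<omega> i (param i x)) *
      indicator {x. param i x \<in> D \<and> chart_at (param i x) = i} x \<partial>lborel)"


section \<open>Bergman spaces\<close>

definition bergman_space ::
    "(3 \<Rightarrow> P2 \<Rightarrow> real) \<Rightarrow> (3 \<Rightarrow> P2 \<Rightarrow> real) \<Rightarrow> P2 set \<Rightarrow> cocycle \<Rightarrow> sect set" where
  "bergman_space h \<omega> D L =
    {s \<in> sections D L. volume_integral \<omega> D (\<lambda>p. Re (hermitian_form h s s p)) < \<infinity>}"

definition sect_scale :: "complex \<Rightarrow> sect \<Rightarrow> sect" where
  "sect_scale c s = (\<lambda>i p. c * s i p)"

lemma vector_space_sect_scale: "vector_space sect_scale"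
  by unfold_locales (auto simp: sect_scale_def fun_eq_iff algebra_simps)

text \<open>The library dimension is \<open>0\<close> on infinite-dimensional spaces.\<close>

definition cdim :: "sect set \<Rightarrow> enat" where
  "cdim V =
    (if \<exists>B. finite B \<and> V \<subseteq> module.span sect_scale B
     then enat (vector_space.dim sect_scale V) else \<infinity>)"

end

theory Submission
  imports Defs "HOL-Complex_Analysis.Complex_Analysis"
begin

text \<open>
  Let \<open>D = max 0 (k + 2)\<close> and \<open>q = 2D - 2k - 3\<close>. In the affine chart \<open>\<complex>\<^sup>2\<close> a section of
  \<open>\<O>(k)\<close> is a function \<open>f(x, y)\<close>, and its squared norm is the integral of \<open>|f|\<^sup>2\<close>
  against a weight comparable to \<open>(1 + |x| + |y|)\<^bsup>-2k-6\<^esup>\<close>. Take for \<open>\<Omega>\<close> the union of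
  tubes around the complex lines \<open>y = x / 2\<^sup>j\<close>, of radius \<open>2\<^bsup>-j/2\<^esup> (1 + |x|)\<^bsup>-q/2\<^esup>\<close>. The exponent
  \<open>q\<close> is chosen such that polynomials of degree \<open>D\<close> are square integrable on \<open>\<Omega>\<close>, while
  a square integrable holomorphic function is, by the mean value inequality on polydiscs in a tube,
  \<open>O(|x|\<^bsup>D+1/2\<^esup>)\<close> on each of the lines, hence a polynomial of degree at most \<open>D\<close> there.
  Because the tube of the line \<open>y = x\<close> contains a neighbourhood of \<open>0\<close> and the lines accumulate, the
  homogeneous components of \<open>f\<close> of degree above \<open>D\<close> vanish. So the Bergman space of \<open>\<Omega>\<close> is
  the space of polynomials of degree at most \<open>D\<close> in two variables. Global sections restrict
  injectively to \<open>\<Omega>\<close>, but \<open>x\<^sup>D\<close> has a pole along the line at infinity as \<open>D > k\<close>.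
\<close>

section \<open>Rotation invariance and the mean value inequality\<close>

text \<open>The bookkeeping of exponents, with v = 1 + |x|: on the tubes the weight is about
  v^(-2k-6) and a slice has area about v^(-q), so a polynomial of degree D yields at most
  v^(2D-2k-6-q) = v^(-3), the largest integer power integrable over the complex plane; degree D + 1
  would yield v^(-1). Conversely, a polydisc in a tube has volume about v^2 v^(-q), which bounds
  |f|^2 by v^(2k+6+q-2) = v^(2D+1); the lost half power is harmless because degrees are integers.
  From D = k + 2 on, q is positive and the tubes narrow towards infinity. One tube controls f in one
  direction only, and a nonzero homogeneous polynomial of degree n can vanish on n lines through 0;
  hence infinitely many lines, with factors 2^(-j) that keep the total slice area finite. The
  obstacle is to reach the homogeneous components without power series in two variables. Finite
  combinations of the dilates f(p / 2^i) do this: a polynomial vanishing at the nodes 2^(-n), n <=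
  D, removes the low degrees, and Lagrange interpolation at these nodes isolates each of
  them.\<close>

lemma lborel_complex_eq_distr:
  "(lborel :: complex measure) = distr (lborel \<Otimes>\<^sub>M lborel) borel (\<lambda>(a, b). Complex a b)"
proof (rule lborel_eqI)
  have m[measurable]: "(\<lambda>(a, b). Complex a b) \<in> (lborel \<Otimes>\<^sub>M lborel) \<rightarrow>\<^sub>M borel"
    by (simp add: borel_measurable_complex_iff split_beta)
  fix l u :: complex assume le: "\<And>b. b \<in> Basis \<Longrightarrow> l \<bullet> b \<le> u \<bullet> b"
  have "(\<lambda>(a, b). Complex a b) -` box l u = {Re l<..<Re u} \<times> {Im l<..<Im u}"
    by (auto simp: box_def Basis_complex_def)
  moreover have "Re l \<le> Re u" "Im l \<le> Im u"
    using le[of 1] le[of \<i>] by (auto simp: Basis_complex_def)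
  ultimately show "emeasure (distr (lborel \<Otimes>\<^sub>M lborel) borel (\<lambda>(a, b). Complex a b)) (box l u)
      = (\<Prod>b\<in>Basis. (u - l) \<bullet> b)"
    by (simp add: emeasure_distr space_pair_measure lborel.emeasure_pair_measure_Times Basis_complex_def
        ennreal_mult)
qed simp

text \<open>In real and imaginary parts a shear is, for each fixed value of one part, a translation
  of the real line in the other.\<close>

lemma nn_integral_lborel_complex:
  fixes h :: "complex \<Rightarrow> ennreal"
  assumes [measurable]: "h \<in> borel_measurable borel"
  shows "(\<integral>\<^sup>+z. h z \<partial>lborel) = (\<integral>\<^sup>+a. \<integral>\<^sup>+b. h (Complex a b) \<partial>lborel \<partial>lborel)"
proof -
  have m[measurable]: "(\<lambda>p. Complex (fst p) (snd p)) \<in> (lborel \<Otimes>\<^sub>M lborel) \<rightarrow>\<^sub>M borel"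
    by (simp add: borel_measurable_complex_iff)
  have "(\<integral>\<^sup>+z. h z \<partial>lborel) = (\<integral>\<^sup>+p. h (Complex (fst p) (snd p)) \<partial>(lborel \<Otimes>\<^sub>M lborel))"
    by (subst lborel_complex_eq_distr) (simp add: nn_integral_distr split_beta)
  then show ?thesis
    by (simp add: lborel.nn_integral_fst[symmetric])
qed

lemma measurable_of_Re_Im:
  fixes h :: "complex \<Rightarrow> ennreal"
  assumes [measurable]: "h \<in> borel_measurable borel"
    "f \<in> borel_measurable M" "g \<in> borel_measurable M"
  shows "(\<lambda>z. h (Complex (f z) (g z))) \<in> borel_measurable M"
proof -
  have "(\<lambda>z. Complex (f z) (g z)) \<in> borel_measurable M"
    using assms by (simp add: borel_measurable_complex_iff)
  then show ?thesis by measurable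
qed

lemma nn_integral_lborel_translate:
  fixes h :: "'a::euclidean_space \<Rightarrow> ennreal"
  assumes [measurable]: "h \<in> borel_measurable borel"
  shows "(\<integral>\<^sup>+z. h (c + z) \<partial>lborel) = (\<integral>\<^sup>+z. h z \<partial>lborel)"
proof -
  have "(\<integral>\<^sup>+z. h z \<partial>lborel) = (\<integral>\<^sup>+z. h z \<partial>distr lborel borel ((+) c))"
    by (simp add: lborel_distr_plus)
  then show ?thesis by (simp add: nn_integral_distr)
qed

lemma nn_integral_shear_Im:
  fixes h :: "complex \<Rightarrow> ennreal"
  assumes [measurable]: "h \<in> borel_measurable borel"
  shows "(\<integral>\<^sup>+z. h (Complex (Re z) (Im z + s * Re z)) \<partial>lborel) = (\<integral>\<^sup>+z. h z \<partial>lborel)"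
proof -
  have [measurable]: "(\<lambda>b. h (Complex a b)) \<in> borel_measurable borel" for a
    by (rule measurable_of_Re_Im) simp_all
  have "(\<integral>\<^sup>+b. h (Complex a (b + s * a)) \<partial>lborel) = (\<integral>\<^sup>+b. h (Complex a b) \<partial>lborel)" for a
    using nn_integral_lborel_translate[of "\<lambda>b. h (Complex a b)" "s * a"]
    by (simp add: add.commute)
  moreover have "(\<lambda>z. h (Complex (Re z) (Im z + s * Re z))) \<in> borel_measurable borel"
    by (rule measurable_of_Re_Im) simp_all
  ultimately show ?thesis
    by (simp add: nn_integral_lborel_complex)
qed

text \<open>The translated variable is now the outer one, so the order of integration is exchanged
  before and after the translation.\<close>

lemma nn_integral_shear_Re:
  fixes h :: "complex \<Rightarrow> ennreal"
  assumes [measurable]: "h \<in> borel_measurable borel"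
  shows "(\<integral>\<^sup>+z. h (Complex (Re z + s * Im z) (Im z)) \<partial>lborel) = (\<integral>\<^sup>+z. h z \<partial>lborel)"
proof -
  have [measurable]: "(\<lambda>(x, y). h (Complex (x + s * y) y)) \<in> borel_measurable (lborel \<Otimes>\<^sub>M lborel)"
    "(\<lambda>(x, y). h (Complex x y)) \<in> borel_measurable (lborel \<Otimes>\<^sub>M lborel)"
    unfolding split_beta by (rule measurable_of_Re_Im; simp)+
  have "(\<integral>\<^sup>+a. h (Complex (a + s * b) b) \<partial>lborel) = (\<integral>\<^sup>+a. h (Complex a b) \<partial>lborel)" for b
    using nn_integral_lborel_translate[of "\<lambda>a. h (Complex a b)" "s * b"]
    by (simp add: add.commute measurable_of_Re_Im)
  then show ?thesis
    by (simp add: nn_integral_lborel_complex measurable_of_Re_Im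
        lborel_pair.Fubini'[of "\<lambda>a b. h (Complex (a + s * b) b)", symmetric]
        lborel_pair.Fubini'[of "\<lambda>a b. h (Complex a b)", symmetric])
qed

text \<open>A rotation by an angle \<open>\<theta> \<noteq> \<pi>\<close> is a product of three shears, with factors
  \<open>-tan (\<theta>/2)\<close>, \<open>sin \<theta>\<close> and \<open>-tan (\<theta>/2)\<close>.\<close>

lemma nn_integral_rotate:
  fixes h :: "complex \<Rightarrow> ennreal"
  assumes [measurable]: "h \<in> borel_measurable borel" and e: "cmod e = 1"
  shows "(\<integral>\<^sup>+z. h (e * z) \<partial>lborel) = (\<integral>\<^sup>+z. h z \<partial>lborel)"
proof -
  have *: "(\<integral>\<^sup>+z. h (e * z) \<partial>lborel) = (\<integral>\<^sup>+z. h z \<partial>lborel)"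
    if [measurable]: "h \<in> borel_measurable borel" and e: "cmod e = 1" "e \<noteq> -1"
    for e and h :: "complex \<Rightarrow> ennreal"
  proof -
    define c s where "c = Re e" and "s = Im e"
    have cs: "c\<^sup>2 + s\<^sup>2 = 1"
      using e cmod_power2[of e] by (simp add: c_def s_def)
    have c1: "1 + c \<noteq> 0"
    proof
      assume "1 + c = 0"
      then have "c = -1" by simp
      with cs have "s = 0" by simp
      with \<open>c = -1\<close> e show False by (simp add: c_def s_def complex_eq_iff)
    qed
    \<comment> \<open>This is minus the tangent of half the angle. The identities \<open>ts\<close>
      and \<open>tc\<close> are what reduces the product of the three shears to multiplication by
      e.\<close>
    define t where "t = - (s / (1 + c))"
    have ts: "t * s = c - 1"
      using cs c1 by (simp add: t_def field_simps power2_eq_square)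
    have tc: "t * (1 + c) = - s"
      using c1 by (simp add: t_def)
    define h1 where "h1 z = h (Complex (Re z + t * Im z) (Im z))" for z
    define h2 where "h2 z = h1 (Complex (Re z) (Im z + s * Re z))" for z
    have [measurable]: "h1 \<in> borel_measurable borel"
      unfolding h1_def by (rule measurable_of_Re_Im) simp_all
    have [measurable]: "h2 \<in> borel_measurable borel"
      unfolding h2_def by (rule measurable_of_Re_Im) simp_all
    have "h2 (Complex (Re z + t * Im z) (Im z)) = h (e * z)" for z
    proof -
      have "Im z + s * (Re z + t * Im z) = (t * s + 1) * Im z + s * Re z"
        by (simp add: algebra_simps)
      also have "\<dots> = Im (e * z)"
        by (simp add: ts) (simp add: c_def s_def algebra_simps)
      finally have 1: "Im z + s * (Re z + t * Im z) = Im (e * z)" .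
      have "Re z + t * Im z + t * (Im z + s * (Re z + t * Im z))
          = (t * s + 1) * Re z + t * (1 + (t * s + 1)) * Im z"
        by (simp add: algebra_simps)
      also have "\<dots> = Re (e * z)"
        by (simp add: ts tc) (simp add: c_def s_def algebra_simps)
      finally show ?thesis
        unfolding h2_def h1_def complex.sel 1 by (simp only: complex_surj)
    qed
    then have "(\<integral>\<^sup>+z. h (e * z) \<partial>lborel) = (\<integral>\<^sup>+z. h2 z \<partial>lborel)"
      using nn_integral_shear_Re[of h2 t] by simp
    also have "\<dots> = (\<integral>\<^sup>+z. h1 z \<partial>lborel)"
      unfolding h2_def by (rule nn_integral_shear_Im) simp
    also have "\<dots> = (\<integral>\<^sup>+z. h z \<partial>lborel)"
      unfolding h1_def by (rule nn_integral_shear_Re) simp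
    finally show ?thesis .
  qed
  show ?thesis
  proof (cases "e = -1")
    case True
    \<comment> \<open>The half turn has \<open>1 + c = 0\<close> and hence no t; it is composed of
      two quarter turns.\<close>
    have [measurable]: "(\<lambda>z. h (\<i> * z)) \<in> borel_measurable borel"
      by measurable
    have "(\<integral>\<^sup>+z. h (e * z) \<partial>lborel) = (\<integral>\<^sup>+z. h (\<i> * (\<i> * z)) \<partial>lborel)"
      by (simp add: True mult.assoc[symmetric])
    also have "\<dots> = (\<integral>\<^sup>+z. h (\<i> * z) \<partial>lborel)"
      by (rule *[of "\<lambda>z. h (\<i> * z)" \<i>]) (auto simp: complex_eq_iff)
    also have "\<dots> = (\<integral>\<^sup>+z. h z \<partial>lborel)"
      by (rule *[of h \<i>]) (auto simp: complex_eq_iff)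
    finally show ?thesis .
  qed (use * assms in auto)
qed

lemma nn_integral_lborel_pair:
  fixes h :: "'a::euclidean_space \<times> 'b::euclidean_space \<Rightarrow> ennreal"
  assumes [measurable]: "h \<in> borel_measurable borel"
  shows "(\<integral>\<^sup>+p. h p \<partial>lborel) = (\<integral>\<^sup>+x. \<integral>\<^sup>+y. h (x, y) \<partial>lborel \<partial>lborel)"
proof -
  have "h \<in> borel_measurable (lborel \<Otimes>\<^sub>M lborel)"
    by (simp add: lborel_prod)
  from lborel.nn_integral_fst[OF this] show ?thesis
    by (simp add: lborel_prod)
qed

text \<open>The measure is a product, so the common rotation is applied to one factor at a
  time.\<close>

lemma nn_integral_rotate_pair:
  fixes h :: "complex \<times> complex \<Rightarrow> ennreal"
  assumes [measurable]: "h \<in> borel_measurable borel" and e: "cmod e = 1"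
  shows "(\<integral>\<^sup>+p. h (e * fst p, e * snd p) \<partial>lborel) = (\<integral>\<^sup>+p. h p \<partial>lborel)"
proof -
  have m1: "(\<lambda>p. h (e * fst p, e * snd p)) \<in> borel_measurable borel"
    by (rule measurable_compose[OF borel_measurable_continuous_onI assms(1)]) (intro continuous_intros)
  have m2: "(\<lambda>y. h (x, y)) \<in> borel_measurable borel" for x
    by (rule measurable_compose[OF borel_measurable_continuous_onI assms(1)]) (intro continuous_intros)
  have [measurable]: "h \<in> borel_measurable (lborel \<Otimes>\<^sub>M lborel)"
    by (simp add: lborel_prod)
  have m3: "(\<lambda>x. \<integral>\<^sup>+y. h (x, y) \<partial>lborel) \<in> borel_measurable borel"
    using lborel.borel_measurable_nn_integral_fst[of h lborel] by simp
  have "(\<integral>\<^sup>+p. h (e * fst p, e * snd p) \<partial>lborel)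
      = (\<integral>\<^sup>+x. \<integral>\<^sup>+y. h (e * x, e * y) \<partial>lborel \<partial>lborel)"
    by (simp add: nn_integral_lborel_pair m1)
  also have "\<dots> = (\<integral>\<^sup>+x. \<integral>\<^sup>+y. h (e * x, y) \<partial>lborel \<partial>lborel)"
    by (simp add: nn_integral_rotate[OF m2 e])
  also have "\<dots> = (\<integral>\<^sup>+x. \<integral>\<^sup>+y. h (x, y) \<partial>lborel \<partial>lborel)"
    by (rule nn_integral_rotate[OF m3 e])
  finally show ?thesis
    by (simp add: nn_integral_lborel_pair)
qed

section \<open>Complex lines and the mean value inequality for |f|^2\<close>

lemma holomorphic2_on_line:
  assumes "holomorphic2_on f S" "\<And>t. t \<in> T \<Longrightarrow> (a + t * b, c + t * d) \<in> S"
  shows "(\<lambda>t. f (a + t * b, c + t * d)) holomorphic_on T"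
proof (rule holomorphic_onI)
  fix t assume "t \<in> T"
  then obtain A B where
    "(f has_derivative (\<lambda>v. A * fst v + B * snd v)) (at (a + t * b, c + t * d))"
    using assms unfolding holomorphic2_on_def by blast
  moreover have "((\<lambda>t. (a + t * b, c + t * d)) has_derivative (\<lambda>h. (h * b, h * d))) (at t)"
    by (auto intro!: derivative_eq_intros)
  ultimately have "((\<lambda>t. f (a + t * b, c + t * d)) has_derivative
      (\<lambda>h. A * (h * b) + B * (h * d))) (at t)"
    using has_derivative_compose[of "\<lambda>t. (a + t * b, c + t * d)"] by fastforce
  then have "((\<lambda>t. f (a + t * b, c + t * d)) has_field_derivative (A * b + B * d)) (at t)"
    unfolding has_field_derivative_def
    by (rule has_derivative_eq_rhs) (auto simp: algebra_simps)
  then show "(\<lambda>t. f (a + t * b, c + t * d)) field_differentiable at t within T"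
    using field_differentiable_at_within field_differentiable_def by blast
qed

lemma holomorphic2_on_subset: "holomorphic2_on f S \<Longrightarrow> T \<subseteq> S \<Longrightarrow> holomorphic2_on f T"
  unfolding holomorphic2_on_def by blast

lemma holomorphic2_on_imp_continuous_on: "holomorphic2_on f S \<Longrightarrow> continuous_on S f"
  unfolding holomorphic2_on_def
  by (meson continuous_at_imp_continuous_on has_derivative_continuous)

text \<open>Cauchy's formula is applied to the square of g instead of g: the value at the centre is
  a circle mean of the square, and moving the modulus inside gives the L2 estimate without
  Cauchy-Schwarz.\<close>

lemma norm_squared_le_circle_mean:
  assumes "g holomorphic_on T" "open T" "cball 0 1 \<subseteq> T"
  shows "ennreal ((cmod (g 0))\<^sup>2)
    \<le> (\<integral>\<^sup>+t. ennreal ((cmod (g (exp (2 * of_real pi * \<i> * of_real t))))\<^sup>2) * indicator {0..1} t \<partial>lborel)"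
proof -
  define e where "e t = exp (2 * of_real pi * \<i> * of_real t)" for t :: real
  have e1: "cmod (e t) = 1" for t
    by (simp add: e_def norm_exp_eq_Re)
  have cont_e: "continuous_on S e" for S
    unfolding e_def by (intro continuous_intros)
  have cont: "continuous_on {0..1} (\<lambda>t. g (e t))"
    by (rule continuous_on_compose2[OF holomorphic_on_imp_continuous_on[OF assms(1)] cont_e])
      (use e1 assms(3) in \<open>auto simp: subset_iff\<close>)
  have inv: "inverse (2 * of_real pi * \<i>) * ((2 * of_real pi * \<i>) * z) = z" for z
    by (simp add: field_simps)
  have circ: "circlepath 0 1 t = e t" for t
    by (simp add: circlepath e_def)
  have "((\<lambda>u. (g u)\<^sup>2 / (u - 0)) has_contour_integral (2 * of_real pi * \<i> * (g 0)\<^sup>2)) (circlepath 0 1)"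
    by (rule Cauchy_integral_circlepath_simple)
      (auto intro!: holomorphic_intros holomorphic_on_subset[OF assms(1) assms(3)])
  then have "((\<lambda>t. (g (e t))\<^sup>2 / e t * (2 * of_real pi * \<i> * e t)) has_integral
      2 * of_real pi * \<i> * (g 0)\<^sup>2) {0..1}"
    unfolding has_contour_integral_def
    by (rule has_integral_eq[rotated]) (simp add: vector_derivative_circlepath01 circ e_def)
  then have "((\<lambda>t. (2 * of_real pi * \<i>) * (g (e t))\<^sup>2) has_integral
      2 * of_real pi * \<i> * (g 0)\<^sup>2) {0..1}"
    by (rule has_integral_eq[rotated]) (simp add: e_def field_simps)
  from has_integral_mult_right[OF this, of "inverse (2 * of_real pi * \<i>)"]
  have int: "((\<lambda>t. (g (e t))\<^sup>2) has_integral (g 0)\<^sup>2) {0..1}"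
    unfolding inv .
  have int2: "(\<lambda>t. (cmod (g (e t)))\<^sup>2) integrable_on {0..1}"
    by (intro integrable_continuous_real continuous_intros cont)
  have "cmod ((g 0)\<^sup>2) \<le> integral {0..1} (\<lambda>t. (cmod (g (e t)))\<^sup>2)"
    using integral_norm_bound_integral[OF has_integral_integrable[OF int] int2] int
    by (simp add: norm_power integral_unique)
  moreover have "(\<integral>\<^sup>+t. ennreal ((cmod (g (e t)))\<^sup>2) * indicator {0..1} t \<partial>lborel)
      = ennreal (integral {0..1} (\<lambda>t. (cmod (g (e t)))\<^sup>2))"
  proof (rule nn_integral_has_integral_lebesgue')
    show "((\<lambda>t. (cmod (g (e t)))\<^sup>2) has_integral integral {0..1} (\<lambda>t. (cmod (g (e t)))\<^sup>2)) {0..1}"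
      using int2 by (rule integrable_integral)
  qed simp
  ultimately show ?thesis
    unfolding e_def[symmetric] by (simp add: norm_power ennreal_leI)
qed

text \<open>For each v in S the disc of points t v lies in S, so the one-variable inequality holds
  on its boundary circle. Integrating over v and exchanging integrals, every rotation contributes
  the same amount. Since only circularity of S enters, S may later be a polydisc sheared along a
  slanted tube.\<close>

lemma mean_value_circular_set:
  assumes hol: "holomorphic2_on f U" and U: "open U" and S: "S \<in> sets borel"
    and sub: "\<And>v. v \<in> S \<Longrightarrow> (a + fst v, b + snd v) \<in> U"
    and circ: "\<And>v t. v \<in> S \<Longrightarrow> cmod t \<le> 1 \<Longrightarrow> (t * fst v, t * snd v) \<in> S"
  shows "ennreal ((cmod (f (a, b)))\<^sup>2) * emeasure lborel S
    \<le> (\<integral>\<^sup>+v. ennreal ((cmod (f (a + fst v, b + snd v)))\<^sup>2) * indicator S v \<partial>lborel)"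
proof -
  define e where "e t = exp (2 * of_real pi * \<i> * of_real t)" for t :: real
  have e1: "cmod (e t) = 1" for t
    by (simp add: e_def norm_exp_eq_Re)
  define H where "H v = ennreal ((cmod (f (a + fst v, b + snd v)))\<^sup>2) * indicator S v" for v
  have Heq: "H = (\<lambda>v. ennreal ((cmod (indicator S v *\<^sub>R f (a + fst v, b + snd v)))\<^sup>2))"
    by (auto simp: H_def fun_eq_iff indicator_def)
  \<comment> \<open>f is continuous only on U, so measurability is established for the product with
    the indicator of S.\<close>
  have "continuous_on S (\<lambda>v. f (a + fst v, b + snd v))"
    by (rule continuous_on_compose2[OF holomorphic2_on_imp_continuous_on[OF hol]])
      (auto intro!: continuous_intros sub)
  from borel_measurable_continuous_on_indicator[OF S this]
  have Hm[measurable]: "H \<in> borel_measurable borel"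
    unfolding Heq by measurable
  have pm: "(\<lambda>(v, t). H (e t * fst v, e t * snd v) * indicator {0..1} t) \<in> borel_measurable (lborel \<Otimes>\<^sub>M lborel)"
  proof -
    have "(\<lambda>p. (e (snd p) * fst (fst p), e (snd p) * snd (fst p))) \<in> borel_measurable borel"
      unfolding e_def by (intro borel_measurable_continuous_onI continuous_intros)
    from measurable_compose[OF this Hm]
    have "(\<lambda>p. H (e (snd p) * fst (fst p), e (snd p) * snd (fst p))) \<in> borel_measurable (lborel \<Otimes>\<^sub>M lborel)"
      by (simp add: lborel_prod)
    then show ?thesis
      unfolding split_beta by measurable
  qed
  have "ennreal ((cmod (f (a, b)))\<^sup>2) * emeasure lborel S
      = (\<integral>\<^sup>+v. ennreal ((cmod (f (a, b)))\<^sup>2) * indicator S v \<partial>lborel)"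
    using S by (simp add: nn_integral_cmult_indicator)
  also have "\<dots> \<le> (\<integral>\<^sup>+v. \<integral>\<^sup>+t. H (e t * fst v, e t * snd v) * indicator {0..1} t \<partial>lborel \<partial>lborel)"
  proof (rule nn_integral_mono)
    fix v :: "complex \<times> complex"
    show "ennreal ((cmod (f (a, b)))\<^sup>2) * indicator S v
      \<le> (\<integral>\<^sup>+t. H (e t * fst v, e t * snd v) * indicator {0..1} t \<partial>lborel)"
    proof (cases "v \<in> S")
      case True
      define T where "T = (\<lambda>t. (a + t * fst v, b + t * snd v)) -` U"
      have "open T"
        unfolding T_def by (intro open_vimage U continuous_intros)
      moreover have "cball 0 1 \<subseteq> T"
        using True circ sub by (fastforce simp: T_def)
      moreover have "(\<lambda>t. f (a + t * fst v, b + t * snd v)) holomorphic_on T"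
        by (rule holomorphic2_on_line[OF hol]) (simp add: T_def)
      ultimately have "ennreal ((cmod (f (a + 0 * fst v, b + 0 * snd v)))\<^sup>2)
        \<le> (\<integral>\<^sup>+t. ennreal ((cmod (f (a + e t * fst v, b + e t * snd v)))\<^sup>2) * indicator {0..1} t \<partial>lborel)"
        unfolding e_def by (intro norm_squared_le_circle_mean)
      also have "\<dots> = (\<integral>\<^sup>+t. H (e t * fst v, e t * snd v) * indicator {0..1} t \<partial>lborel)"
        using circ[OF True] e1 by (simp add: H_def)
      finally show ?thesis using True by simp
    qed simp
  qed
  also have "\<dots> = (\<integral>\<^sup>+t. \<integral>\<^sup>+v. H (e t * fst v, e t * snd v) * indicator {0..1} t \<partial>lborel \<partial>lborel)"
    using lborel_pair.Fubini'[OF pm] by simp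
  \<comment> \<open>By rotation invariance in both coordinates the inner integral no longer depends
    on t.\<close>
  also have "\<dots> = (\<integral>\<^sup>+t. (\<integral>\<^sup>+v. H v \<partial>lborel) * indicator {0..1::real} t \<partial>lborel)"
  proof (rule nn_integral_cong)
    fix t :: real
    have [measurable]: "(\<lambda>v. H (e t * fst v, e t * snd v)) \<in> borel_measurable borel"
      by (rule measurable_compose[OF borel_measurable_continuous_onI Hm]) (intro continuous_intros)
    show "(\<integral>\<^sup>+v. H (e t * fst v, e t * snd v) * indicator {0..1} t \<partial>lborel)
        = (\<integral>\<^sup>+v. H v \<partial>lborel) * indicator {0..1} t"
      by (simp add: nn_integral_multc nn_integral_rotate_pair e1)
  qed
  also have "\<dots> = (\<integral>\<^sup>+v. H v \<partial>lborel)"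
    by (simp add: nn_integral_cmult_indicator)
  finally show ?thesis
    by (simp add: H_def)
qed

section \<open>Holomorphic functions that are polynomials on many lines\<close>

lemma holomorphic2_on_const: "holomorphic2_on (\<lambda>p. c) S"
  unfolding holomorphic2_on_def by (auto intro!: exI[of _ 0] derivative_eq_intros)

lemma holomorphic2_on_add:
  assumes "holomorphic2_on f S" "holomorphic2_on g S"
  shows "holomorphic2_on (\<lambda>p. f p + g p) S"
  unfolding holomorphic2_on_def
proof
  fix p assume "p \<in> S"
  with assms obtain a b c d where
    "(f has_derivative (\<lambda>v. a * fst v + b * snd v)) (at p)"
    "(g has_derivative (\<lambda>v. c * fst v + d * snd v)) (at p)"
    unfolding holomorphic2_on_def by meson
  from has_derivative_add[OF this]
  have "((\<lambda>p. f p + g p) has_derivative (\<lambda>v. (a + c) * fst v + (b + d) * snd v)) (at p)"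
    by (simp add: algebra_simps)
  then show "\<exists>a b. ((\<lambda>p. f p + g p) has_derivative (\<lambda>v. a * fst v + b * snd v)) (at p)"
    by blast
qed

lemma holomorphic2_on_cmult:
  assumes "holomorphic2_on f S"
  shows "holomorphic2_on (\<lambda>p. c * f p) S"
  unfolding holomorphic2_on_def
proof
  fix p assume "p \<in> S"
  with assms obtain a b where
    "(f has_derivative (\<lambda>v. a * fst v + b * snd v)) (at p)"
    unfolding holomorphic2_on_def by meson
  from has_derivative_mult_right[OF this, of c]
  have "((\<lambda>p. c * f p) has_derivative (\<lambda>v. (c * a) * fst v + (c * b) * snd v)) (at p)"
    by (simp add: algebra_simps)
  then show "\<exists>a b. ((\<lambda>p. c * f p) has_derivative (\<lambda>v. a * fst v + b * snd v)) (at p)"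
    by blast
qed

lemma holomorphic2_on_sum:
  "(\<And>i. i \<in> I \<Longrightarrow> holomorphic2_on (f i) S) \<Longrightarrow> holomorphic2_on (\<lambda>p. \<Sum>i\<in>I. f i p) S"
  by (induction I rule: infinite_finite_induct)
    (auto intro: holomorphic2_on_const holomorphic2_on_add)

lemma holomorphic2_on_monomial: "holomorphic2_on (\<lambda>p. fst p ^ m * snd p ^ n) S"
proof -
  have "((\<lambda>p. fst p ^ m * snd p ^ n) has_derivative
      (\<lambda>v. (of_nat m * fst p ^ (m - 1) * snd p ^ n) * fst v + (fst p ^ m * (of_nat n * snd p ^ (n - 1))) * snd v)) (at p)"
    for p :: "complex \<times> complex"
    by (auto intro!: derivative_eq_intros simp: algebra_simps)
  then show ?thesis
    unfolding holomorphic2_on_def by blast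
qed

lemma holomorphic2_on_scale:
  assumes "holomorphic2_on f S" "\<And>p. p \<in> T \<Longrightarrow> (fst p * c, snd p * c) \<in> S"
  shows "holomorphic2_on (\<lambda>p. f (fst p * c, snd p * c)) T"
  unfolding holomorphic2_on_def
proof
  fix p assume "p \<in> T"
  then obtain a b where
    1: "(f has_derivative (\<lambda>v. a * fst v + b * snd v)) (at (fst p * c, snd p * c))"
    using assms unfolding holomorphic2_on_def by meson
  have 2: "((\<lambda>p. (fst p * c, snd p * c)) has_derivative (\<lambda>v. (fst v * c, snd v * c))) (at p)"
    by (auto intro!: derivative_eq_intros)
  have "((\<lambda>p. f (fst p * c, snd p * c)) has_derivative (\<lambda>v. (a * c) * fst v + (b * c) * snd v)) (at p)"
    using has_derivative_compose[OF 2 1] by (simp add: algebra_simps)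
  then show "\<exists>a b. ((\<lambda>p. f (fst p * c, snd p * c)) has_derivative (\<lambda>v. a * fst v + b * snd v)) (at p)"
    by blast
qed

section \<open>Taylor expansion along lines through the origin\<close>

lemma power_series_unique:
  fixes a b :: "nat \<Rightarrow> complex"
  assumes "r > 0" "\<And>t. norm t < r \<Longrightarrow> (\<lambda>n. a n * t ^ n) sums f t"
    "\<And>t. norm t < r \<Longrightarrow> (\<lambda>n. b n * t ^ n) sums f t"
  shows "a n = b n"
proof (rule ccontr)
  assume "a n \<noteq> b n"
  have s: "(\<lambda>n. (a n - b n) * t ^ n) sums 0" if "norm t < r" for t
    using sums_diff[OF assms(2,3)[OF that]] by (simp add: algebra_simps)
  \<comment> \<open>\<open>powser_0_nonzero\<close> asks for a nonzero coefficient of positive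
    index, so the constant terms are compared separately.\<close>
  have "a 0 - b 0 = 0"
    using s[of 0] \<open>r > 0\<close> by simp
  with \<open>a n \<noteq> b n\<close> have "n > 0" by (cases n) auto
  show False
  proof (rule powser_0_nonzero[of r 0 "\<lambda>n. a n - b n" "\<lambda>_. 0" n])
    fix d :: real
    assume "0 < d" "\<And>z::complex. z \<in> cball 0 d - {0} \<Longrightarrow> (0::complex) \<noteq> 0"
    from this(2)[of "of_real d"] this(1) show False by simp
  qed (use s \<open>r > 0\<close> \<open>n > 0\<close> \<open>a n \<noteq> b n\<close> in auto)
qed

text \<open>Both coordinates are strictly smaller than r, which leaves room for a disc of radius s >
  1 in t. The series therefore also holds at t = 1, and \<open>g n\<close> is the value at (x, y) of
  the component of degree n.\<close>

lemma Taylor_along_line: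
  assumes "holomorphic2_on f (ball 0 r \<times> ball 0 r)" "x \<in> ball 0 r" "y \<in> ball 0 r"
  obtains g where "\<And>t. cmod t \<le> 1 \<Longrightarrow> (\<lambda>n. g n * t ^ n) sums f (x * t, y * t)"
proof -
  define m where "m = max (cmod x) (cmod y)"
  have m: "0 \<le> m" "m < r" "cmod x \<le> m" "cmod y \<le> m"
    using assms(2,3) by (auto simp: m_def le_max_iff_disj)
  obtain s where s: "1 < s" "m * s < r"
  proof (cases "m = 0")
    case True
    then show ?thesis using that[of 2] m(2) by simp
  next
    case False
    then have "1 < r / m" using m by simp
    then obtain s where "1 < s" "s < r / m" using dense by blast
    then show ?thesis using that[of s] m False by (simp add: field_simps)
  qed
  define G where "G t = f (0 + t * x, 0 + t * y)" for t
  have "G holomorphic_on ball 0 s"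
    unfolding G_def
  proof (rule holomorphic2_on_line[OF assms(1)])
    fix t assume t: "t \<in> ball (0::complex) s"
    have "cmod (t * x) \<le> s * m" "cmod (t * y) \<le> s * m"
      unfolding norm_mult using t m s by (auto intro!: mult_mono)
    then show "(0 + t * x, 0 + t * y) \<in> ball 0 r \<times> ball 0 r"
      using s by (simp add: mult.commute)
  qed
  from holomorphic_power_series[OF this]
  have "(\<lambda>n. (deriv ^^ n) G 0 / fact n * t ^ n) sums f (x * t, y * t)" if "cmod t \<le> 1" for t
    using that s by (auto simp: G_def mult.commute)
  then show ?thesis by (rule that)
qed

text \<open>On a monomial of total degree \<open>n\<close> the operator \<open>dilation_sum q\<close> is multiplication
  by \<open>q(2\<^sup>-\<^sup>n)\<close>.\<close>

definition dilation_sum :: "complex poly \<Rightarrow> (complex \<times> complex \<Rightarrow> complex) \<Rightarrow> complex \<times> complex \<Rightarrow> complex" where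
  "dilation_sum q f p = (\<Sum>i\<le>degree q. coeff q i * f (fst p * (1/2) ^ i, snd p * (1/2) ^ i))"

lemma mult_half_power_in_ball: "x \<in> ball 0 r \<Longrightarrow> x * (1/2) ^ i \<in> ball (0::complex) r"
  using mult_left_le[of "(1/2) ^ i" "cmod x"]
  by (simp add: norm_mult norm_power norm_divide power_le_one)

lemma holomorphic2_on_dilation_sum:
  "holomorphic2_on f (ball 0 r \<times> ball 0 r) \<Longrightarrow> holomorphic2_on (dilation_sum q f) (ball 0 r \<times> ball 0 r)"
  unfolding dilation_sum_def
  by (intro holomorphic2_on_sum holomorphic2_on_cmult holomorphic2_on_scale)
    (auto simp: mult_half_power_in_ball simp del: mem_ball mem_ball_0)

text \<open>Dilation by 2^(-i) multiplies the n-th coefficient by (2^(-i))^n = (2^(-n))^i; summing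
  against the coefficients of q evaluates q at 2^(-n).\<close>

lemma dilation_sum_sums:
  assumes g: "\<And>t. cmod t \<le> 1 \<Longrightarrow> (\<lambda>n. g n * t ^ n) sums f (x * t, y * t)" and t: "cmod t \<le> 1"
  shows "(\<lambda>n. g n * poly q ((1/2) ^ n) * t ^ n) sums dilation_sum q f (x * t, y * t)"
proof -
  have "(\<lambda>n. coeff q i * (g n * (t * (1/2) ^ i) ^ n)) sums (coeff q i * f (x * t * (1/2) ^ i, y * t * (1/2) ^ i))" for i
  proof -
    have "cmod (t * (1/2) ^ i) \<le> 1"
      using t by (simp add: norm_mult norm_power norm_divide mult_le_one power_le_one)
    from sums_mult[OF g[OF this]] show ?thesis by (simp add: mult.assoc)
  qed
  then have "(\<lambda>n. \<Sum>i\<le>degree q. coeff q i * (g n * (t * (1/2) ^ i) ^ n)) sums dilation_sum q f (x * t, y * t)"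
    unfolding dilation_sum_def by (auto intro!: sums_sum)
  moreover have "(\<Sum>i\<le>degree q. coeff q i * (g n * (t * (1/2) ^ i) ^ n)) = g n * poly q ((1/2) ^ n) * t ^ n" for n
    by (simp add: poly_altdef sum_distrib_left sum_distrib_right power_mult_distrib
        power_mult[symmetric] mult_ac)
  ultimately show ?thesis by simp
qed

section \<open>Identity theorems for accumulating lines\<close>

lemma islimpt_half_powers:
  assumes "x \<noteq> 0"
  shows "0 islimpt (range (\<lambda>j. x * (1/2) ^ j) :: complex set)"
  unfolding islimpt_sequential
proof (intro exI conjI allI)
  have "(\<lambda>j. x * (1/2) ^ j) \<longlonglongrightarrow> x * 0"
    by (intro tendsto_intros LIMSEQ_power_zero) (simp add: norm_divide)
  then show "(\<lambda>j. x * (1/2) ^ j) \<longlonglongrightarrow> 0" by simp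
qed (use assms in auto)

text \<open>Arguments by the slope y / x miss the axis x = 0. The identity theorem in x alone, for
  fixed y, restores it.\<close>

lemma holomorphic2_vanishing_off_axis:
  assumes "holomorphic2_on f (ball 0 r \<times> ball 0 r)"
    and "\<And>x y. x \<in> ball 0 r \<Longrightarrow> y \<in> ball 0 r \<Longrightarrow> x \<noteq> 0 \<Longrightarrow> f (x, y) = 0"
    and y: "y \<in> ball 0 r"
  shows "f (0, y) = 0"
proof -
  have "r > 0"
    using y by (simp add: le_less_trans[OF norm_ge_zero])
  have "(\<lambda>x. f (0 + x * 1, y + x * 0)) holomorphic_on ball 0 r"
    by (rule holomorphic2_on_line[OF assms(1)]) (use y in auto)
  then have "f (0 + 0 * 1, y + 0 * 0) = 0"
    by (rule analytic_continuation[of _ "ball 0 r" "range (\<lambda>j. of_real (r/2) * (1/2) ^ j)" 0])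
      (use \<open>r > 0\<close> y assms(2)[OF _ y] mult_half_power_in_ball[of "of_real (r/2)" r]
        islimpt_half_powers[of "of_real (r/2)"] in auto)
  then show ?thesis by simp
qed

text \<open>For fixed nonzero x the points x / 2^j accumulate at 0, an interior point of the disc in
  y, so the identity theorem in y applies. This is the place where the accumulation of the lines is
  used.\<close>

lemma holomorphic2_vanishing_on_lines:
  assumes hol: "holomorphic2_on f (ball 0 r \<times> ball 0 r)"
    and zero: "\<And>j x. x \<in> ball 0 r \<Longrightarrow> f (x, x * (1/2) ^ j) = 0"
    and xy: "x \<in> ball 0 r" "y \<in> ball 0 r"
  shows "f (x, y) = 0"
proof -
  have r: "r > 0"
    using xy by (simp add: le_less_trans[OF norm_ge_zero])
  have *: "f (x, y) = 0" if xy: "x \<in> ball 0 r" "y \<in> ball 0 r" "x \<noteq> 0" for x y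
  proof -
    have "(\<lambda>y. f (x + y * 0, 0 + y * 1)) holomorphic_on ball 0 r"
      by (rule holomorphic2_on_line[OF hol]) (use xy in auto)
    then have "f (x + y * 0, 0 + y * 1) = 0"
      by (rule analytic_continuation[of _ "ball 0 r" "range (\<lambda>j. x * (1/2) ^ j)" 0])
        (use r xy zero mult_half_power_in_ball[of x r] islimpt_half_powers[of x] in auto)
    then show ?thesis by simp
  qed
  then show ?thesis
    using holomorphic2_vanishing_off_axis[OF hol _ xy(2)] xy by (cases "x = 0") auto
qed

text \<open>F(x, y) / x^d depends on the slope l = y / x only. As a function P of l it is entire,
  and boundedness of F on a smaller polydisc makes it grow at most like |l|^d, so Liouville's
  theorem turns it into a polynomial of degree at most d.\<close>

lemma homogeneous_is_polynomial:
  assumes hol: "holomorphic2_on F (ball 0 r \<times> ball 0 r)" and r: "r > 0"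
    and hom: "\<And>x y t. x \<in> ball 0 r \<Longrightarrow> y \<in> ball 0 r \<Longrightarrow> cmod t \<le> 1 \<Longrightarrow> F (x * t, y * t) = F (x, y) * t ^ d"
  obtains c where "\<And>x y. x \<in> ball 0 r \<Longrightarrow> y \<in> ball 0 r \<Longrightarrow> F (x, y) = (\<Sum>b\<le>d. c b * x ^ (d - b) * y ^ b)"
proof -
  have indep: "F (u, u * l) / u ^ d = F (v, v * l) / v ^ d"
    if "u \<noteq> 0" "v \<noteq> 0" "u \<in> ball 0 r" "v \<in> ball 0 r" "u * l \<in> ball 0 r" "v * l \<in> ball 0 r" for u v l
  proof -
    \<comment> \<open>Homogeneity is assumed for \<open>cmod t \<le> 1\<close> only, so the point of
      smaller modulus is written as a multiple of the other.\<close>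
    have "F (u, u * l) / u ^ d = F (v, v * l) / v ^ d"
      if "u \<noteq> 0" "v \<noteq> 0" "v \<in> ball 0 r" "v * l \<in> ball 0 r" "cmod u \<le> cmod v" for u v
    proof -
      have "F (v * (u / v), v * l * (u / v)) = F (v, v * l) * (u / v) ^ d"
        by (rule hom) (use that in \<open>auto simp: norm_divide divide_le_eq\<close>)
      then show ?thesis using that by (simp add: field_simps)
    qed
    from this[of u v] this[of v u] show ?thesis
      using that by (cases "cmod u \<le> cmod v") auto
  qed
  \<comment> \<open>A first coordinate for slope l that keeps both s l and |s l * l| at most r / 2,
    while being at least r / (4 |l|) once |l| >= 1.\<close>
  define s where "s l = r / (2 * (1 + cmod l))" for l
  have s: "s l > 0" "s l < r" "s l * cmod l < r" for l
  proof -
    have "1 + cmod l > 0" by (simp add: add_pos_nonneg)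
    then show "s l > 0" using r by (simp add: s_def)
    have "r * cmod l \<ge> 0" using r by simp
    then have "0 < r + r * (cmod l * 2)" "0 < r * cmod l + r * 2"
      using r by linarith+
    then show "s l < r" "s l * cmod l < r"
      using r \<open>1 + cmod l > 0\<close> by (simp_all add: s_def field_simps)
  qed
  define P where "P l = F (of_real (s l), of_real (s l) * l) / of_real (s l) ^ d" for l
  have P_eq: "P l = F (u, u * l) / u ^ d" if "u \<noteq> 0" "u \<in> ball 0 r" "u * l \<in> ball 0 r" for u l
    unfolding P_def using s[of l] that
    by (intro indep) (auto simp: norm_mult)
  have "P holomorphic_on UNIV"
    unfolding holomorphic_on_def
  proof
    fix l :: complex
    \<comment> \<open>\<open>s\<close> is not holomorphic in the slope. Near the given l it is
      frozen to the constant u, which \<open>P_eq\<close> permits.\<close>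
    define u :: complex where "u = of_real (s l)"
    define T where "T = (\<lambda>l. u * l) -` ball 0 r"
    have T: "open T" "l \<in> T" "u \<noteq> 0" "u \<in> ball 0 r"
      using s[of l] unfolding T_def u_def
      by (auto intro!: open_vimage continuous_intros simp: norm_mult)
    have "(\<lambda>l. F (u + l * 0, 0 + l * u) / u ^ d) holomorphic_on T"
      by (intro holomorphic_intros holomorphic2_on_line[OF hol])
        (use T in \<open>auto simp: T_def mult.commute\<close>)
    then have "P holomorphic_on T"
      by (rule holomorphic_transform) (use T in \<open>auto simp: P_eq T_def mult.commute\<close>)
    then show "P field_differentiable at l within UNIV"
      using T by (auto simp: holomorphic_on_open field_differentiable_def)
  qed
  moreover have "bounded (F ` (cball 0 (r/2) \<times> cball 0 (r/2)))"
    by (intro compact_imp_bounded compact_continuous_image compact_Times compact_cball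
        continuous_on_subset[OF holomorphic2_on_imp_continuous_on[OF hol]])
      (use r in auto)
  then obtain B where B: "B > 0" "\<And>p. p \<in> cball 0 (r/2) \<times> cball 0 (r/2) \<Longrightarrow> cmod (F p) \<le> B"
    by (auto simp: bounded_pos)
  have "cmod (P l) \<le> B * (4 / r) ^ d * cmod l ^ d" if l: "1 \<le> cmod l" for l
  proof -
    have 1: "1 + cmod l > 0" by (simp add: add_pos_nonneg)
    have "s l \<le> r/2" "s l * cmod l \<le> r / 2"
      using r 1 by (auto simp: s_def field_simps)
    then have "cmod (F (of_real (s l), of_real (s l) * l)) \<le> B"
      using s[of l] by (intro B) (auto simp: norm_mult)
    moreover have "r / (4 * cmod l) \<le> s l"
      unfolding s_def using r l by (intro divide_left_mono mult_pos_pos) auto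
    then have "(r / (4 * cmod l)) ^ d \<le> s l ^ d"
      using r by (intro power_mono) auto
    moreover have "cmod (P l) = cmod (F (of_real (s l), of_real (s l) * l)) / s l ^ d"
      using s[of l] by (simp add: P_def norm_divide norm_power)
    moreover have "0 < r / (4 * cmod l)"
      using r l by (intro divide_pos_pos) auto
    then have "0 < (r / (4 * cmod l)) ^ d"
      by (rule zero_less_power)
    ultimately have "cmod (P l) \<le> B / (r / (4 * cmod l)) ^ d"
      using B(1) by (auto intro!: frac_le)
    also have "\<dots> = B * (4 / r) ^ d * cmod l ^ d"
      using r l by (simp add: power_divide power_mult_distrib)
    finally show ?thesis .
  qed
  ultimately have P: "P l = (\<Sum>k\<le>d. (deriv ^^ k) P 0 / fact k * l ^ k)" for l
    by (intro Liouville_polynomial[where A = 1 and B = "B * (4 / r) ^ d"]) auto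
  define c where "c k = (deriv ^^ k) P 0 / fact k" for k
  \<comment> \<open>The formula for F follows from P where x is nonzero; the difference G carries it
    over to x = 0.\<close>
  define G where "G p = F p + (-1) * (\<Sum>b\<le>d. c b * (fst p ^ (d - b) * snd p ^ b))" for p
  have G: "holomorphic2_on G (ball 0 r \<times> ball 0 r)"
    unfolding G_def
    by (intro holomorphic2_on_add holomorphic2_on_cmult holomorphic2_on_sum hol holomorphic2_on_monomial)
  have G0: "G (x, y) = 0" if xy: "x \<in> ball 0 r" "y \<in> ball 0 r" "x \<noteq> 0" for x y
  proof -
    have "F (x, y) = x ^ d * P (y / x)"
      using P_eq[of x "y / x"] xy by simp
    also have "\<dots> = (\<Sum>b\<le>d. c b * (x ^ (d - b) * y ^ b))"
      unfolding P[of "y / x"] sum_distrib_left c_def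
    proof (rule sum.cong)
      fix b assume "b \<in> {..d}"
      then have "x ^ d = x ^ (d - b) * x ^ b" by (simp flip: power_add)
      then show "x ^ d * ((deriv ^^ b) P 0 / fact b * (y / x) ^ b)
        = (deriv ^^ b) P 0 / fact b * (x ^ (d - b) * y ^ b)"
        using xy(3) by (simp add: power_divide)
    qed simp
    finally show ?thesis by (simp add: G_def)
  qed
  have "G (x, y) = 0" if "x \<in> ball 0 r" "y \<in> ball 0 r" for x y
    using holomorphic2_vanishing_off_axis[OF G G0 that(2)] G0 that by (cases "x = 0") auto
  then show ?thesis
    by (intro that[of c]) (simp add: G_def mult.assoc)
qed

lemma half_power_inject: "(1/2) ^ m = ((1/2) ^ n :: complex) \<longleftrightarrow> m = n"
proof
  assume "(1/2) ^ m = ((1/2) ^ n :: complex)"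
  then have "2 ^ m = (2 ^ n :: complex)"
    by (simp add: power_divide)
  from arg_cong[OF this, of cmod] show "m = n"
    by (simp add: norm_power)
qed simp

text \<open>A dilation operator that removes all degrees up to D makes f vanish on every line, hence
  on the polydisc; so f has no components beyond D. The remaining ones are extracted by further
  dilation operators and are polynomials by homogeneity.\<close>

lemma polynomial_if_polynomial_on_lines:
  assumes hol: "holomorphic2_on f (ball 0 r \<times> ball 0 r)" and r: "r > 0"
    and lines: "\<And>j. \<exists>a. \<forall>x\<in>ball 0 r. f (x, x * (1/2) ^ j) = (\<Sum>n\<le>D. a n * x ^ n)"
  obtains c where "\<And>x y. x \<in> ball 0 r \<Longrightarrow> y \<in> ball 0 r \<Longrightarrow>
    f (x, y) = (\<Sum>d\<le>D. \<Sum>b\<le>d. c d b * x ^ (d - b) * y ^ b)"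
proof -
  have shrink: "x * t \<in> ball 0 r" if "x \<in> ball 0 r" "cmod t \<le> 1" for x t :: complex
    using that mult_right_le_one_le[of "cmod x" "cmod t"] by (auto simp: norm_mult)
  \<comment> \<open>Its zeros are the nodes 2^(-n) with n <= D and no other power of 1/2, so the
    operator removes exactly the degrees up to D.\<close>
  define q :: "complex poly" where "q = (\<Prod>i\<le>D. [:- ((1/2) ^ i), 1:])"
  have q0: "poly q ((1/2) ^ n) = 0 \<longleftrightarrow> n \<le> D" for n
    by (auto simp: q_def poly_prod half_power_inject)
  define h where "h = dilation_sum q f"
  have hhol: "holomorphic2_on h (ball 0 r \<times> ball 0 r)"
    unfolding h_def by (rule holomorphic2_on_dilation_sum[OF hol])
  have "h (x, x * (1/2) ^ j) = 0" if x: "x \<in> ball 0 r" for x j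
  proof -
    obtain a where a: "\<And>x. x \<in> ball 0 r \<Longrightarrow> f (x, x * (1/2) ^ j) = (\<Sum>n\<le>D. a n * x ^ n)"
      using lines by blast
    obtain g where g: "\<And>t. cmod t \<le> 1 \<Longrightarrow> (\<lambda>n. g n * t ^ n) sums f (x * t, x * (1/2) ^ j * t)"
      using Taylor_along_line[OF hol x mult_half_power_in_ball[OF x]] by blast
    have "(\<lambda>n. (if n \<in> {..D} then a n * x ^ n else 0) * t ^ n) sums f (x * t, x * (1/2) ^ j * t)"
      if "cmod t < 1" for t
    proof -
      have "f (x * t, x * (1/2) ^ j * t) = (\<Sum>n\<le>D. a n * x ^ n * t ^ n)"
        using a[OF shrink[OF x, of t]] that by (simp add: mult_ac power_mult_distrib)
      moreover have "(\<lambda>n. if n \<in> {..D} then a n * x ^ n * t ^ n else 0) sums (\<Sum>n\<le>D. a n * x ^ n * t ^ n)"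
        by (rule sums_If_finite_set) simp
      ultimately show ?thesis by (auto intro: sums_cong[THEN iffD1, rotated])
    qed
    then have "g n = (if n \<in> {..D} then a n * x ^ n else 0)" for n
      using g by (intro power_series_unique[of 1]) auto
    \<comment> \<open>Along the line, coefficients beyond D vanish by hypothesis, and those up to D
      are multiplied by a zero of q.\<close>
    then have "g n * poly q ((1/2) ^ n) = 0" for n
      using q0 by simp
    with dilation_sum_sums[OF g, of 1 q] show ?thesis
      by (simp add: h_def sums_iff)
  qed
  then have h0: "h (x, y) = 0" if "x \<in> ball 0 r" "y \<in> ball 0 r" for x y
    using holomorphic2_vanishing_on_lines[OF hhol _ that] by blast
  \<comment> \<open>Here (x, y) is an arbitrary point of the polydisc: h = 0 gives g n * q(2^(-n)) =
    0, and q(2^(-n)) is nonzero for n > D.\<close>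
  have finite_Taylor: "\<exists>g. \<forall>t. cmod t \<le> 1 \<longrightarrow> (\<lambda>n. (if n \<le> D then g n else 0) * t ^ n) sums f (x * t, y * t)"
    if xy: "x \<in> ball 0 r" "y \<in> ball 0 r" for x y
  proof -
    obtain g where g: "\<And>t. cmod t \<le> 1 \<Longrightarrow> (\<lambda>n. g n * t ^ n) sums f (x * t, y * t)"
      using Taylor_along_line[OF hol xy] by blast
    have "g n * poly q ((1/2) ^ n) = 0" for n
    proof (rule power_series_unique[of 1 _ "\<lambda>_. 0" "\<lambda>_. 0"])
      fix t :: complex assume "cmod t < 1"
      then show "(\<lambda>n. g n * poly q ((1/2) ^ n) * t ^ n) sums 0"
        using dilation_sum_sums[OF g, of t q] h0[OF shrink shrink] xy by (simp add: h_def)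
    qed auto
    then have "(if n \<le> D then g n else 0) = g n" for n
      using q0 by auto
    with g show ?thesis by (intro exI[of _ g]) simp
  qed
  \<comment> \<open>The Lagrange polynomial of the node 2^(-d) among the nodes of degree up to D.
    Its dilation operator projects onto the component of degree d, as no higher degrees are
    left.\<close>
  define q' :: "nat \<Rightarrow> complex poly" where
    "q' d = smult (inverse (\<Prod>i\<in>{..D} - {d}. (1/2) ^ d - (1/2) ^ i)) (\<Prod>i\<in>{..D} - {d}. [:- ((1/2) ^ i), 1:])" for d
  have q': "poly (q' d) ((1/2) ^ n) = (if n = d then 1 else 0)" if "n \<le> D" for n d
  proof -
    have "(\<Prod>i\<in>{..D} - {d}. (1/2) ^ d - (1/2) ^ i) \<noteq> (0 :: complex)"
      by (auto simp: half_power_inject)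
    with that show ?thesis
      by (auto simp: q'_def poly_prod)
  qed
  define F where "F d = dilation_sum (q' d) f" for d
  have Fhol: "holomorphic2_on (F d) (ball 0 r \<times> ball 0 r)" for d
    unfolding F_def by (rule holomorphic2_on_dilation_sum[OF hol])
  have F: "f (x, y) = (\<Sum>d\<le>D. F d (x, y))" 
    "\<And>d t. d \<le> D \<Longrightarrow> cmod t \<le> 1 \<Longrightarrow> F d (x * t, y * t) = F d (x, y) * t ^ d"
    if xy: "x \<in> ball 0 r" "y \<in> ball 0 r" for x y
  proof -
    obtain g where g: "\<And>t. cmod t \<le> 1 \<Longrightarrow> (\<lambda>n. (if n \<le> D then g n else 0) * t ^ n) sums f (x * t, y * t)"
      using finite_Taylor[OF xy] by blast
    have Fg: "F d (x * t, y * t) = g d * t ^ d" if "d \<le> D" "cmod t \<le> 1" for d t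
    proof -
      have "(\<lambda>n. if n = d then g n * t ^ n else 0) sums F d (x * t, y * t)"
        unfolding F_def using dilation_sum_sums[OF g \<open>cmod t \<le> 1\<close>, of "q' d"]
        by (rule sums_cong[THEN iffD1, rotated]) (use q' \<open>d \<le> D\<close> in auto)
      moreover have "(\<lambda>n. if n = d then g n * t ^ n else 0) sums (g d * t ^ d)"
        using sums_If_finite[of "\<lambda>n. n = d" "\<lambda>n. g n * t ^ n"] by simp
      ultimately show ?thesis by (rule sums_unique2)
    qed
    from Fg[of _ 1] have F1: "F d (x, y) = g d" if "d \<le> D" for d
      using that by simp
    show "F d (x * t, y * t) = F d (x, y) * t ^ d" if "d \<le> D" "cmod t \<le> 1" for d t
      using Fg[OF that] F1 that by simp
    have "(\<lambda>n. if n \<in> {..D} then g n else 0) sums f (x, y)"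
      using g[of 1] by simp
    moreover have "(\<lambda>n. if n \<in> {..D} then g n else 0) sums (\<Sum>n\<le>D. g n)"
      by (rule sums_If_finite_set) simp
    ultimately have "f (x, y) = (\<Sum>n\<le>D. g n)" by (rule sums_unique2)
    then show "f (x, y) = (\<Sum>d\<le>D. F d (x, y))"
      using F1 by simp
  qed
  have "\<exists>c. \<forall>x\<in>ball 0 r. \<forall>y\<in>ball 0 r. F d (x, y) = (\<Sum>b\<le>d. c b * x ^ (d - b) * y ^ b)" if "d \<le> D" for d
    using homogeneous_is_polynomial[OF Fhol r F(2)[OF _ _ that]] by metis
  then obtain c where "\<And>d x y. d \<le> D \<Longrightarrow> x \<in> ball 0 r \<Longrightarrow> y \<in> ball 0 r \<Longrightarrow>
      F d (x, y) = (\<Sum>b\<le>d. c d b * x ^ (d - b) * y ^ b)"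
    by metis
  with F(1) show ?thesis
    by (intro that[of c]) auto
qed

section \<open>The union of tubes\<close>

lemma emeasure_ball_complex: "0 \<le> r \<Longrightarrow> emeasure lborel (ball (c::complex) r) = ennreal (pi * r\<^sup>2)"
  by (simp add: emeasure_ball unit_ball_vol_2)

text \<open>Dyadic comparison: if n > 0 is least with |x| < 2^n, then |x| >= 2^(n-1) bounds the
  integrand by 8 * 8^(-n). The ball of radius 2^n has area pi * 4^n, so a geometric series of ratio
  1/2 remains.\<close>

lemma nn_integral_inverse_cube_finite:
  "(\<integral>\<^sup>+x. ennreal (1 / (1 + cmod x) ^ 3) \<partial>lborel) < \<infinity>"
proof -
  have le: "ennreal (1 / (1 + cmod x) ^ 3) \<le> (\<Sum>n. ennreal (8 * (1/8) ^ n) * indicator (ball 0 (2 ^ n)) x)" for x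
  proof -
    define F where "F k = ennreal (8 * (1/8) ^ k) * indicator (ball 0 (2 ^ k)) x" for k :: nat
    have F_le: "F k \<le> (\<Sum>k. F k)" for k
      using sum_le_suminf[OF summableI, of "{k}" F] by simp
    obtain m where "cmod x < 2 ^ m"
      using real_arch_pow[of 2 "cmod x"] by auto
    define n where "n = (LEAST n. cmod x < 2 ^ n)"
    have n: "cmod x < 2 ^ n"
      unfolding n_def by (rule LeastI) fact
    have "1 / (1 + cmod x) ^ 3 \<le> 8 * (1/8) ^ n"
    proof (cases n)
      case 0
      have "(1 + cmod x) ^ 3 \<ge> 1" by (rule one_le_power) simp
      moreover have "0 < (1 + cmod x) ^ 3" by (simp add: add_pos_nonneg)
      ultimately have "1 / (1 + cmod x) ^ 3 \<le> 1" by (simp add: pos_divide_le_eq)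
      then show ?thesis using 0 by simp
    next
      case (Suc k)
      then have "\<not> cmod x < 2 ^ k"
        unfolding n_def using not_less_Least[of k "\<lambda>n. cmod x < 2 ^ n"] by simp
      then have "(2 ^ k) ^ 3 \<le> (1 + cmod x) ^ 3"
        by (intro power_mono) auto
      then have "1 / (1 + cmod x) ^ 3 \<le> 1 / (2 ^ k) ^ 3"
        by (intro divide_left_mono mult_pos_pos zero_less_power) (auto simp: add_pos_nonneg)
      also have "(2 ^ k) ^ 3 = (8 ^ k :: real)"
        by (simp add: power_mult[symmetric] mult.commute[of k]) (simp add: power_mult)
      finally show ?thesis using Suc by (simp add: power_divide)
    qed
    then have "ennreal (1 / (1 + cmod x) ^ 3) \<le> ennreal (8 * (1/8) ^ n) * indicator (ball 0 (2 ^ n)) x"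
      using n by (simp add: ennreal_leI)
    also have "\<dots> \<le> (\<Sum>n. ennreal (8 * (1/8) ^ n) * indicator (ball 0 (2 ^ n)) x)"
      using F_le unfolding F_def .
    finally show ?thesis .
  qed
  have ball: "ball (0::complex) r \<in> sets lborel" for r
    by simp
  have meas: "(\<lambda>x. ennreal c * indicator (ball (0::complex) r) x) \<in> borel_measurable lborel" for c r
    by (intro borel_measurable_times_ennreal borel_measurable_indicator ball) simp
  have "(\<integral>\<^sup>+x. ennreal (1 / (1 + cmod x) ^ 3) \<partial>lborel)
      \<le> (\<integral>\<^sup>+x. (\<Sum>n. ennreal (8 * (1/8) ^ n) * indicator (ball 0 (2 ^ n)) (x::complex)) \<partial>lborel)"
    by (intro nn_integral_mono le)
  also have "\<dots> = (\<Sum>n. ennreal (8 * (1/8) ^ n) * emeasure lborel (ball (0::complex) (2 ^ n)))"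
    by (subst nn_integral_suminf) (rule meas, intro suminf_cong nn_integral_cmult_indicator ball)
  also have "\<dots> = (\<Sum>n. ennreal (8 * pi * (1/2) ^ n))"
  proof (rule suminf_cong)
    fix n :: nat
    have "(1/8) ^ n * ((2 ^ n)\<^sup>2) = ((1/2) ^ n :: real)"
      by (simp add: power_divide power2_eq_square flip: power_mult_distrib)
        (simp add: field_simps flip: power_mult_distrib)
    then have "8 * (1/8) ^ n * (pi * (2 ^ n)\<^sup>2) = 8 * pi * (1/2::real) ^ n"
      by (metis mult.assoc mult.left_commute)
    then show "ennreal (8 * (1/8) ^ n) * emeasure lborel (ball (0::complex) (2 ^ n)) = ennreal (8 * pi * (1/2) ^ n)"
      by (simp add: emeasure_ball_complex flip: ennreal_mult)
  qed
  also have "\<dots> = ennreal (8 * pi * 2)"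
  proof (rule suminf_ennreal_eq)
    show "(\<lambda>n. 8 * pi * (1/2) ^ n) sums (8 * pi * 2)"
      using sums_mult[OF geometric_sums[of "1/2::real"], of "8 * pi"] by simp
  qed simp
  finally show ?thesis
    by (rule le_less_trans) simp
qed

text \<open>Squaring the distance avoids the half-integral powers in the radius and leaves a strict
  inequality between continuous functions. The factor \<open>(1/2) ^ j\<close> is, up to pi, the
  part of the slice area that depends on j.\<close>

definition tube_domain :: "nat \<Rightarrow> (complex \<times> complex) set" where
  "tube_domain q =
    {p. \<exists>j::nat. (cmod (snd p - fst p * (1/2) ^ j))\<^sup>2 * (1 + cmod (fst p)) ^ q < (1/2) ^ j}"

lemma open_tube_domain: "open (tube_domain q)"
proof -
  have "tube_domain q = (\<Union>j::nat. {p. (cmod (snd p - fst p * (1/2) ^ j))\<^sup>2 * (1 + cmod (fst p)) ^ q < (1/2) ^ j})"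
    by (auto simp: tube_domain_def)
  then show ?thesis
    by (auto intro!: open_Collect_less continuous_intros)
qed

text \<open>The lines pass through 0, so scaling down shrinks the distance to each of them as well
  as the factor (1 + |x|)^q. This gives connectedness and allows continuation along complex lines
  from 0.\<close>

lemma tube_domain_balanced:
  assumes "(x, y) \<in> tube_domain q" "cmod t \<le> 1"
  shows "(x * t, y * t) \<in> tube_domain q"
proof -
  obtain j where j: "(cmod (y - x * (1/2) ^ j))\<^sup>2 * (1 + cmod x) ^ q < (1/2) ^ j"
    using assms by (auto simp: tube_domain_def)
  have "y * t - x * t * (1/2) ^ j = (y - x * (1/2) ^ j) * t"
    by (simp add: algebra_simps)
  then have "cmod (y * t - x * t * (1/2) ^ j) \<le> cmod (y - x * (1/2) ^ j)"
    using mult_right_le_one_le[of "cmod (y - x * (1/2) ^ j)" "cmod t"] assms(2)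
    by (simp add: norm_mult)
  moreover have "cmod (x * t) \<le> cmod x"
    using mult_right_le_one_le[of "cmod x" "cmod t"] assms(2) by (simp add: norm_mult)
  ultimately have "(cmod (y * t - x * t * (1/2) ^ j))\<^sup>2 * (1 + cmod (x * t)) ^ q
      \<le> (cmod (y - x * (1/2) ^ j))\<^sup>2 * (1 + cmod x) ^ q"
    by (intro mult_mono power_mono) auto
  also note j
  finally show ?thesis
    unfolding tube_domain_def by auto
qed

text \<open>Already the tube with j = 0 contains it: |y - x| < 2^(-q-1) and (1 + |x|)^q <= 2^q give
  a product of at most 2^(-q-2).\<close>

lemma polydisc_subset_tube_domain: "ball 0 ((1/2) ^ (q + 2)) \<times> ball 0 ((1/2) ^ (q + 2)) \<subseteq> tube_domain q"
proof clarify
  fix x y :: complex assume xy: "x \<in> ball 0 ((1/2) ^ (q + 2))" "y \<in> ball 0 ((1/2) ^ (q + 2))"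
  have "(1/2) ^ (q + 2) \<le> (1/4::real)"
    by (simp add: power_one_over field_simps)
  have "cmod (y - x) \<le> cmod x + cmod y"
    using norm_triangle_ineq4[of y x] by simp
  also have "\<dots> < (1/2) ^ (q + 1)"
    using xy by (simp add: power_add)
  finally have 1: "cmod (y - x) < (1/2) ^ (q + 1)" .
  have "cmod x \<le> 1"
    using xy \<open>(1/2) ^ (q + 2) \<le> (1/4::real)\<close> by simp
  have "(cmod (y - x))\<^sup>2 * (1 + cmod x) ^ q \<le> ((1/2) ^ (q + 1))\<^sup>2 * 2 ^ q"
    using 1 \<open>cmod x \<le> 1\<close> by (intro mult_mono power_mono) auto
  also have "\<dots> = (1/2) ^ (q + 2)"
    by (simp add: power2_eq_square power_one_over field_simps)
  also have "\<dots> < 1"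
    using \<open>(1/2) ^ (q + 2) \<le> (1/4::real)\<close> by simp
  finally show "(x, y) \<in> tube_domain q"
    unfolding tube_domain_def by (auto intro!: exI[of _ 0])
qed

lemma starlike_tube_domain: "starlike (tube_domain q)"
  unfolding starlike_def
proof (intro bexI[of _ 0] ballI subsetI)
  fix p z assume p: "p \<in> tube_domain q" and "z \<in> closed_segment 0 p"
  then obtain u where u: "0 \<le> u" "u \<le> 1" "z = u *\<^sub>R p"
    by (auto simp: closed_segment_def)
  then have "z = (fst p * of_real u, snd p * of_real u)"
    by (auto simp: prod_eq_iff scaleR_conv_of_real)
  then show "z \<in> tube_domain q"
    using tube_domain_balanced[of "fst p" "snd p" q "of_real u"] p u by auto
next
  show "0 \<in> tube_domain q"
    using polydisc_subset_tube_domain[of q] by (auto simp: zero_prod_def subset_iff)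
qed

text \<open>All slopes are at most 1 and all radii less than 1. This confines the tubes to a region
  where the weight is governed by |x| alone.\<close>

lemma tube_domain_snd_le:
  assumes "(x, y) \<in> tube_domain q"
  shows "cmod y \<le> 1 + cmod x"
proof -
  obtain j where j: "(cmod (y - x * (1/2) ^ j))\<^sup>2 * (1 + cmod x) ^ q < (1/2) ^ j"
    using assms by (auto simp: tube_domain_def)
  have "(cmod (y - x * (1/2) ^ j))\<^sup>2 * 1 \<le> (cmod (y - x * (1/2) ^ j))\<^sup>2 * (1 + cmod x) ^ q"
    by (intro mult_left_mono one_le_power) auto
  also note j
  also have "(1/2::real) ^ j \<le> 1" by (simp add: power_le_one)
  finally have "cmod (y - x * (1/2) ^ j) < 1"
    by (simp add: power_less_one_iff abs_square_less_1)
  moreover have "cmod (x * (1/2) ^ j) \<le> cmod x"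
    using mult_left_le[of "(1/2) ^ j" "cmod x"]
    by (simp add: norm_mult norm_power norm_divide power_le_one)
  ultimately show ?thesis
    using norm_triangle_ineq2[of y "x * (1/2) ^ j"] by linarith
qed

text \<open>The slice is a union of discs of areas pi * 2^(-j) / (1 + |x|)^q; overlaps only help,
  and the geometric series gives the factor 2.\<close>

lemma emeasure_tube_domain_slice:
  "emeasure lborel {y. (x, y) \<in> tube_domain q} \<le> ennreal (2 * pi / (1 + cmod x) ^ q)"
proof -
  define r where "r j = sqrt ((1/2) ^ j / (1 + cmod x) ^ q)" for j :: nat
  have pos: "0 < (1 + cmod x) ^ q"
    by (simp add: add_pos_nonneg)
  have r: "0 \<le> r j" "(r j)\<^sup>2 = (1/2) ^ j / (1 + cmod x) ^ q" for j
    using pos by (simp_all add: r_def)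
  have "(cmod (y - x * (1/2) ^ j))\<^sup>2 * (1 + cmod x) ^ q < (1/2) ^ j \<longleftrightarrow> y \<in> ball (x * (1/2) ^ j) (r j)" for y and j :: nat
  proof -
    have "(cmod (y - x * (1/2) ^ j))\<^sup>2 * (1 + cmod x) ^ q < (1/2) ^ j \<longleftrightarrow>
      (cmod (y - x * (1/2) ^ j))\<^sup>2 < (r j)\<^sup>2"
      using pos by (simp add: r(2) pos_less_divide_eq)
    also have "\<dots> \<longleftrightarrow> cmod (y - x * (1/2) ^ j) < r j"
      using r(1)[of j] by (metis norm_ge_zero power2_less_imp_less power_strict_mono zero_less_numeral)
    finally show ?thesis by (simp add: dist_norm norm_minus_commute)
  qed
  then have "{y. (x, y) \<in> tube_domain q} = (\<Union>j. ball (x * (1/2) ^ j) (r j))"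
    by (auto simp: tube_domain_def)
  then have "emeasure lborel {y. (x, y) \<in> tube_domain q} \<le> (\<Sum>j. emeasure lborel (ball (x * (1/2) ^ j) (r j)))"
    by (simp only:) (rule emeasure_subadditive_countably, auto)
  also have "\<dots> = (\<Sum>j. ennreal (pi / (1 + cmod x) ^ q * (1/2) ^ j))"
    using r by (simp add: emeasure_ball_complex)
  also have "\<dots> = ennreal (pi / (1 + cmod x) ^ q * 2)"
  proof (rule suminf_ennreal_eq)
    show "(\<lambda>j. pi / (1 + cmod x) ^ q * (1/2) ^ j) sums (pi / (1 + cmod x) ^ q * 2)"
      using sums_mult[OF geometric_sums[of "1/2::real"], of "pi / (1 + cmod x) ^ q"] by simp
  qed simp
  finally show ?thesis by (simp add: mult.commute)
qed

text \<open>For the q of the theorem, q - 3 = 2D - 2k - 6, so the integrand is v^(2D) times the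
  model weight, with v = 1 + |x|. Integrating over the slices first leaves a multiple of
  v^(-3).\<close>

lemma nn_integral_tube_domain_finite:
  "(\<integral>\<^sup>+p. ennreal ((1 + cmod (fst p)) powi (int q - 3)) * indicator (tube_domain q) p \<partial>lborel) < \<infinity>"
proof -
  define w where "w x = (1 + cmod x) powi (int q - 3)" for x
  have w0: "0 \<le> w x" for x by (simp add: w_def)
  have pos: "0 < 1 + cmod x" for x by (simp add: add_pos_nonneg)
  have w1: "w x * (2 * pi / (1 + cmod x) ^ q) = 2 * pi * (1 / (1 + cmod x) ^ 3)" for x
    using pos[of x] by (simp add: w_def power_int_diff field_simps)
  have [measurable]: "tube_domain q \<in> sets borel"
    using open_tube_domain by auto
  have "continuous_on UNIV (\<lambda>x::complex. (1 + cmod x) powi (int q - 3))"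
    by (intro continuous_intros) (simp add: add_nonneg_eq_0_iff)
  then have w: "w \<in> borel_measurable borel"
    unfolding w_def[abs_def] by (intro borel_measurable_continuous_onI)
  have "(fst :: complex \<times> complex \<Rightarrow> complex) \<in> borel_measurable borel"
    by (intro borel_measurable_continuous_onI continuous_intros)
  from measurable_compose[OF this w]
  have wm: "(\<lambda>p. ennreal (w (fst p)) * indicator (tube_domain q) p) \<in> borel_measurable borel"
    by measurable
  have slice: "{y. (x, y) \<in> tube_domain q} \<in> sets borel" for x
  proof -
    have "open ((\<lambda>y. (x, y)) -` tube_domain q)"
      by (intro open_vimage open_tube_domain continuous_intros)
    then show ?thesis by (simp add: vimage_def)
  qed
  have "(\<integral>\<^sup>+p. ennreal (w (fst p)) * indicator (tube_domain q) p \<partial>lborel)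
      = (\<integral>\<^sup>+x. \<integral>\<^sup>+y. ennreal (w x) * indicator {y. (x, y) \<in> tube_domain q} y \<partial>lborel \<partial>lborel)"
    by (subst nn_integral_lborel_pair[OF wm]) (auto intro!: nn_integral_cong simp: indicator_def)
  also have "\<dots> = (\<integral>\<^sup>+x. ennreal (w x) * emeasure lborel {y. (x, y) \<in> tube_domain q} \<partial>lborel)"
    by (simp add: nn_integral_cmult_indicator slice)
  also have "\<dots> \<le> (\<integral>\<^sup>+x. ennreal (2 * pi) * ennreal (1 / (1 + cmod x) ^ 3) \<partial>lborel)"
  proof (rule nn_integral_mono)
    fix x :: complex
    have "ennreal (w x) * emeasure lborel {y. (x, y) \<in> tube_domain q}
        \<le> ennreal (w x) * ennreal (2 * pi / (1 + cmod x) ^ q)"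
      by (intro mult_left_mono emeasure_tube_domain_slice) simp
    also have "\<dots> = ennreal (w x * (2 * pi / (1 + cmod x) ^ q))"
      using pos[of x] by (intro ennreal_mult[symmetric] w0) simp
    also have "\<dots> = ennreal (2 * pi) * ennreal (1 / (1 + cmod x) ^ 3)"
      unfolding w1 by (rule ennreal_mult) simp_all
    finally show "ennreal (w x) * emeasure lborel {y. (x, y) \<in> tube_domain q}
        \<le> ennreal (2 * pi) * ennreal (1 / (1 + cmod x) ^ 3)" .
  qed
  also have "\<dots> = ennreal (2 * pi) * (\<integral>\<^sup>+x. ennreal (1 / (1 + cmod x) ^ 3) \<partial>lborel)"
    by (rule nn_integral_cmult) (auto intro!: borel_measurable_continuous_onI continuous_intros simp: add_nonneg_eq_0_iff)
  also have "\<dots> < \<infinity>"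
    using nn_integral_inverse_cube_finite by (simp add: ennreal_mult_less_top)
  finally show ?thesis by (simp add: w_def)
qed

section \<open>From square integrability to polynomials\<close>

lemma power_int_comparable:
  fixes u v :: real
  assumes "0 < v" "v / 2 \<le> u" "u \<le> 2 * v"
  shows "u powi n \<le> 2 ^ nat \<bar>n\<bar> * v powi n"
proof (cases "n \<ge> 0")
  case True
  have "u ^ nat n \<le> (2 * v) ^ nat n"
    using assms by (intro power_mono) auto
  with True show ?thesis by (simp add: power_int_def power_mult_distrib)
next
  case False
  define m where "m = nat (- n)"
  have "(v / 2) ^ m \<le> u ^ m"
    using assms by (intro power_mono) auto
  then have "inverse (u ^ m) \<le> inverse ((v / 2) ^ m)"
    using assms by (intro le_imp_inverse_le zero_less_power) auto
  with False show ?thesis by (simp add: power_int_def m_def power_divide field_simps)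
qed

text \<open>The mean value inequality on a sheared polydisc around the point of the line: as large
  as |x| along the line, as thin as the tube across it. The weight is comparable to its central
  value there, so dividing by weight and volume yields the growth rate.\<close>

lemma L2_bound_on_line:
  assumes hol: "holomorphic2_on f (tube_domain q)"
    and int: "(\<integral>\<^sup>+p. ennreal ((cmod (f p))\<^sup>2 * (1 + cmod (fst p)) powi (int q - 3 - 2 * int D))
      * indicator (tube_domain q) p \<partial>lborel) < \<infinity>"
  obtains C where "\<And>x. (cmod (f (x, x * (1/2) ^ j)))\<^sup>2 \<le> C * (1 + cmod x) ^ (2 * D + 1)"
proof -
  define e where "e = int q - 3 - 2 * int D"
  define H where "H p = ennreal ((cmod (f p))\<^sup>2 * (1 + cmod (fst p)) powi e) * indicator (tube_domain q) p" for p
  have "integral\<^sup>N lborel H < \<infinity>"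
    using int unfolding H_def e_def .
  then obtain I where I: "0 \<le> I" "integral\<^sup>N lborel H = ennreal I"
    by (cases "integral\<^sup>N lborel H") auto
  define l where "l = (1/2 :: complex) ^ j"
  have op: "tube_domain q \<in> sets borel"
    using open_tube_domain by auto
  have "continuous_on (tube_domain q) (\<lambda>p. (cmod (f p))\<^sup>2 * (1 + cmod (fst p)) powi e)"
    by (intro continuous_intros holomorphic2_on_imp_continuous_on[OF hol]) (auto simp: add_nonneg_eq_0_iff)
  from borel_measurable_continuous_on_indicator[OF op this]
  have "(\<lambda>p. ennreal (indicator (tube_domain q) p *\<^sub>R ((cmod (f p))\<^sup>2 * (1 + cmod (fst p)) powi e))) \<in> borel_measurable borel"
    by measurable
  also have "(\<lambda>p. ennreal (indicator (tube_domain q) p *\<^sub>R ((cmod (f p))\<^sup>2 * (1 + cmod (fst p)) powi e))) = H"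
    by (auto simp: H_def fun_eq_iff indicator_def)
  finally have Hm[measurable]: "H \<in> borel_measurable borel" .
  show ?thesis
  proof (rule that)
    fix x :: complex
    define v where "v = 1 + cmod x"
    have v: "v \<ge> 1" by (simp add: v_def)
    \<comment> \<open>This radius keeps 1 + |x + fst p| within a factor 2 of v.\<close>
    define \<rho> where "\<rho> = v / 2"
    \<comment> \<open>The radius of the j-th tube at 1 + |x| = 2 v, where it is smallest; so the
      whole translate of S stays in that tube.\<close>
    define \<delta> where "\<delta> = sqrt ((1/2) ^ j / (2 * v) ^ q)"
    have \<rho>: "0 < \<rho>" and \<delta>: "0 < \<delta>" "\<delta>\<^sup>2 = (1/2) ^ j / (2 * v) ^ q"
      using v by (simp_all add: \<rho>_def \<delta>_def)
    \<comment> \<open>A polydisc sheared in the direction of the line. The shear is complex linear,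
      hence S is circular and has the volume of the unsheared polydisc.\<close>
    define S where "S = {p. cmod (fst p) < \<rho> \<and> cmod (snd p - fst p * l) < \<delta>}"
    have "open S"
      unfolding S_def by (intro open_Collect_conj open_Collect_less continuous_intros)
    then have S[measurable]: "S \<in> sets borel" by auto
    have near: "v / 2 \<le> 1 + cmod (x + fst p)" "1 + cmod (x + fst p) \<le> 2 * v" if "p \<in> S" for p
      using that norm_triangle_ineq[of x "fst p"] norm_triangle_ineq2[of x "- fst p"] v
      by (auto simp: S_def \<rho>_def v_def)
    have sub: "(x + fst p, x * l + snd p) \<in> tube_domain q" if p: "p \<in> S" for p
    proof -
      have eq: "x * l + snd p - (x + fst p) * l = snd p - fst p * l"
        by (simp add: algebra_simps)
      have "cmod (snd p - fst p * l) < \<delta>"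
        using p by (simp add: S_def)
      then have "(cmod (x * l + snd p - (x + fst p) * l))\<^sup>2 < \<delta>\<^sup>2"
        unfolding eq by (intro power_strict_mono) auto
      moreover have "(1 + cmod (x + fst p)) ^ q \<le> (2 * v) ^ q"
        using near[OF p] by (intro power_mono) auto
      moreover have "0 < (1 + cmod (x + fst p)) ^ q"
        by (simp add: add_pos_nonneg)
      ultimately have "(cmod (x * l + snd p - (x + fst p) * l))\<^sup>2 * (1 + cmod (x + fst p)) ^ q < \<delta>\<^sup>2 * (2 * v) ^ q"
        by (intro mult_less_le_imp_less) auto
      also have "\<dots> = (1/2) ^ j"
        using v by (simp add: \<delta>(2))
      finally show ?thesis
        unfolding tube_domain_def l_def by auto
    qed
    have circ: "(t * fst p, t * snd p) \<in> S" if p: "p \<in> S" and t: "cmod t \<le> 1" for p t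
    proof -
      have "t * snd p - t * fst p * l = t * (snd p - fst p * l)"
        by (simp add: algebra_simps)
      then show ?thesis
        using p mult_left_le_one_le[of "cmod (fst p)" "cmod t"]
          mult_left_le_one_le[of "cmod (snd p - fst p * l)" "cmod t"] t
        by (auto simp: S_def norm_mult)
    qed
    have vol: "emeasure lborel S = ennreal (pi * \<rho>\<^sup>2 * (pi * \<delta>\<^sup>2))"
    proof -
      have "emeasure lborel S = (\<integral>\<^sup>+a. \<integral>\<^sup>+b. indicator S (a, b) \<partial>lborel \<partial>lborel)"
        by (subst nn_integral_lborel_pair[symmetric]) simp_all
      also have "\<dots> = (\<integral>\<^sup>+a. indicator (ball 0 \<rho>) a * (\<integral>\<^sup>+b. indicator (ball (a * l) \<delta>) b \<partial>lborel) \<partial>lborel)"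
        by (auto intro!: nn_integral_cong simp: S_def indicator_def dist_norm norm_minus_commute)
      also have "\<dots> = (\<integral>\<^sup>+a. ennreal (pi * \<delta>\<^sup>2) * indicator (ball 0 \<rho>) (a::complex) \<partial>lborel)"
        using \<delta>(1) by (simp add: emeasure_ball_complex mult.commute)
      also have "\<dots> = ennreal (pi * \<rho>\<^sup>2 * (pi * \<delta>\<^sup>2))"
        using \<rho> by (subst nn_integral_cmult_indicator)
          (simp_all add: emeasure_ball_complex mult_ac flip: ennreal_mult)
      finally show ?thesis .
    qed
    \<comment> \<open>K times the weight is at least 1 on the translate, so the weight may be
      inserted under the integral at the cost of K.\<close>
    define K where "K = 2 ^ nat \<bar>- e\<bar> * v powi (- e)"
    have Hm2: "(\<lambda>p. H ((x, x * l) + p)) \<in> borel_measurable borel"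
      by (rule measurable_compose[OF borel_measurable_continuous_onI Hm]) (intro continuous_intros)
    have K: "0 \<le> K" using v by (simp add: K_def)
    have "ennreal ((cmod (f (x, x * l)))\<^sup>2) * emeasure lborel S
        \<le> (\<integral>\<^sup>+p. ennreal ((cmod (f (x + fst p, x * l + snd p)))\<^sup>2) * indicator S p \<partial>lborel)"
      by (rule mean_value_circular_set[OF hol open_tube_domain S sub circ])
    also have "\<dots> \<le> (\<integral>\<^sup>+p. ennreal K * H ((x, x * l) + p) \<partial>lborel)"
    proof (rule nn_integral_mono)
      fix p
      show "ennreal ((cmod (f (x + fst p, x * l + snd p)))\<^sup>2) * indicator S p \<le> ennreal K * H ((x, x * l) + p)"
      proof (cases "p \<in> S")
        case True
        define u where "u = 1 + cmod (x + fst p)"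
        have u: "u > 0" by (simp add: u_def add_pos_nonneg)
        have "u powi (- e) \<le> K"
          unfolding K_def using near[OF True] v by (intro power_int_comparable) (auto simp: u_def)
        then have "u powi (- e) * u powi e \<le> K * u powi e"
          using u by (intro mult_right_mono) auto
        moreover have "u powi (- e) * u powi e = 1"
          using u by (simp flip: power_int_add)
        ultimately have "(cmod (f (x + fst p, x * l + snd p)))\<^sup>2 * 1
            \<le> (cmod (f (x + fst p, x * l + snd p)))\<^sup>2 * (K * u powi e)"
          by (intro mult_left_mono) auto
        then have "ennreal ((cmod (f (x + fst p, x * l + snd p)))\<^sup>2)
            \<le> ennreal (K * ((cmod (f (x + fst p, x * l + snd p)))\<^sup>2 * u powi e))"
          by (intro ennreal_leI) (simp add: mult_ac)
        moreover have "H ((x, x * l) + p) = ennreal ((cmod (f (x + fst p, x * l + snd p)))\<^sup>2 * u powi e)"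
          using sub[OF True] by (simp add: H_def u_def plus_prod_def)
        ultimately show ?thesis
          using True K u by (simp add: ennreal_mult)
      qed simp
    qed
    also have "\<dots> = ennreal K * (\<integral>\<^sup>+p. H ((x, x * l) + p) \<partial>lborel)"
      by (rule nn_integral_cmult) (simp add: Hm2)
    also have "\<dots> = ennreal (K * I)"
      using I K by (simp add: nn_integral_lborel_translate ennreal_mult)
    finally have "ennreal ((cmod (f (x, x * l)))\<^sup>2 * (pi * \<rho>\<^sup>2 * (pi * \<delta>\<^sup>2))) \<le> ennreal (K * I)"
      unfolding vol by (simp add: ennreal_mult)
    then have main: "(cmod (f (x, x * l)))\<^sup>2 * (pi * \<rho>\<^sup>2 * (pi * \<delta>\<^sup>2)) \<le> K * I"
      using K I by (simp add: ennreal_le_iff)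
    define c where "c = pi * pi * (1/2) ^ j / (4 * 2 ^ q)"
    have c: "c > 0" by (simp add: c_def)
    have "pi * \<rho>\<^sup>2 * (pi * \<delta>\<^sup>2) = c * (v\<^sup>2 / v ^ q)"
      unfolding \<delta>(2) \<rho>_def c_def using v by (simp add: power_mult_distrib power_divide mult_ac)
    with main have "(cmod (f (x, x * l)))\<^sup>2 * c * (v\<^sup>2 / v ^ q) \<le> K * I"
      by (simp add: mult.assoc)
    then have "(cmod (f (x, x * l)))\<^sup>2 \<le> K * I / c * (v ^ q / v\<^sup>2)"
      using c v by (simp add: field_simps)
    also have "\<dots> = 2 ^ nat \<bar>- e\<bar> * I / c * (v powi (- e) * v ^ q / v\<^sup>2)"
      by (simp add: K_def)
    also have "v powi (- e) * v ^ q / v\<^sup>2 = v powi (- e + int q - 2)"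
      using v by (simp add: power_int_add power_int_diff power_int_minus field_simps)
    \<comment> \<open>The inverse weight contributes -e, the tube area q and the disc of radius v /
      2 contributes -2.\<close>
    also have "- e + int q - 2 = int (2 * D + 1)"
      by (simp add: e_def)
    finally show "(cmod (f (x, x * (1/2) ^ j)))\<^sup>2 \<le> 2 ^ nat \<bar>- e\<bar> * I / c * (1 + cmod x) ^ (2 * D + 1)"
      by (simp only: l_def[symmetric] v_def[symmetric] power_int_of_nat)
  qed
qed

text \<open>Rounding the exponent D + 1/2 up would admit degree D + 1. Squared Cauchy estimates keep
  the half: for n > D they bound the squared n-th derivative at 0 by a constant times R^(2D+1-2n),
  which is at most that constant over R.\<close>

lemma polynomial_if_square_growth:
  assumes hol: "g holomorphic_on UNIV"
    and C: "\<And>x. (cmod (g x))\<^sup>2 \<le> C * (1 + cmod x) ^ (2 * D + 1)"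
  shows "\<exists>a. \<forall>x. g x = (\<Sum>n\<le>D. a n * x ^ n)"
proof -
  have "C \<ge> 0"
    using C[of 0] by (simp add: order_trans[OF zero_le_power2])
  define B where "B = C * 2 ^ (2 * D + 1)"
  have B: "0 \<le> B" using \<open>C \<ge> 0\<close> by (simp add: B_def)
  have bound: "(cmod (g x))\<^sup>2 \<le> B * cmod x ^ (2 * D + 1)" if "1 \<le> cmod x" for x
  proof -
    have "(1 + cmod x) ^ (2 * D + 1) \<le> (2 * cmod x) ^ (2 * D + 1)"
      using that by (intro power_mono) auto
    then have "C * (1 + cmod x) ^ (2 * D + 1) \<le> C * (2 * cmod x) ^ (2 * D + 1)"
      using \<open>C \<ge> 0\<close> by (intro mult_left_mono)
    with C[of x] have "(cmod (g x))\<^sup>2 \<le> C * (2 * cmod x) ^ (2 * D + 1)"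
      by (rule order_trans)
    then show ?thesis by (simp only: B_def power_mult_distrib mult.assoc)
  qed
  have zero: "(deriv ^^ n) g 0 = 0" if "n > D" for n
  proof (rule ccontr)
    assume nz: "(deriv ^^ n) g 0 \<noteq> 0"
    define d where "d = (cmod ((deriv ^^ n) g 0))\<^sup>2"
    have d: "d > 0" using nz by (simp add: d_def)
    have le: "d * R \<le> (fact n)\<^sup>2 * B" if R: "1 \<le> R" for R :: real
    proof -
      have "cmod ((deriv ^^ n) g 0) \<le> fact n * sqrt (B * R ^ (2 * D + 1)) / R ^ n"
      proof (rule Cauchy_inequality)
        fix x :: complex assume "cmod (0 - x) = R"
        then have "(cmod (g x))\<^sup>2 \<le> B * R ^ (2 * D + 1)"
          using bound[of x] R by simp
        then show "cmod (g x) \<le> sqrt (B * R ^ (2 * D + 1))"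
          by (rule real_le_rsqrt)
      qed (use R hol in \<open>auto intro: holomorphic_on_subset holomorphic_on_imp_continuous_on\<close>)
      then have "d \<le> (fact n * sqrt (B * R ^ (2 * D + 1)) / R ^ n)\<^sup>2"
        unfolding d_def by (rule power_mono) simp
      also have "\<dots> = (fact n)\<^sup>2 * (B * R ^ (2 * D + 1)) / R ^ (2 * n)"
        using B R by (simp add: power_mult_distrib power_divide power_mult[symmetric] mult.commute)
      finally have "d * R ^ (2 * n) \<le> (fact n)\<^sup>2 * B * R ^ (2 * D + 1)"
        using R by (simp add: field_simps)
      moreover have "d * R ^ (2 * D + 2) \<le> d * R ^ (2 * n)"
        using d R \<open>n > D\<close> by (intro mult_left_mono power_increasing) auto
      ultimately have "d * R * R ^ (2 * D + 1) \<le> (fact n)\<^sup>2 * B * R ^ (2 * D + 1)"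
        by (simp add: mult.assoc)
      moreover have "0 < R ^ (2 * D + 1)" using R by simp
      ultimately show ?thesis
        by (rule mult_right_le_imp_le)
    qed
    \<comment> \<open>Chosen so that d * R exceeds the bound in \<open>le\<close> by exactly d >
      0.\<close>
    define R where "R = 1 + (fact n)\<^sup>2 * B / d"
    have "1 \<le> R" using B d by (simp add: R_def)
    moreover have "d * R = d + (fact n)\<^sup>2 * B"
      using d by (simp add: R_def distrib_left)
    ultimately show False using le[of R] d by linarith
  qed
  have "g x = (\<Sum>n\<le>D. (deriv ^^ n) g 0 / fact n * x ^ n)" for x
  proof -
    have "(\<lambda>n. (deriv ^^ n) g 0 / fact n * (x - 0) ^ n) sums g x"
      by (rule holomorphic_power_series[of _ _ "cmod x + 1"]) (use hol in \<open>auto intro: holomorphic_on_subset\<close>)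
    moreover have "(\<lambda>n. (deriv ^^ n) g 0 / fact n * x ^ n) sums (\<Sum>n\<le>D. (deriv ^^ n) g 0 / fact n * x ^ n)"
      using zero by (intro sums_finite) auto
    ultimately show ?thesis by (auto intro: sums_unique2)
  qed
  then show ?thesis
    by (intro exI[of _ "\<lambda>n. (deriv ^^ n) g 0 / fact n"] allI)
qed

text \<open>The polynomial is found on a polydisc around 0 and then spread to each point of the
  domain by the identity theorem on the complex line through 0 and that point.\<close>

lemma L2_holomorphic_is_polynomial:
  assumes hol: "holomorphic2_on f (tube_domain q)"
    and int: "(\<integral>\<^sup>+p. ennreal ((cmod (f p))\<^sup>2 * (1 + cmod (fst p)) powi (int q - 3 - 2 * int D))
      * indicator (tube_domain q) p \<partial>lborel) < \<infinity>"
  obtains c where "\<And>x y. (x, y) \<in> tube_domain q \<Longrightarrow>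
    f (x, y) = (\<Sum>d\<le>D. \<Sum>b\<le>d. c d b * x ^ (d - b) * y ^ b)"
proof -
  define r :: real where "r = (1/2) ^ (q + 2)"
  have r: "r > 0" by (simp add: r_def)
  have sub: "ball 0 r \<times> ball 0 r \<subseteq> tube_domain q"
    unfolding r_def by (rule polydisc_subset_tube_domain)
  have lines: "\<exists>a. \<forall>x\<in>ball 0 r. f (x, x * (1/2) ^ j) = (\<Sum>n\<le>D. a n * x ^ n)" for j
  proof -
    obtain C where "\<And>x. (cmod (f (x, x * (1/2) ^ j)))\<^sup>2 \<le> C * (1 + cmod x) ^ (2 * D + 1)"
      using L2_bound_on_line[OF hol int] by blast
    moreover have "(x * 1, x * (1/2) ^ j) \<in> tube_domain q" for x
    proof -
      have "(cmod (x * (1/2) ^ j - x * (1/2) ^ j))\<^sup>2 * (1 + cmod x) ^ q < (1/2) ^ j"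
        by simp
      then show ?thesis
        unfolding tube_domain_def by (simp only: mem_Collect_eq fst_conv snd_conv mult_1_right) blast
    qed
    then have "(\<lambda>x. f (0 + x * 1, 0 + x * (1/2) ^ j)) holomorphic_on UNIV"
      by (intro holomorphic2_on_line[OF hol]) simp
    ultimately show ?thesis
      using polynomial_if_square_growth[of "\<lambda>x. f (x, x * (1/2) ^ j)" C D] by auto
  qed
  obtain c where c: "\<And>x y. x \<in> ball 0 r \<Longrightarrow> y \<in> ball 0 r \<Longrightarrow>
      f (x, y) = (\<Sum>d\<le>D. \<Sum>b\<le>d. c d b * x ^ (d - b) * y ^ b)"
    by (rule polynomial_if_polynomial_on_lines[OF holomorphic2_on_subset[OF hol sub] r lines]) (rule that)
  define P where "P x y = (\<Sum>d\<le>D. \<Sum>b\<le>d. c d b * x ^ (d - b) * y ^ b)" for x y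
  have "f (x, y) = P x y" if xy: "(x, y) \<in> tube_domain q" for x y
  proof -
    \<comment> \<open>The part of that complex line inside the domain, in the parameter t; it is
      star-shaped about 0, therefore connected, and contains t = 1.\<close>
    define T where "T = {t. (x * t, y * t) \<in> tube_domain q}"
    have "open ((\<lambda>t. (x * t, y * t)) -` tube_domain q)"
      by (intro open_vimage open_tube_domain continuous_intros)
    then have "open T" by (simp add: T_def vimage_def)
    have T_scale: "t * u \<in> T" if "t \<in> T" "cmod u \<le> 1" for t u
      using tube_domain_balanced[of "x * t" "y * t" q u] that by (simp add: T_def mult.assoc)
    have "1 \<in> T" using xy by (simp add: T_def)
    have "starlike T"
      unfolding starlike_def
    proof (intro bexI[of _ 0] ballI subsetI)
      fix t z assume t: "t \<in> T" and "z \<in> closed_segment 0 t"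
      then obtain u where "0 \<le> u" "u \<le> 1" "z = u *\<^sub>R t"
        by (auto simp: closed_segment_def)
      then show "z \<in> T"
        using T_scale[OF t, of "of_real u"] by (simp add: scaleR_conv_of_real mult.commute)
    qed (use T_scale[OF \<open>1 \<in> T\<close>, of 0] in simp)
    \<comment> \<open>So small that |t| <= s puts (x t, y t) into the polydisc where the polynomial
      is already known.\<close>
    define s where "s = r / (1 + cmod x + cmod y)"
    have pos: "0 < 1 + cmod x + cmod y"
      by (simp add: add_pos_nonneg)
    have s: "s > 0" "s * (1 + cmod x + cmod y) = r"
      using r pos by (auto simp: s_def)
    have s2: "s + s * cmod x + s * cmod y = r" "s * cmod x \<ge> 0" "s * cmod y \<ge> 0"
      using s by (simp_all add: algebra_simps)
    have small: "x * t \<in> ball 0 r" "y * t \<in> ball 0 r" if "cmod t \<le> s" for t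
    proof -
      have "cmod x * cmod t \<le> cmod x * s" "cmod y * cmod t \<le> cmod y * s"
        using that by (auto intro: mult_left_mono)
      then have "cmod x * cmod t < r" "cmod y * cmod t < r"
        using s2 s(1) by (simp_all only: mult.commute[of s])
      then show "x * t \<in> ball 0 r" "y * t \<in> ball 0 r"
        by (simp_all add: norm_mult)
    qed
    have Z: "cmod (of_real s * (1/2) ^ j) \<le> s" for j
      using s(1) mult_left_le[of "(1/2) ^ j" s]
      by (simp add: norm_mult norm_power norm_divide power_le_one)
    have "(\<lambda>t. f (0 + t * x, 0 + t * y) - P (x * t) (y * t)) holomorphic_on T"
      unfolding P_def
      by (intro holomorphic_intros holomorphic2_on_line[OF hol]) (simp add: T_def mult.commute)
    then have "f (0 + 1 * x, 0 + 1 * y) - P (x * 1) (y * 1) = 0"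
    proof (rule analytic_continuation[of _ T "range (\<lambda>j. of_real s * (1/2) ^ j)" 0])
      show "range (\<lambda>j. of_real s * (1/2) ^ j) \<subseteq> T"
        using small[OF Z] sub by (auto simp: T_def)
      show "0 \<in> T" using T_scale[OF \<open>1 \<in> T\<close>, of 0] by simp
      show "0 islimpt range (\<lambda>j. complex_of_real s * (1/2) ^ j)"
        using s by (intro islimpt_half_powers) auto
      fix z assume "z \<in> range (\<lambda>j. complex_of_real s * (1/2) ^ j)"
      then show "f (0 + z * x, 0 + z * y) - P (x * z) (y * z) = 0"
        using small[OF Z] c by (auto simp: P_def mult.commute[of _ x] mult.commute[of _ y])
    qed (use \<open>open T\<close> \<open>starlike T\<close> \<open>1 \<in> T\<close> starlike_imp_connected in auto)
    then show ?thesis by simp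
  qed
  then show ?thesis
    by (intro that[of c]) (simp add: P_def)
qed

section \<open>Charts of the projective plane\<close>

lemma index3_distinct: "(2::3) \<noteq> 1" "(3::3) \<noteq> 1" "(3::3) \<noteq> 2" "(1::3) \<noteq> 2" "(1::3) \<noteq> 3" "(2::3) \<noteq> 3"
  by simp_all

lemma param_eqs:
  "param 1 x = abs_P2 (vector [1, fst x, snd x])"
  "param 2 x = abs_P2 (vector [fst x, 1, snd x])"
  "param 3 x = abs_P2 (vector [fst x, snd x, 1])"
  unfolding param_def using index3_distinct by simp_all

lemma vector_3_nonzero:
  "vector [1, a, b] \<noteq> (0 :: complex^3)" "vector [a, 1, b] \<noteq> (0 :: complex^3)" "vector [a, b, 1] \<noteq> (0 :: complex^3)"
  using nonzero_if_coord[of "vector [1, a, b]" 1] nonzero_if_coord[of "vector [a, 1, b]" 2]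
    nonzero_if_coord[of "vector [a, b, 1]" 3] by simp_all

lemma ratio_param:
  "ratio i j (param 1 (x, y)) = vector [1, x, y] $ j / vector [1, x, y] $ i"
  "ratio i j (param 2 (x, y)) = vector [x, 1, y] $ j / vector [x, 1, y] $ i"
  "ratio i j (param 3 (x, y)) = vector [x, y, 1] $ j / vector [x, y, 1] $ i"
  by (simp_all add: param_eqs ratio_abs vector_3_nonzero)

lemma abs_P2_scale: "z \<noteq> 0 \<Longrightarrow> c \<noteq> 0 \<Longrightarrow> abs_P2 (c *s z) = abs_P2 z"
  by (rule Quotient_rel_abs[OF Quotient_P2, symmetric]) (auto simp: proj_rel_def)

lemma param_inject: "param 1 x = param 1 y \<longleftrightarrow> x = y"
proof
  assume "param 1 x = param 1 y"
  then have "ratio 1 2 (param 1 (fst x, snd x)) = ratio 1 2 (param 1 (fst y, snd y))"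
    "ratio 1 3 (param 1 (fst x, snd x)) = ratio 1 3 (param 1 (fst y, snd y))"
    by simp_all
  then show "x = y"
    unfolding ratio_param by (simp add: prod_eq_iff)
qed simp

lemma chart_dom_abs: "z \<noteq> 0 \<Longrightarrow> abs_P2 z \<in> chart_dom i \<longleftrightarrow> z $ i \<noteq> 0"
proof
  assume z: "z \<noteq> 0" and "abs_P2 z \<in> chart_dom i"
  then obtain w :: "complex^3" where w: "w $ i \<noteq> 0" "abs_P2 z = abs_P2 w"
    by (auto simp: chart_dom_def)
  then have "w \<noteq> 0" by (auto dest: nonzero_if_coord)
  have "z $ i / z $ i = w $ i / w $ i"
    using ratio_abs[OF z, of i i] ratio_abs[OF \<open>w \<noteq> 0\<close>, of i i] w(2) by simp
  then show "z $ i \<noteq> 0" using w(1) by auto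
qed (auto simp: chart_dom_def)

lemma param_in_chart_dom:
  "param 1 (x, y) \<in> chart_dom i \<longleftrightarrow> vector [1, x, y] $ i \<noteq> (0::complex)"
  "param 2 (x, y) \<in> chart_dom i \<longleftrightarrow> vector [x, 1, y] $ i \<noteq> (0::complex)"
  "param 3 (x, y) \<in> chart_dom i \<longleftrightarrow> vector [x, y, 1] $ i \<noteq> (0::complex)"
  by (simp_all add: param_eqs chart_dom_abs vector_3_nonzero)

lemma abs_P2_eq_param_1:
  fixes z :: "complex^3"
  assumes "z $ 1 \<noteq> 0"
  shows "abs_P2 z = param 1 (z $ 2 / z $ 1, z $ 3 / z $ 1)"
proof -
  have "param 1 (z $ 2 / z $ 1, z $ 3 / z $ 1) = abs_P2 (z $ 1 *s vector [1, z $ 2 / z $ 1, z $ 3 / z $ 1])"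
    by (simp add: param_eqs abs_P2_scale vector_3_nonzero assms)
  also have "z $ 1 *s vector [1, z $ 2 / z $ 1, z $ 3 / z $ 1] = z"
    using assms by (simp add: vec_eq_iff forall_3)
  finally show ?thesis ..
qed

lemma chart_dom_cases:
  assumes "p \<in> chart_dom i"
  obtains x y where "p = param i (x, y)"
proof -
  obtain z :: "complex^3" where z: "z $ i \<noteq> 0" "p = abs_P2 z"
    using assms by (auto simp: chart_dom_def)
  \<comment> \<open>The two conditionals select the coordinates other than i in increasing order, as
    \<open>param\<close> expects them.\<close>
  have "p = param i (z $ (if i = 1 then 2 else 1) / z $ i, z $ (if i = 3 then 2 else 3) / z $ i)"
  proof -
    define w :: "complex^3" where "w = (1 / z $ i) *s z"
    have "w $ i = 1" using z by (simp add: w_def)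
    have "abs_P2 w = p"
      unfolding w_def z(2) by (rule abs_P2_scale) (use z nonzero_if_coord in auto)
    moreover have "i = 1 \<or> i = 2 \<or> i = 3" by (rule exhaust_3)
    then have "param i (w $ (if i = 1 then 2 else 1), w $ (if i = 3 then 2 else 3)) = abs_P2 w"
      using \<open>w $ i = 1\<close> index3_distinct
      by (elim disjE) (auto simp: param_eqs vec_eq_iff forall_3 intro!: arg_cong[of _ _ abs_P2])
    ultimately show ?thesis by (simp add: w_def)
  qed
  then show ?thesis by (rule that)
qed

lemma param_1_eq_param_2: "x \<noteq> 0 \<Longrightarrow> param 1 (x, y) = param 2 (1 / x, y / x)"
  using abs_P2_eq_param_1[of "vector [1 / x, 1, y / x]"] by (simp add: param_eqs)

lemma param_1_eq_param_3: "y \<noteq> 0 \<Longrightarrow> param 1 (x, y) = param 3 (1 / y, x / y)"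
  using abs_P2_eq_param_1[of "vector [1 / y, x / y, 1]"] by (simp add: param_eqs)

lemma continuous_on_vector_3:
  assumes "continuous_on S f" "continuous_on S g" "continuous_on S h"
  shows "continuous_on S (\<lambda>x. vector [f x, g x, h x] :: complex^3)"
proof -
  have "vector [a, b, c] = (\<chi> i::3. if i = 1 then a else if i = 2 then b else c)" for a b c :: complex
    by (simp add: vec_eq_iff forall_3)
  moreover have "continuous_on S (\<lambda>x. if i = 1 then f x else if i = 2 then g x else h x)" for i :: 3
    using assms by (cases "i = 1"; cases "i = 2"; simp)
  ultimately show ?thesis
    by (simp only:) (rule continuous_on_vec_lambda)
qed

lemma open_vimage_param:
  assumes "open U"
  shows "open (param i -` U)"
proof -
  have U: "open {z. z \<noteq> 0 \<and> abs_P2 z \<in> U}"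
    using assms by (simp add: open_P2_def)
  have *: "open (param i -` U)"
    if "continuous_on UNIV f" "\<And>x. param i x = abs_P2 (f x)" "\<And>x. f x \<noteq> 0" for f
  proof -
    have "param i -` U = f -` {z. z \<noteq> 0 \<and> abs_P2 z \<in> U}"
      using that by auto
    then show ?thesis using open_vimage[OF U that(1)] by simp
  qed
  have "i = 1 \<or> i = 2 \<or> i = 3" by (rule exhaust_3)
  then show ?thesis
  proof (elim disjE)
    assume "i = 1"
    then show ?thesis
      by (intro *[of "\<lambda>x. vector [1, fst x, snd x]"] continuous_on_vector_3 continuous_intros)
        (auto simp: param_eqs vector_3_nonzero)
  next
    assume "i = 2"
    then show ?thesis
      by (intro *[of "\<lambda>x. vector [fst x, 1, snd x]"] continuous_on_vector_3 continuous_intros)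
        (auto simp: param_eqs vector_3_nonzero)
  next
    assume "i = 3"
    then show ?thesis
      by (intro *[of "\<lambda>x. vector [fst x, snd x, 1]"] continuous_on_vector_3 continuous_intros)
        (auto simp: param_eqs vector_3_nonzero)
  qed
qed

lemma continuous_on_param: "continuous_on S (param i)"
  by (rule continuous_on_subset[of UNIV])
    (auto simp: continuous_on_open_vimage open_vimage_param)

text \<open>In the quotient topology one has to show that the cone over G is open; it is described
  by the continuous quotients of coordinates on z_1 nonzero.\<close>

lemma open_image_param_1:
  assumes "open G"
  shows "open (param 1 ` G)"
proof -
  have "{z. z \<noteq> 0 \<and> abs_P2 z \<in> param 1 ` G}
      = {z::complex^3. z $ 1 \<noteq> 0} \<inter> (\<lambda>z::complex^3. (z $ 2 / z $ 1, z $ 3 / z $ 1)) -` G"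
  proof (intro set_eqI iffI)
    fix z :: "complex^3" assume "z \<in> {z. z \<noteq> 0 \<and> abs_P2 z \<in> param 1 ` G}"
    then obtain x y where z: "z \<noteq> 0" "abs_P2 z = param 1 (x, y)" "(x, y) \<in> G"
      by auto
    then have "z $ 1 \<noteq> 0"
      using chart_dom_abs[of z 1] by (simp add: param_in_chart_dom)
    with z show "z \<in> {z::complex^3. z $ 1 \<noteq> 0} \<inter> (\<lambda>z::complex^3. (z $ 2 / z $ 1, z $ 3 / z $ 1)) -` G"
      by (simp add: abs_P2_eq_param_1 param_inject)
  qed (auto simp: abs_P2_eq_param_1 dest: nonzero_if_coord)
  moreover have "open ({z::complex^3. z $ 1 \<noteq> 0} \<inter> (\<lambda>z::complex^3. (z $ 2 / z $ 1, z $ 3 / z $ 1)) -` G)"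
  proof (rule continuous_open_preimage)
    show "open {z::complex^3. z $ 1 \<noteq> 0}"
      by (intro open_Collect_neq continuous_intros)
  qed (auto intro!: continuous_intros assms)
  ultimately show ?thesis
    by (simp add: open_P2_def)
qed

section \<open>Decay of the weight at the line at infinity\<close>

lemma complex_jacobian_eq:
  assumes "(f has_derivative f') (at x)"
  shows "complex_jacobian f x = fst (f' (1, 0)) * snd (f' (0, 1)) - fst (f' (0, 1)) * snd (f' (1, 0))"
  using frechet_derivative_at[OF assms] by (simp add: complex_jacobian_def Let_def)

lemma complex_jacobian_inverse_quotient:
  assumes "x \<noteq> 0"
  shows "complex_jacobian (\<lambda>p. (1 / fst p, snd p / fst p)) (x, y) = - (1 / x ^ 3)"
proof -
  have "((\<lambda>p. (1 / fst p, snd p / fst p)) has_derivative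
      (\<lambda>v. (- fst v / x\<^sup>2, snd v / x - y * fst v / x\<^sup>2))) (at (x, y))"
    using assms by (auto intro!: derivative_eq_intros simp: field_simps power2_eq_square)
  from complex_jacobian_eq[OF this] show ?thesis
    using assms by (simp add: power2_eq_square power3_eq_cube field_simps)
qed

lemma complex_jacobian_inverse_quotient':
  assumes "y \<noteq> 0"
  shows "complex_jacobian (\<lambda>p. (1 / snd p, fst p / snd p)) (x, y) = 1 / y ^ 3"
proof -
  have "((\<lambda>p. (1 / snd p, fst p / snd p)) has_derivative
      (\<lambda>v. (- snd v / y\<^sup>2, fst v / y - x * snd v / y\<^sup>2))) (at (x, y))"
    using assms by (auto intro!: derivative_eq_intros simp: field_simps power2_eq_square)
  from complex_jacobian_eq[OF this] show ?thesis
    using assms by (simp add: power2_eq_square power3_eq_cube field_simps)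
qed

text \<open>The metric of \<open>\<O> k\<close> contributes |t|^(-2k), and the squared modulus of
  the Jacobian, which is 1 / t^3 up to sign, contributes |t|^(-6).\<close>

lemma weight_transition:
  assumes h: "hermitian_metric (\<O> k) h" and \<omega>: "volume_form \<omega>"
  shows "x \<noteq> 0 \<Longrightarrow> h 1 (param 1 (x, y)) * \<omega> 1 (param 1 (x, y))
      = h 2 (param 2 (1 / x, y / x)) * \<omega> 2 (param 2 (1 / x, y / x)) * cmod x powi (- 2 * k - 6)"
    and "y \<noteq> 0 \<Longrightarrow> h 1 (param 1 (x, y)) * \<omega> 1 (param 1 (x, y))
      = h 3 (param 3 (1 / y, x / y)) * \<omega> 3 (param 3 (1 / y, x / y)) * cmod y powi (- 2 * k - 6)"
proof -
  have hh: "h j p = h i p * (cmod (\<O> k i j p))\<^sup>2" if "p \<in> chart_dom i" "p \<in> chart_dom j" for i j p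
    using h that unfolding hermitian_metric_def by blast
  have ww: "\<omega> i p = \<omega> j p * (cmod (complex_jacobian (chart j \<circ> param i) (chart i p)))\<^sup>2"
    if "p \<in> chart_dom i" "p \<in> chart_dom j" for i j p
    using \<omega> that unfolding volume_form_def by blast
  have pw: "(cmod ((1 / t) powi k))\<^sup>2 * (cmod (1 / t ^ 3))\<^sup>2 = cmod t powi (- 2 * k - 6)" if "t \<noteq> 0" for t :: complex
  proof -
    define r where "r = cmod t"
    have r: "r \<noteq> 0" using that by (simp add: r_def)
    have "cmod ((1 / t) powi k) = r powi (- k)"
      by (simp add: r_def norm_power_int norm_divide norm_inverse power_int_inverse power_int_minus divide_inverse)
    moreover have "cmod (1 / t ^ 3) = r powi (- 3)"
      by (simp add: r_def norm_power norm_inverse power_int_minus divide_inverse)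
    ultimately have "(cmod ((1 / t) powi k))\<^sup>2 * (cmod (1 / t ^ 3))\<^sup>2
        = r powi (- k) * r powi (- k) * (r powi (- 3) * r powi (- 3))"
      by (simp only: power2_eq_square)
    also have "\<dots> = r powi (- k + - k + (- 3 + - 3))"
      using r by (simp only: power_int_add simp_thms)
    also have "- k + - k + (- 3 + - 3) = - 2 * k - 6"
      by simp
    finally show ?thesis
      unfolding r_def .
  qed
  show "h 1 (param 1 (x, y)) * \<omega> 1 (param 1 (x, y))
      = h 2 (param 2 (1 / x, y / x)) * \<omega> 2 (param 2 (1 / x, y / x)) * cmod x powi (- 2 * k - 6)" if x: "x \<noteq> 0"
  proof -
    define p where "p = param 1 (x, y)"
    have dom: "p \<in> chart_dom 1" "p \<in> chart_dom 2"
      using x by (simp_all add: p_def param_in_chart_dom)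
    have "chart 2 \<circ> param 1 = (\<lambda>p. (1 / fst p, snd p / fst p))"
      using index3_distinct by (auto simp: fun_eq_iff chart_def ratio_param)
    moreover have "chart 1 p = (x, y)"
      by (simp add: chart_def p_def ratio_param)
    ultimately have "\<omega> 1 p = \<omega> 2 p * (cmod (1 / x ^ 3))\<^sup>2"
      using ww[OF dom] x by (simp add: complex_jacobian_inverse_quotient)
    moreover have "h 1 p = h 2 p * (cmod ((1 / x) powi k))\<^sup>2"
      using hh[OF dom(2,1)] by (simp add: \<O>_def p_def ratio_param)
    ultimately have "h 1 p * \<omega> 1 p = h 2 p * \<omega> 2 p * ((cmod ((1 / x) powi k))\<^sup>2 * (cmod (1 / x ^ 3))\<^sup>2)"
      by (simp only: mult_ac)
    then show ?thesis
      using pw[OF x] param_1_eq_param_2[OF x, of y] by (simp only: p_def)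
  qed
  show "h 1 (param 1 (x, y)) * \<omega> 1 (param 1 (x, y))
      = h 3 (param 3 (1 / y, x / y)) * \<omega> 3 (param 3 (1 / y, x / y)) * cmod y powi (- 2 * k - 6)" if y: "y \<noteq> 0"
  proof -
    define p where "p = param 1 (x, y)"
    have dom: "p \<in> chart_dom 1" "p \<in> chart_dom 3"
      using y by (simp_all add: p_def param_in_chart_dom)
    have "chart 3 \<circ> param 1 = (\<lambda>p. (1 / snd p, fst p / snd p))"
      using index3_distinct by (auto simp: fun_eq_iff chart_def ratio_param)
    moreover have "chart 1 p = (x, y)"
      by (simp add: chart_def p_def ratio_param)
    ultimately have "\<omega> 1 p = \<omega> 3 p * (cmod (1 / y ^ 3))\<^sup>2"
      using ww[OF dom] y by (simp add: complex_jacobian_inverse_quotient')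
    moreover have "h 1 p = h 3 p * (cmod ((1 / y) powi k))\<^sup>2"
      using hh[OF dom(2,1)] by (simp add: \<O>_def p_def ratio_param)
    ultimately have "h 1 p * \<omega> 1 p = h 3 p * \<omega> 3 p * ((cmod ((1 / y) powi k))\<^sup>2 * (cmod (1 / y ^ 3))\<^sup>2)"
      by (simp only: mult_ac)
    then show ?thesis
      using pw[OF y] param_1_eq_param_3[OF y, of x] by (simp only: p_def)
  qed
qed

lemma smooth_imp_continuous_on: "smooth f \<Longrightarrow> continuous_on S f"
  unfolding smooth_def using Ck.simps(1)[of f] continuous_on_subset[of UNIV f S] by blast

lemma param_in_own_chart_dom: "param i x \<in> chart_dom i"
  using exhaust_3[of i] by (cases x) (auto simp: param_in_chart_dom)

lemma weight_bounded_on_polydisc: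
  assumes h: "hermitian_metric (\<O> k) h" and \<omega>: "volume_form \<omega>"
  shows "\<exists>B>0. \<forall>x \<in> cball 0 1 \<times> cball 0 1.
    1 / B \<le> h i (param i x) * \<omega> i (param i x) \<and> h i (param i x) * \<omega> i (param i x) \<le> B"
proof -
  define W where "W x = h i (param i x) * \<omega> i (param i x)" for x
  define K where "K = (cball 0 1 \<times> cball 0 1 :: (complex \<times> complex) set)"
  have K: "compact K" "K \<noteq> {}"
    by (auto simp: K_def intro!: compact_Times)
  have "continuous_on K (\<lambda>x. h i (param i x))" "continuous_on K (\<lambda>x. \<omega> i (param i x))"
    by (intro smooth_imp_continuous_on, use h in \<open>unfold hermitian_metric_def, blast\<close>,
        intro smooth_imp_continuous_on, use \<omega> in \<open>unfold volume_form_def, blast\<close>)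
  then have cont: "continuous_on K W"
    unfolding W_def[abs_def] by (rule continuous_on_mult)
  have pos: "0 < W x" for x
    unfolding W_def using h \<omega> param_in_own_chart_dom[of i x]
    unfolding hermitian_metric_def volume_form_def by (intro mult_pos_pos) blast+
  obtain a where a: "\<And>x. x \<in> K \<Longrightarrow> W a \<le> W x"
    using continuous_attains_inf[OF K cont] by blast
  obtain b where b: "\<And>x. x \<in> K \<Longrightarrow> W x \<le> W b"
    using continuous_attains_sup[OF K cont] by blast
  define B where "B = max (1 / W a) (W b)"
  have "B > 0" using pos[of b] by (simp add: B_def)
  moreover have "1 / B \<le> W a"
  proof -
    have "1 / W a \<le> B" by (simp add: B_def)
    then show ?thesis using pos[of a] \<open>B > 0\<close> by (simp add: field_simps)
  qed
  moreover have "W b \<le> B" by (simp add: B_def)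
  ultimately have "\<forall>x\<in>K. 1 / B \<le> W x \<and> W x \<le> B"
    using a b order_trans by blast
  with \<open>B > 0\<close> show ?thesis
    unfolding W_def K_def by blast
qed

text \<open>The closed unit polydiscs of the three charts cover the plane, according to the
  homogeneous coordinate of largest modulus. On each of them the weight is bounded above and below
  by compactness, so only the transition factor is left. From here on, h and the volume form enter
  through powers of 1 + |x| only.\<close>

lemma weight_comparable:
  assumes h: "hermitian_metric (\<O> k) h" and \<omega>: "volume_form \<omega>"
  obtains C where "C > 0" "\<And>x y. cmod y \<le> 1 + cmod x \<Longrightarrow>
      (1 + cmod x) powi (- 2 * k - 6) \<le> C * (h 1 (param 1 (x, y)) * \<omega> 1 (param 1 (x, y)))"
    "\<And>x y. cmod y \<le> 1 + cmod x \<Longrightarrow>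
      h 1 (param 1 (x, y)) * \<omega> 1 (param 1 (x, y)) \<le> C * (1 + cmod x) powi (- 2 * k - 6)"
proof -
  define n where "n = - 2 * k - 6"
  define W where "W i x = h i (param i x) * \<omega> i (param i x)" for i x
  have "\<forall>i. \<exists>B>0. \<forall>x \<in> cball 0 1 \<times> cball 0 1. 1 / B \<le> W i x \<and> W i x \<le> B"
    unfolding W_def using weight_bounded_on_polydisc[OF h \<omega>] by blast
  then obtain Bi where Bi: "\<And>i. Bi i > 0"
    "\<And>i x. x \<in> cball 0 1 \<times> cball 0 1 \<Longrightarrow> 1 / Bi i \<le> W i x \<and> W i x \<le> Bi i"
    by metis
  \<comment> \<open>Any common upper bound would do; it also serves for the lower bounds 1 /
    B.\<close>
  define B where "B = Bi 1 + Bi 2 + Bi 3"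
  have "B > 0" using Bi(1)[of 1] Bi(1)[of 2] Bi(1)[of 3] by (simp add: B_def)
  have "Bi i \<le> B" for i
    using Bi(1)[of 1] Bi(1)[of 2] Bi(1)[of 3] exhaust_3[of i] by (auto simp: B_def)
  then have B: "1 / B \<le> W i (u, v)" "W i (u, v) \<le> B" if "cmod u \<le> 1" "cmod v \<le> 1" for i u v
  proof -
    have "1 / B \<le> 1 / Bi i"
      using \<open>Bi i \<le> B\<close> Bi(1)[of i] \<open>B > 0\<close> by (simp add: frac_le)
    then show "1 / B \<le> W i (u, v)" "W i (u, v) \<le> B"
      using Bi(2)[of "(u, v)" i] that \<open>Bi i \<le> B\<close> by auto
  qed
  \<comment> \<open>M is 1, |x| or |y|, the largest homogeneous coordinate of [1 : x : y]; the
    hypothesis on y is what makes it comparable to 1 + |x|.\<close>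
  have key: "\<exists>M w. M > 0 \<and> (1 + cmod x) / 2 \<le> M \<and> M \<le> 2 * (1 + cmod x) \<and> 1 / B \<le> w \<and> w \<le> B
      \<and> W 1 (x, y) = w * M powi n" if le: "cmod y \<le> 1 + cmod x" for x y
  proof -
    consider "cmod x \<le> 1" "cmod y \<le> 1" | "1 \<le> cmod x" "cmod y \<le> cmod x" | "1 \<le> cmod y" "cmod x \<le> cmod y"
      by linarith
    then show ?thesis
    proof cases
      case 1
      then show ?thesis
        using B[of x y 1] by (intro exI[of _ 1] exI[of _ "W 1 (x, y)"]) (auto simp: add_nonneg_nonneg)
    next
      case 2
      then have "x \<noteq> 0" by auto
      have c: "cmod (1 / x) \<le> 1" "cmod (y / x) \<le> 1"
        using 2 by (auto simp: norm_divide divide_le_eq)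
      show ?thesis
        using B[OF c, of 2] 2 weight_transition(1)[OF h \<omega> \<open>x \<noteq> 0\<close>, of y] \<open>x \<noteq> 0\<close>
        unfolding W_def n_def
        by (intro exI[of _ "cmod x"] exI[of _ "h 2 (param 2 (1 / x, y / x)) * \<omega> 2 (param 2 (1 / x, y / x))"])
          auto
    next
      case 3
      then have "y \<noteq> 0" by auto
      have c: "cmod (1 / y) \<le> 1" "cmod (x / y) \<le> 1"
        using 3 by (auto simp: norm_divide divide_le_eq)
      show ?thesis
        using B[OF c, of 3] 3 le weight_transition(2)[OF h \<omega> \<open>y \<noteq> 0\<close>, of x] \<open>y \<noteq> 0\<close>
        unfolding W_def n_def
        by (intro exI[of _ "cmod y"] exI[of _ "h 3 (param 3 (1 / y, x / y)) * \<omega> 3 (param 3 (1 / y, x / y))"])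
          auto
    qed
  qed
  define C where "C = B * 2 ^ nat \<bar>n\<bar>"
  have "C > 0" using \<open>B > 0\<close> by (simp add: C_def)
  show ?thesis
  proof (rule that[OF \<open>C > 0\<close>])
    fix x y :: complex assume "cmod y \<le> 1 + cmod x"
    from key[OF this] obtain M w where M: "M > 0" "(1 + cmod x) / 2 \<le> M" "M \<le> 2 * (1 + cmod x)"
      and w: "1 / B \<le> w" "w \<le> B" "W 1 (x, y) = w * M powi n" by blast
    have "(1 + cmod x) powi n \<le> 2 ^ nat \<bar>n\<bar> * M powi n"
      using M by (intro power_int_comparable) auto
    also have "\<dots> \<le> 2 ^ nat \<bar>n\<bar> * ((B * w) * M powi n)"
    proof -
      have "1 \<le> B * w"
        using w(1) \<open>B > 0\<close> by (simp add: field_simps)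
      then have "1 * M powi n \<le> (B * w) * M powi n"
        using M by (intro mult_right_mono) auto
      then show ?thesis by simp
    qed
    finally show "(1 + cmod x) powi (- 2 * k - 6) \<le> C * (h 1 (param 1 (x, y)) * \<omega> 1 (param 1 (x, y)))"
      using w(3) by (simp add: C_def W_def n_def mult_ac)
    have "M powi n \<le> 2 ^ nat \<bar>n\<bar> * (1 + cmod x) powi n"
      using M by (intro power_int_comparable) (auto simp: add_pos_nonneg)
    then have "w * M powi n \<le> B * (2 ^ nat \<bar>n\<bar> * (1 + cmod x) powi n)"
      using w(2) M \<open>B > 0\<close> by (intro mult_mono) auto
    then show "h 1 (param 1 (x, y)) * \<omega> 1 (param 1 (x, y)) \<le> C * (1 + cmod x) powi (- 2 * k - 6)"
      using w(3) by (simp add: C_def W_def n_def mult_ac)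
  qed
qed

text \<open>\<open>chart_at\<close> prefers chart 1, so the other two summands integrate over the
  empty set.\<close>

lemma volume_integral_in_chart_1:
  assumes "\<Omega> \<subseteq> chart_dom 1"
  shows "volume_integral \<omega> \<Omega> F
    = (\<integral>\<^sup>+x. ennreal (F (param 1 x) * \<omega> 1 (param 1 x)) * indicator (param 1 -` \<Omega>) x \<partial>lborel)"
proof -
  have "chart_at p = 1" if "p \<in> \<Omega>" for p
    using that assms by (auto simp: chart_at_def)
  then have e: "{x. param 1 x \<in> \<Omega> \<and> chart_at (param 1 x) = 1} = param 1 -` \<Omega>"
    "{x. param 2 x \<in> \<Omega> \<and> chart_at (param 2 x) = 2} = {}"
    "{x. param 3 x \<in> \<Omega> \<and> chart_at (param 3 x) = 3} = {}"
    using index3_distinct by auto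
  show ?thesis
    unfolding volume_integral_def sum_3 e by simp
qed

section \<open>Sections over the tube region\<close>

text \<open>In charts 2 and 3 the first coordinate is z_1 / z_i, which is nonzero on chart 1 and may
  occur there with a negative exponent.\<close>

lemma holomorphic2_on_Laurent_monomial:
  assumes "\<And>p. p \<in> S \<Longrightarrow> fst p \<noteq> 0"
  shows "holomorphic2_on (\<lambda>p. fst p powi m * snd p ^ n) S"
  unfolding holomorphic2_on_def
proof
  fix p assume "p \<in> S"
  then have "fst p \<noteq> 0" by (rule assms)
  then have "((\<lambda>p. fst p powi m * snd p ^ n) has_derivative
      (\<lambda>v. (of_int m * fst p powi (m - 1) * snd p ^ n) * fst v + (fst p powi m * (of_nat n * snd p ^ (n - 1))) * snd v)) (at p)"
    by (auto intro!: derivative_eq_intros simp: algebra_simps)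
  then show "\<exists>a b. ((\<lambda>p. fst p powi m * snd p ^ n) has_derivative (\<lambda>v. a * fst v + b * snd v)) (at p)"
    by blast
qed

lemma holomorphic2_on_cong_open:
  assumes "holomorphic2_on g S" "open S" "\<And>p. p \<in> S \<Longrightarrow> g p = f p"
  shows "holomorphic2_on f S"
  unfolding holomorphic2_on_def
proof
  fix p assume "p \<in> S"
  then obtain a b where "(g has_derivative (\<lambda>v. a * fst v + b * snd v)) (at p)"
    using assms(1) unfolding holomorphic2_on_def by blast
  from has_derivative_transform_within_open[OF this assms(2) \<open>p \<in> S\<close> assms(3)]
  show "\<exists>a b. (f has_derivative (\<lambda>v. a * fst v + b * snd v)) (at p)"
    by blast
qed

text \<open>The complex line through 0 and (x, y) meets the polydisc in a neighbourhood of 0, and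
  the identity theorem on that line reaches (x, y).\<close>

lemma entire2_zero:
  assumes hol: "holomorphic2_on f UNIV" and r: "r > 0"
    and zero: "\<And>x y. x \<in> ball 0 r \<Longrightarrow> y \<in> ball 0 r \<Longrightarrow> f (x, y) = 0"
  shows "f (x, y) = 0"
proof -
  define s where "s = r / (1 + cmod x + cmod y)"
  have pos: "0 < 1 + cmod x + cmod y"
    by (simp add: add_pos_nonneg)
  have s: "s > 0" "s * (1 + cmod x + cmod y) = r"
    using r pos by (auto simp: s_def)
  have "(\<lambda>t. f (0 + t * x, 0 + t * y)) holomorphic_on UNIV"
    by (rule holomorphic2_on_line[OF hol]) simp
  then have "f (0 + 1 * x, 0 + 1 * y) = 0"
  proof (rule analytic_continuation[of _ UNIV "range (\<lambda>j. of_real s * (1/2) ^ j)" 0])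
    show "0 islimpt range (\<lambda>j. complex_of_real s * (1/2) ^ j)"
      using s by (intro islimpt_half_powers) auto
    fix z assume "z \<in> range (\<lambda>j. complex_of_real s * (1/2) ^ j)"
    then have "cmod z \<le> s"
      using s mult_left_le[of _ s] by (auto simp: norm_mult norm_power norm_divide power_le_one)
    then have "cmod z * cmod x \<le> s * cmod x" "cmod z * cmod y \<le> s * cmod y"
      by (auto intro: mult_right_mono)
    moreover have "s + s * cmod x + s * cmod y = r" "0 \<le> s * cmod x" "0 \<le> s * cmod y"
      using s by (simp_all add: algebra_simps)
    ultimately have "cmod z * cmod x < r" "cmod z * cmod y < r"
      using s(1) by linarith+
    then show "f (0 + z * x, 0 + z * y) = 0"
      by (intro zero) (simp_all add: norm_mult)
  qed auto
  then show ?thesis by simp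
qed

lemma polynomial_zero_on_ball:
  fixes a :: "nat \<Rightarrow> complex"
  assumes "\<And>t. cmod t < 1 \<Longrightarrow> (\<Sum>n\<le>N. a n * t ^ n) = 0" "n \<le> N"
  shows "a n = 0"
proof -
  have "(if n \<in> {..N} then a n else 0) = 0"
  proof (rule power_series_unique[of 1 _ "\<lambda>_. 0" "\<lambda>_. 0"])
    fix t :: complex assume "cmod t < 1"
    have "(\<lambda>n. if n \<in> {..N} then a n * t ^ n else 0) sums (\<Sum>n\<le>N. a n * t ^ n)"
      by (rule sums_If_finite_set) simp
    then show "(\<lambda>n. (if n \<in> {..N} then a n else 0) * t ^ n) sums 0"
      using assms(1)[OF \<open>cmod t < 1\<close>] by (auto intro: sums_cong[THEN iffD1, rotated])
  qed auto
  with assms(2) show ?thesis by simp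
qed

text \<open>On the line y = l x the expression is a polynomial in the line parameter whose
  coefficient of degree d is, up to a nonzero factor, a polynomial in the slope l with coefficients
  \<open>c d b\<close>. The one-variable statement is used twice.\<close>

lemma polynomial2_zero_on_polydisc:
  assumes r: "r > 0"
    and zero: "\<And>x y. x \<in> ball 0 r \<Longrightarrow> y \<in> ball 0 r \<Longrightarrow>
      (\<Sum>d\<le>D. \<Sum>b\<le>d. c d b * x ^ (d - b) * y ^ b) = (0::complex)"
    and "b \<le> d" "d \<le> D"
  shows "c d b = 0"
proof -
  define \<rho> :: complex where "\<rho> = of_real (r / 2)"
  have \<rho>: "\<rho> \<noteq> 0" "cmod \<rho> < r" using r by (auto simp: \<rho>_def)
  have small: "cmod (\<rho> * t) < r" if "cmod t \<le> 1" for t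
  proof -
    have "cmod \<rho> * cmod t \<le> cmod \<rho>"
      using that by (intro mult_right_le_one_le) auto
    from this \<rho>(2) have "cmod \<rho> * cmod t < r" by (rule le_less_trans)
    then show ?thesis by (simp add: norm_mult)
  qed
  have "\<rho> ^ d * (\<Sum>b\<le>d. c d b * l ^ b) = 0" if l: "cmod l < 1" for l
  proof (rule polynomial_zero_on_ball[where a = "\<lambda>d. \<rho> ^ d * (\<Sum>b\<le>d. c d b * l ^ b)" and N = D])
    fix t :: complex assume t: "cmod t < 1"
    have "cmod (t * l) \<le> 1"
      using t l by (simp add: norm_mult mult_le_one)
    then have "(\<Sum>d\<le>D. \<Sum>b\<le>d. c d b * (\<rho> * t) ^ (d - b) * (\<rho> * (t * l)) ^ b) = 0"
      using t by (intro zero) (simp_all add: small)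
    moreover have "(\<Sum>b\<le>d. c d b * (\<rho> * t) ^ (d - b) * (\<rho> * (t * l)) ^ b)
        = \<rho> ^ d * (\<Sum>b\<le>d. c d b * l ^ b) * t ^ d" for d
      unfolding sum_distrib_left sum_distrib_right
    proof (rule sum.cong)
      fix b assume "b \<in> {..d}"
      then have "(\<rho> * t) ^ d = (\<rho> * t) ^ (d - b) * (\<rho> * t) ^ b"
        by (simp flip: power_add)
      then have "\<rho> ^ d * t ^ d = (\<rho> * t) ^ (d - b) * (\<rho> * t) ^ b"
        by (simp add: power_mult_distrib)
      then show "c d b * (\<rho> * t) ^ (d - b) * (\<rho> * (t * l)) ^ b = \<rho> ^ d * (c d b * l ^ b) * t ^ d"
        by (simp add: power_mult_distrib mult_ac)
    qed simp
    ultimately show "(\<Sum>d\<le>D. \<rho> ^ d * (\<Sum>b\<le>d. c d b * l ^ b) * t ^ d) = 0"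
      by simp
  qed (use assms in auto)
  then have "(\<Sum>b\<le>d. c d b * l ^ b) = 0" if "cmod l < 1" for l
    using that \<rho> by simp
  from polynomial_zero_on_ball[OF this \<open>b \<le> d\<close>] show ?thesis .
qed

section \<open>The vector space of sections\<close>

interpretation sect: vector_space sect_scale
  by (rule vector_space_sect_scale)

interpretation sect_pair: vector_space_pair sect_scale sect_scale
  by unfold_locales

lemma sum_sect_apply: "(\<Sum>x\<in>I. F x) i p = (\<Sum>x\<in>I. (F x :: sect) i p)"
  by (induction I rule: infinite_finite_induct) auto

lemma sectionsI:
  assumes "\<And>i. holomorphic2_on (\<lambda>x. s i (param i x)) {x. param i x \<in> \<Omega>}"
    and "\<And>i j p. p \<in> \<Omega> \<Longrightarrow> p \<in> chart_dom i \<Longrightarrow> p \<in> chart_dom j \<Longrightarrow> s i p = L i j p * s j p"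
    and "\<And>i p. p \<notin> \<Omega> \<inter> chart_dom i \<Longrightarrow> s i p = 0"
  shows "s \<in> sections \<Omega> L"
  unfolding sections_def using assms by blast

lemma section_cocycle:
  "s \<in> sections \<Omega> L \<Longrightarrow> p \<in> \<Omega> \<Longrightarrow> p \<in> chart_dom i \<Longrightarrow> p \<in> chart_dom j \<Longrightarrow> s i p = L i j p * s j p"
  unfolding sections_def by blast

lemma section_outside: "s \<in> sections \<Omega> L \<Longrightarrow> p \<notin> \<Omega> \<inter> chart_dom i \<Longrightarrow> s i p = 0"
  unfolding sections_def by blast

lemma section_holomorphic: "s \<in> sections \<Omega> L \<Longrightarrow> holomorphic2_on (\<lambda>x. s i (param i x)) {x. param i x \<in> \<Omega>}"
  unfolding sections_def by blast

lemma section_transition: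
  "s \<in> sections \<Omega> (\<O> k) \<Longrightarrow> p \<in> \<Omega> \<Longrightarrow> p \<in> chart_dom i \<Longrightarrow> p \<in> chart_dom j \<Longrightarrow> s i p = ratio i j p powi k * s j p"
  using section_cocycle[of s \<Omega> "\<O> k" p i j] unfolding \<O>_def by blast

lemma subspace_sections: "sect.subspace (sections \<Omega> L)"
  unfolding sect.subspace_def
proof (intro conjI ballI allI)
  show "0 \<in> sections \<Omega> L"
  proof (rule sectionsI)
    show "holomorphic2_on (\<lambda>x. (0 :: sect) i (param i x)) {x. param i x \<in> \<Omega>}" for i
      unfolding zero_fun_apply by (rule holomorphic2_on_const)
  qed (simp_all only: zero_fun_apply mult_zero_right)
next
  fix s t assume s: "s \<in> sections \<Omega> L" and t: "t \<in> sections \<Omega> L"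
  show "s + t \<in> sections \<Omega> L"
  proof (rule sectionsI)
    show "holomorphic2_on (\<lambda>x. (s + t) i (param i x)) {x. param i x \<in> \<Omega>}" for i
      unfolding plus_fun_apply
      by (rule holomorphic2_on_add[OF section_holomorphic[OF s] section_holomorphic[OF t]])
    show "(s + t) i p = L i j p * (s + t) j p"
      if "p \<in> \<Omega>" "p \<in> chart_dom i" "p \<in> chart_dom j" for i j p
      unfolding plus_fun_apply section_cocycle[OF s that] section_cocycle[OF t that]
      by (rule distrib_left[symmetric])
    show "(s + t) i p = 0" if "p \<notin> \<Omega> \<inter> chart_dom i" for i p
      unfolding plus_fun_apply section_outside[OF s that] section_outside[OF t that]
      by (rule add_0_left)
  qed
next
  fix c s assume s: "s \<in> sections \<Omega> L"
  show "sect_scale c s \<in> sections \<Omega> L"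
  proof (rule sectionsI)
    show "holomorphic2_on (\<lambda>x. sect_scale c s i (param i x)) {x. param i x \<in> \<Omega>}" for i
      unfolding sect_scale_def by (rule holomorphic2_on_cmult[OF section_holomorphic[OF s]])
    show "sect_scale c s i p = L i j p * sect_scale c s j p"
      if "p \<in> \<Omega>" "p \<in> chart_dom i" "p \<in> chart_dom j" for i j p
      unfolding sect_scale_def section_cocycle[OF s that] by (rule mult.left_commute)
    show "sect_scale c s i p = 0" if "p \<notin> \<Omega> \<inter> chart_dom i" for i p
      by (simp add: sect_scale_def section_outside[OF s that])
  qed
qed

text \<open>Inside chart 1 the first component determines the others by the transition functions;
  outside their domains the components are 0 by convention.\<close>

lemma sections_eqI:
  assumes st: "s \<in> sections \<Omega> (\<O> k)" "t \<in> sections \<Omega> (\<O> k)" and \<Omega>: "\<Omega> \<subseteq> chart_dom 1"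
    and eq: "\<And>p. p \<in> \<Omega> \<Longrightarrow> s 1 p = t 1 p"
  shows "s = t"
proof (intro ext)
  fix i p
  show "s i p = t i p"
  proof (cases "p \<in> \<Omega> \<inter> chart_dom i")
    case True
    then have p: "p \<in> \<Omega>" "p \<in> chart_dom i" "p \<in> chart_dom 1" using \<Omega> by auto
    show ?thesis
      by (simp only: section_transition[OF st(1) p] section_transition[OF st(2) p] eq[OF p(1)])
  next
    case False
    show ?thesis by (simp only: section_outside[OF st(1) False] section_outside[OF st(2) False])
  qed
qed

lemma ratio_mult: "p \<in> chart_dom j \<Longrightarrow> ratio i j p * ratio j l p = ratio i l p"
proof -
  assume "p \<in> chart_dom j"
  then obtain z :: "complex^3" where z: "z $ j \<noteq> 0" "p = abs_P2 z"
    by (auto simp: chart_dom_def)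
  then show ?thesis
    using nonzero_if_coord[OF z(1)] by (simp add: ratio_abs)
qed

definition monomial_section :: "int \<Rightarrow> P2 set \<Rightarrow> nat \<Rightarrow> nat \<Rightarrow> sect" where
  "monomial_section k \<Omega> a b i p =
    (if p \<in> \<Omega> \<inter> chart_dom i then ratio i 1 p powi k * (ratio 1 2 p ^ a * ratio 1 3 p ^ b) else 0)"

lemma monomial_section_in_sections:
  assumes op: "open \<Omega>" and \<Omega>: "\<Omega> \<subseteq> chart_dom 1"
  shows "monomial_section k \<Omega> a b \<in> sections \<Omega> (\<O> k)"
proof -
  define s where "s = monomial_section k \<Omega> a b"
  have "holomorphic2_on (\<lambda>x. s i (param i x)) {x. param i x \<in> \<Omega>}" for i
  proof -
    define S where "S = {x. param i x \<in> \<Omega>}"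
    have "open S"
      using open_vimage_param[OF op, of i] by (simp add: S_def vimage_def)
    have s_eq: "s i (param i x) = ratio i 1 (param i x) powi k * (ratio 1 2 (param i x) ^ a * ratio 1 3 (param i x) ^ b)"
      if "x \<in> S" for x
      using that param_in_own_chart_dom by (simp add: s_def monomial_section_def S_def)
    have dom: "param i x \<in> chart_dom 1" if "x \<in> S" for x
      using that \<Omega> by (auto simp: S_def)
    have "i = 1 \<or> i = 2 \<or> i = 3" by (rule exhaust_3)
    then have "holomorphic2_on (\<lambda>x. s i (param i x)) S"
    proof (elim disjE)
      assume i: "i = 1"
      show ?thesis
      proof (rule holomorphic2_on_cong_open[OF holomorphic2_on_monomial \<open>open S\<close>])
        fix x assume "x \<in> S"
        then show "fst x ^ a * snd x ^ b = s i (param i x)"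
          using s_eq[OF \<open>x \<in> S\<close>] by (cases x) (simp add: i ratio_param)
      qed
    next
      assume i: "i = 2"
      have nz: "fst x \<noteq> 0" if "x \<in> S" for x
        using dom[OF that] by (cases x) (simp add: i param_in_chart_dom)
      show ?thesis
      proof (rule holomorphic2_on_cong_open[OF holomorphic2_on_Laurent_monomial \<open>open S\<close>])
        fix x assume "x \<in> S"
        \<comment> \<open>In chart 2, with coordinates (u, v), x = 1 / u and y = v / u; in chart 3
          the roles are exchanged, x = v / u and y = 1 / u.\<close>
        then show "fst x powi (k - int a - int b) * snd x ^ b = s i (param i x)"
          using s_eq[OF \<open>x \<in> S\<close>] nz[OF \<open>x \<in> S\<close>]
          by (cases x) (simp add: i ratio_param power_int_diff power_divide)
      qed (rule nz)
    next
      assume i: "i = 3"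
      have nz: "fst x \<noteq> 0" if "x \<in> S" for x
        using dom[OF that] by (cases x) (simp add: i param_in_chart_dom)
      show ?thesis
      proof (rule holomorphic2_on_cong_open[OF holomorphic2_on_Laurent_monomial \<open>open S\<close>])
        fix x assume "x \<in> S"
        then show "fst x powi (k - int a - int b) * snd x ^ a = s i (param i x)"
          using s_eq[OF \<open>x \<in> S\<close>] nz[OF \<open>x \<in> S\<close>]
          by (cases x) (simp add: i ratio_param power_int_diff power_divide)
      qed (rule nz)
    qed
    then show ?thesis by (simp add: S_def)
  qed
  moreover have "s i p = \<O> k i j p * s j p" if "p \<in> \<Omega>" "p \<in> chart_dom i" "p \<in> chart_dom j" for i j p
    using that ratio_mult[of p j i 1]
    by (simp add: s_def monomial_section_def \<O>_def flip: power_int_mult_distrib mult.assoc)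
  moreover have "s i p = 0" if "p \<notin> \<Omega> \<inter> chart_dom i" for i p
    unfolding s_def monomial_section_def by (rule if_not_P[OF that])
  ultimately show ?thesis
    unfolding s_def[symmetric] by (rule sectionsI)
qed

text \<open>In charts 2 and 3 the points missed by chart 1 form the axis where the first coordinate
  is 0, so \<open>holomorphic2_vanishing_off_axis\<close> covers the line at infinity.\<close>

lemma sections_zero_if_zero_in_chart_1:
  assumes s: "s \<in> sections UNIV (\<O> k)" and zero: "\<And>x. s 1 (param 1 x) = 0"
  shows "s = 0"
proof -
  have zero': "s i p = 0" if "p \<in> chart_dom 1" "p \<in> chart_dom i" for i p
  proof -
    obtain x y where "p = param 1 (x, y)"
      using \<open>p \<in> chart_dom 1\<close> by (rule chart_dom_cases)
    then show ?thesis
      using section_transition[OF s UNIV_I that(2,1)] zero by simp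
  qed
  have "s i p = 0" if p: "p \<in> chart_dom i" for i p
  proof -
    obtain x y where xy: "p = param i (x, y)"
      using p by (rule chart_dom_cases)
    have hol: "holomorphic2_on (\<lambda>x. s i (param i x)) (ball 0 (cmod y + 1) \<times> ball 0 (cmod y + 1))"
      using section_holomorphic[OF s, of i] by (rule holomorphic2_on_subset) simp
    have "i = 1 \<or> i = 2 \<or> i = 3" by (rule exhaust_3)
    then have "param i (x, y) \<in> chart_dom 1" if "x \<noteq> 0" for x y
      by (elim disjE) (simp_all add: param_in_chart_dom that)
    then have nz: "s i (param i (x, y)) = 0" if "x \<noteq> 0" for x y
      using that by (intro zero' param_in_own_chart_dom)
    show ?thesis
    proof (cases "x = 0")
      case True
      then show ?thesis
        using holomorphic2_vanishing_off_axis[OF hol] nz xy by simp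
    qed (simp add: nz xy)
  qed
  then have "s i p = 0" for i p
    using section_outside[OF s, of p i] by (cases "p \<in> chart_dom i") simp_all
  then show ?thesis
    by (simp add: fun_eq_iff)
qed

section \<open>The region and its comparison with global sections\<close>

definition tube_region :: "nat \<Rightarrow> P2 set" where
  "tube_region q = param 1 ` tube_domain q"

lemma tube_region_subset: "tube_region q \<subseteq> chart_dom 1"
  by (auto simp: tube_region_def param_in_own_chart_dom)

lemma vimage_tube_region: "param 1 -` tube_region q = tube_domain q" "{x. param 1 x \<in> tube_region q} = tube_domain q"
  by (auto simp: tube_region_def param_inject)

lemma open_tube_region: "open (tube_region q)"
  unfolding tube_region_def by (intro open_image_param_1 open_tube_domain)

lemma connected_tube_region: "connected (tube_region q)"
  unfolding tube_region_def
  by (intro connected_continuous_image continuous_on_param starlike_imp_connected starlike_tube_domain)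

lemma global_section_zero:
  assumes s: "s \<in> sections UNIV (\<O> k)" and zero: "\<And>p. p \<in> tube_region q \<Longrightarrow> s 1 p = 0"
  shows "s = 0"
proof (rule sections_zero_if_zero_in_chart_1[OF s])
  fix x
  have "s 1 (param 1 (fst x, snd x)) = 0"
  proof (rule entire2_zero[of "\<lambda>x. s 1 (param 1 x)" "(1/2) ^ (q + 2)"])
    show "holomorphic2_on (\<lambda>x. s 1 (param 1 x)) UNIV"
      using section_holomorphic[OF s, of 1] by simp
    show "s 1 (param 1 (x, y)) = 0" if "x \<in> ball 0 ((1/2) ^ (q + 2))" "y \<in> ball 0 ((1/2) ^ (q + 2))" for x y
    proof -
      have "(x, y) \<in> tube_domain q"
        using polydisc_subset_tube_domain that by blast
      then show ?thesis by (intro zero) (simp add: tube_region_def)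
    qed
  qed simp
  then show "s 1 (param 1 x) = 0" by simp
qed

text \<open>In the chart around \<open>[0 : 1 : 0]\<close> the section \<open>x\<^sup>D\<close> of \<open>\<O>(k)\<close> becomes \<open>u\<^sup>k\<^sup>-\<^sup>D\<close>.\<close>

lemma monomial_not_global:
  assumes s: "s \<in> sections UNIV (\<O> k)" and D: "int D > k"
    and eq: "\<And>p. p \<in> tube_region q \<Longrightarrow> s 1 p = ratio 1 2 p ^ D"
  shows False
proof -
  \<comment> \<open>Equality with x^D is first extended from the region to all of chart 1, where
    both sides are entire.\<close>
  have "s 1 (param 1 (x, y)) + (-1) * (x ^ D * y ^ 0) = 0" for x y
  proof (rule entire2_zero[of "\<lambda>p. s 1 (param 1 p) + (-1) * (fst p ^ D * snd p ^ 0)" "(1/2) ^ (q + 2)", simplified fst_conv snd_conv])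
    show "holomorphic2_on (\<lambda>p. s 1 (param 1 p) + (-1) * (fst p ^ D * snd p ^ 0)) UNIV"
      using section_holomorphic[OF s, of 1]
      by (intro holomorphic2_on_add holomorphic2_on_cmult holomorphic2_on_monomial) simp
    show "s 1 (param 1 (x, y)) + (-1) * (x ^ D * y ^ 0) = 0"
      if "x \<in> ball 0 ((1/2) ^ (q + 2))" "y \<in> ball 0 ((1/2) ^ (q + 2))" for x y
    proof -
      have "(x, y) \<in> tube_domain q"
        using polydisc_subset_tube_domain that by blast
      then show ?thesis by (subst eq) (simp_all add: tube_region_def ratio_param)
    qed
  qed simp
  then have s1: "s 1 (param 1 (x, y)) = x ^ D" for x y
    by simp
  define m where "m = nat (int D - k)"
  have m: "int m = int D - k" "m > 0"
    using D by (auto simp: m_def)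
  define g where "g u = s 2 (param 2 (0 + u * 1, 0 + u * 0))" for u
  have g: "g u * u ^ m = 1" if "u \<noteq> 0" for u
  proof -
    have "param 2 (u, 0) = param 1 (1 / u, 0)"
      using param_1_eq_param_2[of "1 / u" 0] that by simp
    moreover have "param 2 (u, 0) \<in> chart_dom 1" "param 2 (u, 0) \<in> chart_dom 2"
      using that by (simp_all add: param_in_chart_dom)
    ultimately have "g u = u powi k * (1 / u) ^ D"
      using section_transition[OF s, of "param 2 (u, 0)" 2 1] s1[of "1 / u" 0]
      by (simp add: g_def ratio_param)
    also have "\<dots> = u powi (- int m)"
      using that by (simp add: m(1) power_int_diff power_divide)
    finally show ?thesis
      using that by (simp add: power_int_minus)
  qed
  have "g holomorphic_on UNIV"
    unfolding g_def[abs_def]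
    by (rule holomorphic2_on_line[OF section_holomorphic[OF s]]) simp
  then have "(\<lambda>u. g u * u ^ m - 1) holomorphic_on UNIV"
    by (intro holomorphic_intros)
  \<comment> \<open>Since m > 0 this reads -1 = 0: the function u^(-m) has no entire
    extension.\<close>
  then have "g 0 * 0 ^ m - 1 = 0"
    by (rule analytic_continuation[of _ UNIV "range (\<lambda>j. 1 * (1/2) ^ j)" 0])
      (use islimpt_half_powers[of 1] g in auto)
  then show False using m(2) by (simp add: power_0_left)
qed

section \<open>Square integrability of monomials\<close>

lemma nn_integral_indicator_finite_mono:
  assumes G: "open G" and g: "continuous_on G g" and C: "C \<ge> 0"
    and le: "\<And>x. x \<in> G \<Longrightarrow> f x \<le> C * g x" and g0: "\<And>x. x \<in> G \<Longrightarrow> 0 \<le> g x"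
    and fin: "(\<integral>\<^sup>+x. ennreal (g x) * indicator G x \<partial>lborel) < \<infinity>"
  shows "(\<integral>\<^sup>+x. ennreal (f x) * indicator G x \<partial>lborel) < \<infinity>"
proof -
  have "(\<lambda>x. ennreal (indicator G x *\<^sub>R g x)) \<in> borel_measurable borel"
    using borel_measurable_continuous_on_indicator[OF _ g] G by simp
  also have "(\<lambda>x. ennreal (indicator G x *\<^sub>R g x)) = (\<lambda>x. ennreal (g x) * indicator G x)"
    by (auto simp: indicator_def)
  finally have m: "(\<lambda>x. ennreal (g x) * indicator G x) \<in> borel_measurable lborel"
    by simp
  have "(\<integral>\<^sup>+x. ennreal (f x) * indicator G x \<partial>lborel) \<le> (\<integral>\<^sup>+x. ennreal C * (ennreal (g x) * indicator G x) \<partial>lborel)"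
  proof (rule nn_integral_mono)
    fix x
    show "ennreal (f x) * indicator G x \<le> ennreal C * (ennreal (g x) * indicator G x)"
    proof (cases "x \<in> G")
      case True
      have "ennreal (f x) \<le> ennreal (C * g x)"
        by (intro ennreal_leI le True)
      with True show ?thesis
        using C g0[OF True] by (simp add: ennreal_mult)
    qed simp
  qed
  also have "\<dots> = ennreal C * (\<integral>\<^sup>+x. ennreal (g x) * indicator G x \<partial>lborel)"
    by (rule nn_integral_cmult[OF m])
  also have "\<dots> < \<infinity>"
    using fin by (simp add: ennreal_mult_less_top)
  finally show ?thesis .
qed

lemma bergman_integral_tube_region:
  "volume_integral \<omega> (tube_region q) (\<lambda>p. Re (hermitian_form h s s p))
    = (\<integral>\<^sup>+x. ennreal ((cmod (s 1 (param 1 x)))\<^sup>2 * (h 1 (param 1 x) * \<omega> 1 (param 1 x))) * indicator (tube_domain q) x \<partial>lborel)"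
proof -
  have "chart_at (param 1 x) = 1" for x
    by (simp add: chart_at_def param_in_own_chart_dom)
  then have "Re (hermitian_form h s s (param 1 x)) = h 1 (param 1 x) * (cmod (s 1 (param 1 x)))\<^sup>2" for x
    by (simp add: hermitian_form_def mult.assoc complex_mult_cnj cmod_power2)
  then show ?thesis
    by (simp add: volume_integral_in_chart_1[OF tube_region_subset] vimage_tube_region mult_ac)
qed

lemma norm_monomial_le_on_tube_domain:
  assumes "(x, y) \<in> tube_domain q"
  shows "cmod (x ^ a * y ^ b) ^ 2 \<le> (1 + cmod x) ^ (2 * (a + b))"
proof -
  have "cmod (x ^ a * y ^ b) \<le> (1 + cmod x) ^ a * (1 + cmod x) ^ b"
    unfolding norm_mult norm_power using tube_domain_snd_le[OF assms]
    by (intro mult_mono power_mono) auto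
  then have "cmod (x ^ a * y ^ b) ^ 2 \<le> ((1 + cmod x) ^ (a + b)) ^ 2"
    by (intro power_mono) (auto simp: power_add)
  then show ?thesis by (simp add: power_mult[symmetric] mult.commute)
qed

lemma weight_continuous:
  assumes "hermitian_metric (\<O> k) h" "volume_form \<omega>"
  shows "continuous_on S (\<lambda>x. h 1 (param 1 x) * \<omega> 1 (param 1 x))"
proof (rule continuous_on_mult)
  show "continuous_on S (\<lambda>x. h 1 (param 1 x))"
    using assms(1) unfolding hermitian_metric_def by (intro smooth_imp_continuous_on) blast
  show "continuous_on S (\<lambda>x. \<omega> 1 (param 1 x))"
    using assms(2) unfolding volume_form_def by (intro smooth_imp_continuous_on) blast
qed

text \<open>On the tubes |y| <= v with v = 1 + |x|, hence |x^a y^b|^2 <= v^(2D). Times the weight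
  this is a multiple of v^(q-3) at most, which is integrable over the tubes.\<close>

lemma monomial_section_in_bergman_space:
  assumes h: "hermitian_metric (\<O> k) h" and \<omega>: "volume_form \<omega>"
    and q: "int q = 2 * int D - 2 * k - 3" and ab: "a + b \<le> D"
  shows "monomial_section k (tube_region q) a b \<in> bergman_space h \<omega> (tube_region q) (\<O> k)"
proof -
  define s where "s = monomial_section k (tube_region q) a b"
  have "s \<in> sections (tube_region q) (\<O> k)"
    unfolding s_def by (intro monomial_section_in_sections open_tube_region tube_region_subset)
  obtain C where C: "C > 0" "\<And>x y. cmod y \<le> 1 + cmod x \<Longrightarrow>
      h 1 (param 1 (x, y)) * \<omega> 1 (param 1 (x, y)) \<le> C * (1 + cmod x) powi (- 2 * k - 6)"
    using weight_comparable[OF h \<omega>] by metis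
  have "(\<integral>\<^sup>+x. ennreal ((cmod (s 1 (param 1 x)))\<^sup>2 * (h 1 (param 1 x) * \<omega> 1 (param 1 x)))
      * indicator (tube_domain q) x \<partial>lborel) < \<infinity>"
  proof (rule nn_integral_indicator_finite_mono[OF open_tube_domain _ _ _ _ nn_integral_tube_domain_finite])
    show "continuous_on (tube_domain q) (\<lambda>x. (1 + cmod (fst x)) powi (int q - 3))"
      by (intro continuous_intros) (auto simp: add_nonneg_eq_0_iff)
    fix p assume "p \<in> tube_domain q"
    moreover obtain x y where p: "p = (x, y)" by (cases p)
    ultimately have xy: "(x, y) \<in> tube_domain q" by simp
    define v where "v = 1 + cmod x"
    have v: "v \<ge> 1" by (simp add: v_def)
    have "s 1 (param 1 (x, y)) = x ^ a * y ^ b"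
      using xy by (simp add: s_def monomial_section_def param_in_own_chart_dom vimage_tube_region
          ratio_param tube_region_def)
    then have "(cmod (s 1 (param 1 (x, y))))\<^sup>2 \<le> v ^ (2 * (a + b))"
      using norm_monomial_le_on_tube_domain[OF xy, of a b] by (simp add: v_def)
    also have "\<dots> \<le> v ^ (2 * D)"
      using v ab by (intro power_increasing) auto
    finally have "(cmod (s 1 (param 1 (x, y))))\<^sup>2 * (h 1 (param 1 (x, y)) * \<omega> 1 (param 1 (x, y)))
        \<le> v ^ (2 * D) * (C * v powi (- 2 * k - 6))"
    proof (rule mult_mono)
      show "h 1 (param 1 (x, y)) * \<omega> 1 (param 1 (x, y)) \<le> C * v powi (- 2 * k - 6)"
        unfolding v_def by (intro C(2) tube_domain_snd_le[OF xy])
      show "0 \<le> h 1 (param 1 (x, y)) * \<omega> 1 (param 1 (x, y))"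
        using h \<omega> param_in_own_chart_dom[of 1 "(x, y)"]
        unfolding hermitian_metric_def volume_form_def by (intro mult_nonneg_nonneg less_imp_le) blast+
    qed (use v in simp)
    also have "\<dots> = C * v powi (int (2 * D) + (- 2 * k - 6))"
    proof -
      have "v powi (int (2 * D) + (- 2 * k - 6)) = v powi int (2 * D) * v powi (- 2 * k - 6)"
        using v by (intro power_int_add) simp
      then show ?thesis by (simp only: power_int_of_nat mult_ac)
    qed
    also have "int (2 * D) + (- 2 * k - 6) = int q - 3"
      using q by simp
    finally show "(cmod (s 1 (param 1 p)))\<^sup>2 * (h 1 (param 1 p) * \<omega> 1 (param 1 p)) \<le> C * (1 + cmod (fst p)) powi (int q - 3)"
      by (simp add: p v_def)
  qed (use C in \<open>auto simp: add_nonneg_nonneg\<close>)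
  with \<open>s \<in> sections (tube_region q) (\<O> k)\<close> show ?thesis
    unfolding s_def[symmetric] bergman_space_def bergman_integral_tube_region by simp
qed

section \<open>Dimensions\<close>

text \<open>A pair (d, b) stands for x^(d-b) y^b, indexed by total degree; the bound b <= d makes
  the natural-number subtraction exact.\<close>

definition degree_pairs :: "nat \<Rightarrow> (nat \<times> nat) set" where
  "degree_pairs D = (SIGMA d:{..D}. {..d})"

lemma finite_degree_pairs: "finite (degree_pairs D)"
  by (simp add: degree_pairs_def)

lemma sum_degree_pairs: "(\<Sum>z\<in>degree_pairs D. F z) = (\<Sum>d\<le>D. \<Sum>b\<le>d. F (d, b))"
  unfolding degree_pairs_def by (subst sum.Sigma) simp_all

lemma card_degree_pairs: "2 * card (degree_pairs D) = (D + 1) * (D + 2)"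
proof -
  have "card (degree_pairs D) = (\<Sum>d\<le>D. d + 1)"
    by (simp add: degree_pairs_def)
  moreover have "2 * (\<Sum>d\<le>D. d + 1) = (D + 1) * (D + 2)"
    by (induction D) auto
  ultimately show ?thesis by simp
qed

abbreviation basis_section :: "int \<Rightarrow> nat \<Rightarrow> nat \<times> nat \<Rightarrow> sect" where
  "basis_section k q \<equiv> \<lambda>(d, b). monomial_section k (tube_region q) (d - b) b"

lemma basis_combination_apply:
  assumes "(x, y) \<in> tube_domain q"
  shows "(\<Sum>z\<in>degree_pairs D. sect_scale (c z) (basis_section k q z)) 1 (param 1 (x, y))
    = (\<Sum>d\<le>D. \<Sum>b\<le>d. c (d, b) * x ^ (d - b) * y ^ b)"
proof -
  have "monomial_section k (tube_region q) a b 1 (param 1 (x, y)) = x ^ a * y ^ b" for a b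
    using assms by (simp add: monomial_section_def param_in_own_chart_dom tube_region_def ratio_param)
  then show ?thesis
    by (simp add: sum_sect_apply sect_scale_def sum_degree_pairs mult.assoc)
qed

lemma basis_combination_in_sections:
  "(\<Sum>z\<in>degree_pairs D. sect_scale (c z) (basis_section k q z)) \<in> sections (tube_region q) (\<O> k)"
proof (rule sect.subspace_sum[OF subspace_sections], rule sect.subspace_scale[OF subspace_sections])
  fix z :: "nat \<times> nat"
  show "basis_section k q z \<in> sections (tube_region q) (\<O> k)"
    by (cases z) (simp add: monomial_section_in_sections open_tube_region tube_region_subset)
qed

text \<open>The choice of q makes -2k - 6 equal to q - 3 - 2D, so after the lower bound for the
  weight the polynomial criterion applies to the component in chart 1.\<close>

lemma bergman_space_subset_span:
  assumes h: "hermitian_metric (\<O> k) h" and \<omega>: "volume_form \<omega>"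
    and q: "int q = 2 * int D - 2 * k - 3"
  shows "bergman_space h \<omega> (tube_region q) (\<O> k) \<subseteq> sect.span (basis_section k q ` degree_pairs D)"
proof
  fix s assume "s \<in> bergman_space h \<omega> (tube_region q) (\<O> k)"
  then have s: "s \<in> sections (tube_region q) (\<O> k)"
    and fin: "(\<integral>\<^sup>+x. ennreal ((cmod (s 1 (param 1 x)))\<^sup>2 * (h 1 (param 1 x) * \<omega> 1 (param 1 x)))
      * indicator (tube_domain q) x \<partial>lborel) < \<infinity>"
    unfolding bergman_space_def bergman_integral_tube_region by auto
  define f where "f x = s 1 (param 1 x)" for x
  have hol: "holomorphic2_on f (tube_domain q)"
    unfolding f_def[abs_def] using section_holomorphic[OF s, of 1] by (simp add: vimage_tube_region)
  obtain C where C: "C > 0" "\<And>x y. cmod y \<le> 1 + cmod x \<Longrightarrow>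
      (1 + cmod x) powi (- 2 * k - 6) \<le> C * (h 1 (param 1 (x, y)) * \<omega> 1 (param 1 (x, y)))"
    using weight_comparable[OF h \<omega>] by metis
  have exponent: "int q - 3 - 2 * int D = - 2 * k - 6"
    using q by simp
  have int: "(\<integral>\<^sup>+p. ennreal ((cmod (f p))\<^sup>2 * (1 + cmod (fst p)) powi (int q - 3 - 2 * int D))
      * indicator (tube_domain q) p \<partial>lborel) < \<infinity>"
    unfolding exponent
  proof (rule nn_integral_indicator_finite_mono[OF open_tube_domain _ less_imp_le[OF C(1)] _ _ fin[folded f_def]])
    show "continuous_on (tube_domain q) (\<lambda>x. (cmod (f x))\<^sup>2 * (h 1 (param 1 x) * \<omega> 1 (param 1 x)))"
      by (intro continuous_on_mult continuous_on_power continuous_on_norm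
          holomorphic2_on_imp_continuous_on[OF hol] weight_continuous[OF h \<omega>])
    fix p assume "p \<in> tube_domain q"
    then have "(1 + cmod (fst p)) powi (- 2 * k - 6) \<le> C * (h 1 (param 1 p) * \<omega> 1 (param 1 p))"
      using C(2)[of "snd p" "fst p"] tube_domain_snd_le[of "fst p" "snd p" q] by simp
    then have "(cmod (f p))\<^sup>2 * (1 + cmod (fst p)) powi (- 2 * k - 6) \<le> (cmod (f p))\<^sup>2 * (C * (h 1 (param 1 p) * \<omega> 1 (param 1 p)))"
      by (intro mult_left_mono) auto
    then show "(cmod (f p))\<^sup>2 * (1 + cmod (fst p)) powi (- 2 * k - 6) \<le> C * ((cmod (f p))\<^sup>2 * (h 1 (param 1 p) * \<omega> 1 (param 1 p)))"
      by (simp only: mult_ac)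
    show "0 \<le> (cmod (f p))\<^sup>2 * (h 1 (param 1 p) * \<omega> 1 (param 1 p))"
      using h \<omega> param_in_own_chart_dom[of 1 p]
      unfolding hermitian_metric_def volume_form_def
      by (intro mult_nonneg_nonneg zero_le_power2 less_imp_le) blast+
  qed
  obtain c where c: "\<And>x y. (x, y) \<in> tube_domain q \<Longrightarrow>
      f (x, y) = (\<Sum>d\<le>D. \<Sum>b\<le>d. c d b * x ^ (d - b) * y ^ b)"
    by (rule L2_holomorphic_is_polynomial[OF hol int]) (rule that)
  have "s = (\<Sum>z\<in>degree_pairs D. sect_scale ((\<lambda>(d, b). c d b) z) (basis_section k q z))"
  proof (rule sections_eqI[OF s basis_combination_in_sections tube_region_subset])
    fix p assume "p \<in> tube_region q"
    then obtain x y where p: "p = param 1 (x, y)" "(x, y) \<in> tube_domain q"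
      by (auto simp: tube_region_def)
    then show "s 1 p = (\<Sum>z\<in>degree_pairs D. sect_scale ((\<lambda>(d, b). c d b) z) (basis_section k q z)) 1 p"
      using c[OF p(2)] basis_combination_apply[OF p(2), of "\<lambda>(d, b). c d b"] by (simp add: f_def)
  qed
  also have "\<dots> \<in> sect.span (basis_section k q ` degree_pairs D)"
    by (intro sect.span_sum sect.span_scale sect.span_base) auto
  finally show "s \<in> sect.span (basis_section k q ` degree_pairs D)" .
qed

text \<open>Independence is a property of sets, whereas the monomials form an indexed family.
  Injectivity is therefore derived first, since coinciding members would cancel with coefficients 1
  and -1.\<close>

lemma (in vector_space) independent_image_if_unique_combination:
  assumes fin: "finite I" and zero: "\<And>c i. (\<Sum>i\<in>I. scale (c i) (E i)) = 0 \<Longrightarrow> i \<in> I \<Longrightarrow> c i = 0"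
  shows "inj_on E I" "independent (E ` I)"
proof -
  show inj: "inj_on E I"
  proof (rule inj_onI, rule ccontr)
    fix i j assume ij: "i \<in> I" "j \<in> I" "E i = E j" "i \<noteq> j"
    define c where "c l = (if l = i then 1 else if l = j then -1 else 0 :: 'a)" for l
    have "(\<Sum>l\<in>I. scale (c l) (E l)) = (\<Sum>l\<in>{i, j}. scale (c l) (E l))"
      by (rule sum.mono_neutral_right) (use fin ij in \<open>auto simp: c_def\<close>)
    also have "\<dots> = 0"
      using ij by (simp add: c_def)
    finally have "c i = 0"
      using zero ij(1) by blast
    then show False by (simp add: c_def)
  qed
  have "\<not> (\<exists>u. (\<exists>v\<in>E ` I. u v \<noteq> 0) \<and> (\<Sum>v\<in>E ` I. scale (u v) v) = 0)"
  proof
    assume "\<exists>u. (\<exists>v\<in>E ` I. u v \<noteq> 0) \<and> (\<Sum>v\<in>E ` I. scale (u v) v) = 0"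
    then obtain u i where u: "i \<in> I" "u (E i) \<noteq> 0" "(\<Sum>v\<in>E ` I. scale (u v) v) = 0" by blast
    then have "(\<Sum>i\<in>I. scale (u (E i)) (E i)) = 0"
      by (simp add: sum.reindex[OF inj])
    from zero[OF this u(1)] u(2) show False by simp
  qed
  then show "independent (E ` I)"
    using dependent_finite[of "E ` I"] fin by simp
qed

lemma basis_section_independent:
  "inj_on (basis_section k q) (degree_pairs D)" "sect.independent (basis_section k q ` degree_pairs D)"
proof -
  have *: "c z = 0"
    if 0: "(\<Sum>z\<in>degree_pairs D. sect_scale (c z) (basis_section k q z)) = 0" and z: "z \<in> degree_pairs D" for c z
  proof -
    obtain d b where db: "z = (d, b)" "d \<le> D" "b \<le> d"
      using z by (auto simp: degree_pairs_def)
    have "(\<lambda>d b. c (d, b)) d b = 0"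
    proof (rule polynomial2_zero_on_polydisc[where r = "(1/2) ^ (q + 2)" and D = D and c = "\<lambda>d b. c (d, b)"])
      fix x y :: complex assume "x \<in> ball 0 ((1/2) ^ (q + 2))" "y \<in> ball 0 ((1/2) ^ (q + 2))"
      then have "(x, y) \<in> tube_domain q"
        using polydisc_subset_tube_domain by blast
      from basis_combination_apply[OF this, of c k D] 0
      show "(\<Sum>d\<le>D. \<Sum>b\<le>d. c (d, b) * x ^ (d - b) * y ^ b) = 0" by simp
    qed (use db in auto)
    then show ?thesis by (simp add: db)
  qed
  show "inj_on (basis_section k q) (degree_pairs D)"
    by (rule sect.independent_image_if_unique_combination(1)[OF finite_degree_pairs]) (rule *)
  show "sect.independent (basis_section k q ` degree_pairs D)"
    by (rule sect.independent_image_if_unique_combination(2)[OF finite_degree_pairs]) (rule *)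
qed

section \<open>Restriction of global sections and the dimension count\<close>

definition restrict_section :: "P2 set \<Rightarrow> sect \<Rightarrow> sect" where
  "restrict_section \<Omega> s i p = (if p \<in> \<Omega> then s i p else 0)"

lemma linear_restrict_section: "Vector_Spaces.linear sect_scale sect_scale (restrict_section \<Omega>)"
  unfolding Vector_Spaces.linear_iff
  by (auto simp: vector_space_sect_scale restrict_section_def sect_scale_def fun_eq_iff)

lemma restrict_section_in_sections:
  assumes s: "s \<in> sections UNIV L" and op: "open \<Omega>"
  shows "restrict_section \<Omega> s \<in> sections \<Omega> L"
proof -
  have "holomorphic2_on (\<lambda>x. restrict_section \<Omega> s i (param i x)) {x. param i x \<in> \<Omega>}" for i
  proof (rule holomorphic2_on_cong_open)
    show "holomorphic2_on (\<lambda>x. s i (param i x)) {x. param i x \<in> \<Omega>}"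
      using section_holomorphic[OF s, of i] by (rule holomorphic2_on_subset) simp
    show "open {x. param i x \<in> \<Omega>}"
      using open_vimage_param[OF op, of i] by (simp add: vimage_def)
  qed (simp add: restrict_section_def)
  moreover have "restrict_section \<Omega> s i p = L i j p * restrict_section \<Omega> s j p"
    if "p \<in> \<Omega>" "p \<in> chart_dom i" "p \<in> chart_dom j" for i j p
    using that section_cocycle[OF s UNIV_I that(2,3)] by (simp add: restrict_section_def)
  moreover have "restrict_section \<Omega> s i p = 0" if "p \<notin> \<Omega> \<inter> chart_dom i" for i p
    using that section_outside[OF s, of p i] by (simp add: restrict_section_def)
  ultimately show ?thesis
    by (rule sectionsI)
qed

text \<open>The integrand is the same on the smaller set, for the same metric and volume form, so
  the integral can only decrease.\<close>

lemma restrict_section_in_bergman_space: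
  assumes s: "s \<in> bergman_space h \<omega> UNIV L" and op: "open \<Omega>"
  shows "restrict_section \<Omega> s \<in> bergman_space h \<omega> \<Omega> L"
proof -
  have "volume_integral \<omega> \<Omega> (\<lambda>p. Re (hermitian_form h (restrict_section \<Omega> s) (restrict_section \<Omega> s) p))
      \<le> volume_integral \<omega> UNIV (\<lambda>p. Re (hermitian_form h s s p))"
    unfolding volume_integral_def
    by (intro sum_mono nn_integral_mono)
      (auto simp: indicator_def hermitian_form_def restrict_section_def Let_def)
  also have "\<dots> < \<infinity>"
    using s by (simp add: bergman_space_def)
  finally show ?thesis
    using restrict_section_in_sections[OF _ op] s by (simp add: bergman_space_def)
qed

lemma cdim_bergman_space_tube_region:
  assumes h: "hermitian_metric (\<O> k) h" and \<omega>: "volume_form \<omega>"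
    and q: "int q = 2 * int D - 2 * k - 3"
  shows "cdim (bergman_space h \<omega> (tube_region q) (\<O> k)) = enat (card (degree_pairs D))"
proof -
  let ?B = "basis_section k q ` degree_pairs D" and ?V = "bergman_space h \<omega> (tube_region q) (\<O> k)"
  have "?B \<subseteq> ?V"
    using monomial_section_in_bergman_space[OF h \<omega> q] by (auto simp: degree_pairs_def)
  moreover note bergman_space_subset_span[OF h \<omega> q]
  moreover have "card ?B = card (degree_pairs D)"
    by (rule card_image[OF basis_section_independent(1)])
  ultimately have "sect.dim ?V = card (degree_pairs D)"
    by (intro sect.dim_unique[OF _ _ basis_section_independent(2)])
  moreover have "\<exists>B. finite B \<and> ?V \<subseteq> sect.span B"
    using bergman_space_subset_span[OF h \<omega> q] finite_degree_pairs by blast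
  ultimately show ?thesis
    by (simp add: cdim_def)
qed

text \<open>The global Bergman space need not be computed. A maximal independent subset of it
  restricts to an independent family in the span of the monomials; x^D lies outside the span of this
  family, so adjoining it forces one element less. Finiteness of the global dimension comes out of
  the same count.\<close>

lemma cdim_global_bergman_space_less:
  assumes h: "hermitian_metric (\<O> k) h" and \<omega>: "volume_form \<omega>"
    and q: "int q = 2 * int D - 2 * k - 3" and D: "k < int D"
  shows "cdim (bergman_space h \<omega> UNIV (\<O> k)) < enat (card (degree_pairs D))"
proof -
  define \<Omega> where "\<Omega> = tube_region q"
  define V where "V = bergman_space h \<omega> UNIV (\<O> k)"
  define B where "B = basis_section k q ` degree_pairs D"
  have B: "finite B" "card B = card (degree_pairs D)"
    unfolding B_def using finite_degree_pairs card_image[OF basis_section_independent(1)] by auto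
  obtain C where C: "C \<subseteq> V" "sect.independent C" "V \<subseteq> sect.span C"
    using sect.maximal_independent_subset[of V] by blast
  have "C \<subseteq> sections UNIV (\<O> k)"
    using C(1) by (auto simp: V_def bergman_space_def)
  then have span: "sect.span C \<subseteq> sections UNIV (\<O> k)"
    by (rule sect.span_minimal[OF _ subspace_sections])
  \<comment> \<open>Injectivity is needed on the whole span, for independence of the image; all
    elements of the span are still global sections.\<close>
  have inj: "inj_on (restrict_section \<Omega>) (sect.span C)"
  proof (rule inj_onI)
    fix s t assume st: "s \<in> sect.span C" "t \<in> sect.span C" and eq: "restrict_section \<Omega> s = restrict_section \<Omega> t"
    have "s - t \<in> sections UNIV (\<O> k)"
      using st span by (intro sect.subspace_diff[OF subspace_sections]) auto
    then have "s - t = 0"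
    proof (rule global_section_zero[of _ _ q])
      fix p assume "p \<in> tube_region q"
      then show "(s - t) 1 p = 0"
        using fun_cong[OF fun_cong[OF eq], of 1 p] by (simp add: restrict_section_def \<Omega>_def)
    qed
    then show "s = t" by simp
  qed
  define R where "R = restrict_section \<Omega> ` C"
  have R: "sect.independent R"
    unfolding R_def by (rule sect_pair.linear_independent_injective_image[OF linear_restrict_section C(2) inj])
  have "R \<subseteq> sect.span B"
    using restrict_section_in_bergman_space[OF _ open_tube_region] C(1) bergman_space_subset_span[OF h \<omega> q]
    unfolding R_def B_def V_def \<Omega>_def by blast
  define m where "m = monomial_section k \<Omega> D 0"
  have "m \<in> B"
    unfolding B_def m_def \<Omega>_def by (rule image_eqI[of _ _ "(D, 0)"]) (auto simp: degree_pairs_def)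
  \<comment> \<open>Linearity makes every element of the span of R the restriction of one global
    section, and x^D extends to none.\<close>
  have "m \<notin> sect.span R"
  proof
    assume "m \<in> sect.span R"
    then obtain s where s: "s \<in> sect.span C" "m = restrict_section \<Omega> s"
      unfolding R_def sect_pair.linear_span_image[OF linear_restrict_section] by blast
    show False
    proof (rule monomial_not_global[OF _ D])
      show "s \<in> sections UNIV (\<O> k)" using s span by blast
      fix p assume p: "p \<in> tube_region q"
      then have "s 1 p = m 1 p"
        by (simp add: s(2) restrict_section_def \<Omega>_def)
      also have "\<dots> = ratio 1 2 p ^ D"
      proof -
        have "p \<in> chart_dom 1" using p tube_region_subset by blast
        moreover from this obtain x y where "p = param 1 (x, y)" by (rule chart_dom_cases)
        ultimately show ?thesis
          using p by (simp add: m_def monomial_section_def \<Omega>_def ratio_param)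
      qed
      finally show "s 1 p = ratio 1 2 p ^ D" .
    qed
  qed
  then have "sect.independent (insert m R)" "m \<notin> R"
    using R sect.span_superset[of R] by (auto simp: sect.independent_insert)
  moreover have "insert m R \<subseteq> sect.span B"
    using \<open>R \<subseteq> sect.span B\<close> sect.span_base[OF \<open>m \<in> B\<close>] by blast
  \<comment> \<open>Comparison with the finite set B yields finiteness and the strict inequality at
    once, as m is not in R.\<close>
  ultimately have "finite (insert m R) \<and> card (insert m R) \<le> card B"
    by (intro sect.independent_span_bound[OF B(1)])
  then have "finite R" "card R < card B"
    using \<open>m \<notin> R\<close> by auto
  moreover have "inj_on (restrict_section \<Omega>) C"
    using inj sect.span_superset by (rule inj_on_subset)
  ultimately have "finite C" "card C < card B"
    unfolding R_def by (auto simp: card_image dest: finite_imageD)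
  moreover have "sect.dim V = card C"
    using sect.basis_card_eq_dim[OF C(1,3,2)] by simp
  ultimately show ?thesis
    using C(3) B(2) unfolding cdim_def V_def[symmetric] by auto
qed

theorem theorem4p2:
  fixes k :: int
  shows "\<exists>\<Omega> :: P2 set. open \<Omega> \<and> connected \<Omega> \<and> \<Omega> \<noteq> {} \<and>
    (\<forall>h \<omega>. hermitian_metric (\<O> k) h \<longrightarrow> volume_form \<omega> \<longrightarrow>
      cdim (bergman_space h \<omega> UNIV (\<O> k)) < cdim (bergman_space h \<omega> \<Omega> (\<O> k)) \<and>
      cdim (bergman_space h \<omega> \<Omega> (\<O> k)) < \<infinity> \<and>
      (k < -2 \<longrightarrow> cdim (bergman_space h \<omega> \<Omega> (\<O> k)) = 1) \<and>
      (k \<ge> -2 \<longrightarrow> cdim (bergman_space h \<omega> \<Omega> (\<O> k)) = enat (nat ((k + 3) * (k + 4) div 2))))"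
proof -
  \<comment> \<open>\<open>nat\<close> realises the maximum with 0; below -2 only the constants are
    left.\<close>
  define D where "D = nat (k + 2)"
  \<comment> \<open>D >= k + 2 gives 2D - 2k - 3 >= 1, so nothing is truncated here.\<close>
  define q where "q = nat (2 * int D - 2 * k - 3)"
  have D: "k < int D" "int q = 2 * int D - 2 * k - 3"
    by (auto simp: D_def q_def)
  have card: "k < -2 \<Longrightarrow> card (degree_pairs D) = 1"
    "k \<ge> -2 \<Longrightarrow> card (degree_pairs D) = nat ((k + 3) * (k + 4) div 2)"
  proof -
    assume "k < -2"
    then show "card (degree_pairs D) = 1"
      using card_degree_pairs[of D] by (simp add: D_def)
  next
    assume "k \<ge> -2"
    then have "k = int D - 2"
      by (simp add: D_def)
    then have "(k + 3) * (k + 4) = (int D + 1) * (int D + 2)"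
      by (intro arg_cong2[of _ _ _ _ "(*)"]) simp_all
    also have "\<dots> = int ((D + 1) * (D + 2))"
      by (simp add: algebra_simps)
    also have "\<dots> = 2 * int (card (degree_pairs D))"
      unfolding card_degree_pairs[symmetric] by simp
    finally show "card (degree_pairs D) = nat ((k + 3) * (k + 4) div 2)"
      by simp
  qed
  have "tube_region q \<noteq> {}"
  proof -
    have "(0, 0) \<in> tube_domain q"
      by (simp add: tube_domain_def)
    then show ?thesis
      unfolding tube_region_def by blast
  qed
  \<comment> \<open>The region depends on k alone and is fixed before h and the volume form, which
    are arbitrary in both dimension lemmas.\<close>
  then show ?thesis
    using open_tube_region[of q] connected_tube_region[of q] card
      cdim_global_bergman_space_less[OF _ _ D(2,1)] cdim_bergman_space_tube_region[OF _ _ D(2)]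
    by (intro exI[of _ "tube_region q"]) (auto simp: one_enat_def)
qed

end
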